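(* Let $A$ be a complex unital Banach algebra with unit $e$, let $J$ be a (two-sided) ideal of $A$, and let $a\in A$. If $f$ is an analytic function in a neighborhood of the usual spectrum $\sigma(a)$ of $a$ which is non-constant on any connected component of $\sigma(a)$, then $$f(\sigma_{BF}(a))=\sigma_{BF}(f(a)).$$
   Context: $A$ is a complex Banach algebra with unit $e$, and $J$ is a two-sided ideal of $A$ (not assumed closed), with canonical projection $\pi:A\to A/J$. The element $f(a)\in A$ is defined by the holomorphic functional calculus. An element $x$ of a unital ring $R$ is Drazin invertible in $R$ if there exist $y\in R$ and $k\in\mathbb{N}$ such that $yxy=y$, $xy=yx$ and $x^k y x=x^k$. An element $a\in A$ is a B-Fredholm element of $A$ modulo $J$ if $\pi(a)$ is Drazin invertible in the quotient algebra $A/J$. The B-Fredholm spectrum of $a\in A$ (modulo $J$) is $$\sigma_{BF}(a)=\{\lambda\in\mathbb{C} : a-\lambda e \text{ is not a B-Fredholm element of } A \text{ modulo } J\}.$$ *)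

theory Defs
  imports
    "HOL-Algebra.Algebraic_Closure_Type"
    "HOL-Algebra.QuotRing"
    "HOL-Complex_Analysis.Complex_Analysis"
begin

section \<open>Complex unital Banach algebras\<close>

class complex_banach_algebra_1 = real_normed_algebra_1 + banach +
  fixes scaleC :: "complex \<Rightarrow> 'a \<Rightarrow> 'a"  (infixr \<open>*\<^sub>C\<close> 75)
  assumes scaleC_add_right: "c *\<^sub>C (x + y) = c *\<^sub>C x + c *\<^sub>C y"
    and scaleC_add_left: "(c + d) *\<^sub>C x = c *\<^sub>C x + d *\<^sub>C x"
    and scaleC_scaleC: "c *\<^sub>C d *\<^sub>C x = (c * d) *\<^sub>C x"
    and scaleC_of_real: "complex_of_real r *\<^sub>C x = r *\<^sub>R x"
    and scaleC_mult_left: "(c *\<^sub>C x) * y = c *\<^sub>C (x * y)"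
    and scaleC_mult_right: "x * (c *\<^sub>C y) = c *\<^sub>C (x * y)"
    and norm_scaleC: "norm (c *\<^sub>C x) = cmod c * norm x"

instantiation complex :: complex_banach_algebra_1
begin

definition scaleC_complex :: "complex \<Rightarrow> complex \<Rightarrow> complex" where
  "scaleC_complex c x = c * x"

instance
  by standard (simp_all add: scaleC_complex_def algebra_simps norm_mult scaleR_conv_of_real)

end

definition spectrum :: "'a::complex_banach_algebra_1 \<Rightarrow> complex set" where
  "spectrum a = {w. a - w *\<^sub>C 1 \<notin> Units ring_of_type_algebra}"

definition resolvent :: "'a::complex_banach_algebra_1 \<Rightarrow> complex \<Rightarrow> 'a" where
  "resolvent a z = inv\<^bsub>ring_of_type_algebra\<^esub> (z *\<^sub>C 1 - a)"


section \<open>Holomorphic functional calculus\<close>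

text \<open>
  A chain is a finite list of piecewise continuously differentiable paths. It is a cycle if its
  boundary vanishes: every point is the initial point of exactly as many of the paths as it is the
  final point of. The paths need not be closed individually.
\<close>

definition cycle_in :: "complex set \<Rightarrow> (real \<Rightarrow> complex) list \<Rightarrow> bool" where
  "cycle_in S \<Gamma> \<longleftrightarrow>
     (\<forall>\<gamma>\<in>set \<Gamma>. valid_path \<gamma> \<and> path_image \<gamma> \<subseteq> S) \<and>
     mset (map pathstart \<Gamma>) = mset (map pathfinish \<Gamma>)"

definition chain_index :: "(real \<Rightarrow> complex) list \<Rightarrow> complex \<Rightarrow> complex" where
  "chain_index \<Gamma> z = (\<Sum>\<gamma>\<leftarrow>\<Gamma>. winding_number \<gamma> z)"

definition surrounds_in :: "(real \<Rightarrow> complex) list \<Rightarrow> complex set \<Rightarrow> complex set \<Rightarrow> bool" where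
  "surrounds_in \<Gamma> K U \<longleftrightarrow>
     cycle_in (U - K) \<Gamma> \<and>
     (\<forall>z\<in>K. chain_index \<Gamma> z = 1) \<and> (\<forall>z. z \<notin> U \<longrightarrow> chain_index \<Gamma> z = 0)"

text \<open>Counterpart of \<open>contour_integral\<close>, which is restricted to complex-valued integrands.\<close>

definition chain_integral ::
    "(real \<Rightarrow> complex) list \<Rightarrow> (complex \<Rightarrow> 'a::complex_banach_algebra_1) \<Rightarrow> 'a" where
  "chain_integral \<Gamma> F =
     (\<Sum>\<gamma>\<leftarrow>\<Gamma>. integral {0..1}
        (\<lambda>t. vector_derivative \<gamma> (at t within {0..1}) *\<^sub>C F (\<gamma> t)))"

text \<open>
  The Dunford--Riesz integral. By Cauchy's theorem its value does not depend on the cycle and the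
  neighbourhood \<open>U\<close>, so an arbitrary choice is made.
\<close>

definition functional_calculus ::
    "(complex \<Rightarrow> complex) \<Rightarrow> 'a::complex_banach_algebra_1 \<Rightarrow> 'a" where
  "functional_calculus f a =
     (let \<Gamma> = (SOME \<Gamma>. \<exists>U. open U \<and> spectrum a \<subseteq> U \<and> f holomorphic_on U \<and>
                        surrounds_in \<Gamma> (spectrum a) U)
      in (1 / (2 * complex_of_real pi * \<i>)) *\<^sub>C chain_integral \<Gamma> (\<lambda>z. f z *\<^sub>C resolvent a z))"


section \<open>B-Fredholm elements modulo an ideal\<close>

definition Drazin_invertible :: "('b, 'c) ring_scheme \<Rightarrow> 'b \<Rightarrow> bool" where
  "Drazin_invertible R x \<longleftrightarrow> x \<in> carrier R \<and>
     (\<exists>y\<in>carrier R. \<exists>k::nat.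
        y \<otimes>\<^bsub>R\<^esub> x \<otimes>\<^bsub>R\<^esub> y = y \<and>
        x \<otimes>\<^bsub>R\<^esub> y = y \<otimes>\<^bsub>R\<^esub> x \<and>
        x [^]\<^bsub>R\<^esub> k \<otimes>\<^bsub>R\<^esub> y \<otimes>\<^bsub>R\<^esub> x = x [^]\<^bsub>R\<^esub> k)"

text \<open>The coset \<open>J +> a\<close> is the image of \<open>a\<close> under the canonical projection.\<close>

definition B_Fredholm :: "'a::complex_banach_algebra_1 set \<Rightarrow> 'a \<Rightarrow> bool" where
  "B_Fredholm J a \<longleftrightarrow>
     Drazin_invertible (ring_of_type_algebra Quot J) (J +>\<^bsub>ring_of_type_algebra\<^esub> a)"

definition BF_spectrum :: "'a::complex_banach_algebra_1 set \<Rightarrow> 'a \<Rightarrow> complex set" where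
  "BF_spectrum J a = {w. \<not> B_Fredholm J (a - w *\<^sub>C 1)}"

end

theory Submission
  imports Defs
begin

text \<open>
  The point is that the functional calculus factors through polynomials. Since \<open>f\<close> is not constant on
  any component of the compact spectrum, \<open>f - c\<close> has only finitely many zeros there, so
  \<open>f - c = (z - p\<^sub>1) \<cdots> (z - p\<^sub>n) g\<close> near the spectrum with \<open>g\<close> zero-free on it, and
  \<open>f(a) - c = (a - p\<^sub>1) \<cdots> (a - p\<^sub>n) g(a)\<close> with \<open>g(a)\<close> invertible. The image of such a
  product in \<open>A/J\<close> is Drazin invertible iff the image of every factor is: for the nontrivial direction, the
  factors belonging to distinct \<open>p\<^sub>i\<close> differ by nonzero scalars and can be cancelled from the relation
  expressing Drazin invertibility of the product, using that the Drazin inverse lies in the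
  double commutant.

  The functional calculus is accessible because vector-valued identities can be tested on bounded
  linear functionals (Hahn--Banach), which reduces them to Cauchy's theorem for cycles. The latter
  is obtained from the boundary of a union of small grid squares around the given cycle and the
  points of nonzero index, by exchanging the order of integration in Cauchy's formula.
\<close>

section \<open>Functionals on complex Banach algebras\<close>

text \<open>No closedness of \<open>J\<close> is assumed, so \<open>A/J\<close> is merely a ring: it
  carries no norm and no functional calculus. All analysis therefore takes place in
  \<open>A\<close>, and only algebraic identities and units cross over to the quotient.
  \<open>functional_calculus\<close> integrates over a cycle picked by \<open>SOME\<close>, about
  which nothing is known beyond its index conditions; it may consist of open paths and lie in an
  unknown neighbourhood. Hence Cauchy's theorem is needed for arbitrary cycles, in its homological
  form, so that the cycle can be exchanged for one inside a smaller neighbourhood, where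
  \<open>1 / g\<close> is holomorphic too. Multiplicativity of the calculus then turns this
  reciprocal into the inverse of \<open>g(a)\<close>. Only zeros of \<open>f - c\<close> inside the
  spectrum are divided out; this loses nothing, since \<open>a - p\<close> is a unit for every
  \<open>p\<close> outside it.\<close>

definition sublinear :: "('a::real_vector \<Rightarrow> real) \<Rightarrow> bool" where
  "sublinear p \<longleftrightarrow> (\<forall>x y. p (x + y) \<le> p x + p y) \<and> (\<forall>t x. t \<ge> 0 \<longrightarrow> p (t *\<^sub>R x) \<le> t * p x)"

lemma sublinear_add: "sublinear p \<Longrightarrow> p (x + y) \<le> p x + p y"
  by (simp add: sublinear_def)

text \<open>Applying the inequality with factor \<open>1 / t\<close> to the scaled vector gives the
  converse bound. This lets \<open>sublinear\<close> ask only for \<open>\<le>\<close>, which passes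
  easily to infima, while full homogeneity remains available.\<close>

lemma sublinear_scaleR: "sublinear p \<Longrightarrow> t \<ge> 0 \<Longrightarrow> p (t *\<^sub>R x) = t * p x"
proof (cases "t = 0")
  case True
  assume "sublinear p"
  then have "p 0 \<le> p 0 + p 0" "p 0 \<le> 0"
    using sublinear_add[of p 0 0] unfolding sublinear_def by (simp, force)
  then show ?thesis using True by simp
next
  case False
  assume p: "sublinear p" and "t \<ge> 0"
  then have "t > 0" using False by simp
  have scale: "p (s *\<^sub>R w) \<le> s * p w" if "s \<ge> 0" for s w
    using p that by (simp add: sublinear_def)
  have "p ((1 / t) *\<^sub>R (t *\<^sub>R x)) \<le> (1 / t) * p (t *\<^sub>R x)"
    by (rule scale) (use \<open>t > 0\<close> in simp)
  then have "t * p x \<le> p (t *\<^sub>R x)" using \<open>t > 0\<close> by (simp add: field_simps)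
  moreover have "p (t *\<^sub>R x) \<le> t * p x"
    by (rule scale) fact
  ultimately show ?thesis by simp
qed

lemma sublinear_zero: "sublinear p \<Longrightarrow> p 0 = 0"
  using sublinear_scaleR[of p 0 0] by simp

lemma sublinear_minus: "sublinear p \<Longrightarrow> - p (- x) \<le> p x"
  using sublinear_add[of p x "- x"] by (simp add: sublinear_zero)

text \<open>One statement serves both infima taken below, over a chain of functionals and over a
  half-line of parameters: directedness is asked only at the vectors in question. The lower bound
  \<open>B\<close> guarantees that the real-valued \<open>INF\<close> is a true infimum.\<close>

lemma sublinear_directed_INF:
  assumes "I \<noteq> {}" "\<And>x i. i \<in> I \<Longrightarrow> B x \<le> p i x"
    and add: "\<And>i j x y. i \<in> I \<Longrightarrow> j \<in> I \<Longrightarrow> \<exists>k\<in>I. p k (x + y) \<le> p i x + p j y"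
    and scale: "\<And>i t x. i \<in> I \<Longrightarrow> t \<ge> 0 \<Longrightarrow> \<exists>k\<in>I. p k (t *\<^sub>R x) \<le> t * p i x"
  shows "sublinear (\<lambda>x. INF i\<in>I. p i x)"
proof -
  define u where "u x = (INF i\<in>I. p i x)" for x
  have bdd: "bdd_below ((\<lambda>i. p i x) ` I)" for x
    using assms(2) by (auto intro: bdd_belowI[of _ "B x"])
  have u_le: "u x \<le> p i x" if "i \<in> I" for i x
    unfolding u_def by (rule cINF_lower[OF bdd that])
  have le_u: "c \<le> u x" if "\<And>i. i \<in> I \<Longrightarrow> c \<le> p i x" for c x
    unfolding u_def by (rule cINF_greatest) (use assms(1) that in auto)
  have 1: "u (x + y) \<le> p i x + p j y" if "i \<in> I" "j \<in> I" for i j x y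
    using add[OF that, of x y] u_le order_trans by blast
  \<comment> \<open>Infima are taken over one index at a time: \<open>j\<close> stays fixed while
    \<open>i\<close> varies, and only afterwards does \<open>j\<close> vary.\<close>
  have 2: "u (x + y) - p j y \<le> u x" if "j \<in> I" for j x y
    by (rule le_u) (use 1[OF _ that] in \<open>simp add: algebra_simps\<close>)
  have 3: "u (x + y) - u x \<le> u y" for x y
  proof (rule le_u)
    fix j assume "j \<in> I"
    then show "u (x + y) - u x \<le> p j y" using 2[of j x y] by linarith
  qed
  have 4: "u (t *\<^sub>R x) \<le> t * p i x" if "i \<in> I" "t \<ge> 0" for i t x
    using scale[OF that, of x] u_le order_trans by blast
  have "u (t *\<^sub>R x) \<le> t * u x" if "t \<ge> 0" for t x
  proof (cases "t = 0")
    case True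
    obtain i where "i \<in> I" using assms(1) by blast
    then show ?thesis using 4[of i 0 x] True by simp
  next
    case False
    then have "t > 0" using that by simp
    have "u (t *\<^sub>R x) / t \<le> u x"
      by (rule le_u) (use 4[OF _ that, of _ x] \<open>t > 0\<close> in \<open>simp add: field_simps\<close>)
    then show ?thesis using \<open>t > 0\<close> by (simp add: field_simps)
  qed
  moreover have "u (x + y) \<le> u x + u y" for x y using 3[of x y] by linarith
  ultimately show ?thesis unfolding u_def[symmetric] sublinear_def by blast
qed

text \<open>The functional is the infimum over \<open>t \<ge> 0\<close> of \<open>v t x\<close>;
  \<open>t = 0\<close> and \<open>t = 1\<close> give the two bounds. For a minimal \<open>p\<close>
  it must equal \<open>p\<close>, which forces additivity in the direction \<open>y\<close>; for the
  norm it leads to a linear functional attaining the norm at \<open>y\<close>.\<close>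

lemma sublinear_tilt:
  assumes p: "sublinear p"
  obtains r where "sublinear r" "\<And>x. r x \<le> p x" "\<And>x. r x \<le> p (x + y) - p y"
proof -
  define v where "v t x = p (x + t *\<^sub>R y) - t * p y" for t x
  have low: "- p (- x) \<le> v t x" if "t \<in> {0..}" for t x
    using sublinear_add[OF p, of "x + t *\<^sub>R y" "- x"] sublinear_scaleR[OF p, of t y] that
    by (simp add: v_def)
  have "sublinear (\<lambda>x. INF t\<in>{0..}. v t x)"
  proof (rule sublinear_directed_INF[where B = "\<lambda>x. - p (- x)"])
    fix i j x x' assume "i \<in> {0::real..}" "j \<in> {0::real..}"
    moreover have "v (i + j) (x + x') \<le> v i x + v j x'"
      using sublinear_add[OF p, of "x + i *\<^sub>R y" "x' + j *\<^sub>R y"] by (simp add: v_def algebra_simps)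
    ultimately show "\<exists>k\<in>{0..}. v k (x + x') \<le> v i x + v j x'"
      by (intro bexI[of _ "i + j"]) auto
  next
    fix i t x assume "i \<in> {0::real..}" "(t::real) \<ge> 0"
    moreover have "v (t * i) (t *\<^sub>R x) \<le> t * v i x"
      using sublinear_scaleR[OF p \<open>t \<ge> 0\<close>, of "x + i *\<^sub>R y"] by (simp add: v_def algebra_simps)
    ultimately show "\<exists>k\<in>{0..}. v k (t *\<^sub>R x) \<le> t * v i x"
      by (intro bexI[of _ "t * i"]) auto
  qed (use low in auto)
  moreover have le: "(INF t\<in>{0..}. v t x) \<le> v s x" if "s \<in> {0..}" for s x
    by (rule cINF_lower) (use that low in \<open>auto intro!: bdd_belowI[of _ "- p (- x)"]\<close>)
  moreover have "(INF t\<in>{0..}. v t x) \<le> p x" "(INF t\<in>{0..}. v t x) \<le> p (x + y) - p y" for x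
    using le[of 0 x] le[of 1 x] by (simp_all add: v_def)
  ultimately show thesis using that by blast
qed

text \<open>The Hahn--Banach argument: a minimal sublinear functional is linear.\<close>

lemma sublinear_dominates_linear:
  fixes q :: "'a::real_vector \<Rightarrow> real"
  assumes q: "sublinear q"
  obtains p where "linear p" "\<And>x. p x \<le> q x"
proof -
  define A where "A = {p. sublinear p \<and> p \<le> q}"
  have A: "sublinear p" "p x \<le> q x" if "p \<in> A" for p x
    using that by (auto simp: A_def le_fun_def)
  \<comment> \<open>Zorn's lemma yields maximal elements, so the order is reversed to obtain a
    minimal functional.\<close>
  have "\<exists>p\<in>A. \<forall>r\<in>A. r \<le> p \<longrightarrow> r = p"
  proof (rule predicate_Zorn)
    show "partial_order_on A (relation_of (\<lambda>p r. r \<le> p) A)"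
      by (auto simp: partial_order_on_def preorder_on_def refl_on_def trans_def antisym_def relation_of_def)
    fix C assume C: "C \<in> Chains (relation_of (\<lambda>p r. r \<le> p) A)"
    have chain: "p \<le> r \<or> r \<le> p" if "p \<in> C" "r \<in> C" for p r
      using C that by (auto simp: Chains_def relation_of_def)
    show "\<exists>u\<in>A. \<forall>p\<in>C. u \<le> p"
    proof (cases "C = {}")
      case True
      then show ?thesis using q by (auto simp: A_def)
    next
      case False
      have CA: "p \<in> A" if "p \<in> C" for p using C that by (auto simp: Chains_def relation_of_def)
      \<comment> \<open>Every member of the chain lies below \<open>q\<close>, hence above
        \<open>- q (- x)\<close>; this bound is uniform in the chain and makes its infimum
        finite.\<close>
      have low: "- q (- x) \<le> p x" if "p \<in> C" for p x
        using sublinear_minus[of p x] A[OF CA[OF that]] by (meson dual_order.trans neg_le_iff_le)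
      have "sublinear (\<lambda>x. INF p\<in>C. p x)"
      proof (rule sublinear_directed_INF[where B = "\<lambda>x. - q (- x)"])
        fix p r x y assume pr: "p \<in> C" "r \<in> C"
        show "\<exists>k\<in>C. k (x + y) \<le> p x + r y"
        proof (cases "p \<le> r")
          case True
          then have "p y \<le> r y" by (simp add: le_fun_def)
          then show ?thesis
            using sublinear_add[OF A(1)[OF CA[OF pr(1)]], of x y] pr by (intro bexI[of _ p]) auto
        next
          case False
          then have "r \<le> p" using chain[OF pr] by blast
          then have "r x \<le> p x" by (simp add: le_fun_def)
          then show ?thesis
            using sublinear_add[OF A(1)[OF CA[OF pr(2)]], of x y] pr by (intro bexI[of _ r]) auto
        qed
      next
        fix p x and t :: real assume "p \<in> C" "t \<ge> 0"
        then show "\<exists>k\<in>C. k (t *\<^sub>R x) \<le> t * p x"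
          using sublinear_scaleR[OF A(1)[OF CA]] by (intro bexI[of _ p]) auto
      qed (use low False in auto)
      moreover have le: "(INF p\<in>C. p x) \<le> r x" if "r \<in> C" for r x
        by (rule cINF_lower) (use that low in \<open>auto intro!: bdd_belowI[of _ "- q (- x)"]\<close>)
      moreover have "(INF p\<in>C. p x) \<le> q x" for x
      proof -
        obtain r where "r \<in> C" using False by blast
        then show ?thesis using le[of r x] A(2)[OF CA, of r x] by linarith
      qed
      ultimately show ?thesis
        by (intro bexI[of _ "\<lambda>x. INF p\<in>C. p x"]) (auto simp: A_def le_fun_def)
    qed
  qed
  then obtain p where pA: "p \<in> A" and min: "\<And>r. r \<in> A \<Longrightarrow> r \<le> p \<Longrightarrow> r = p" by blast
  have p: "sublinear p" using A(1)[OF pA] .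
  \<comment> \<open>The tilt of \<open>p\<close> in the direction \<open>y\<close> lies below
    \<open>p\<close>, hence equals \<open>p\<close> by minimality; its second bound is then
    superadditivity.\<close>
  have add: "p (x + y) = p x + p y" for x y
  proof -
    obtain r where r: "sublinear r" "\<And>x. r x \<le> p x" "\<And>x. r x \<le> p (x + y) - p y"
      using sublinear_tilt[OF p, of y] by blast
    then have "r = p" using A(2)[OF pA] by (intro min) (auto simp: A_def le_fun_def intro: order_trans)
    then show ?thesis using r(3)[of x] sublinear_add[OF p, of x y] by simp
  qed
  have neg: "p (- x) = - p x" for x using add[of x "- x"] sublinear_zero[OF p] by simp
  have "p (t *\<^sub>R x) = t * p x" for t x
  proof (cases "t \<ge> 0")
    case True then show ?thesis by (rule sublinear_scaleR[OF p])
  next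
    case False
    then have "p ((- t) *\<^sub>R x) = - t * p x" by (intro sublinear_scaleR[OF p]) auto
    then show ?thesis using neg[of "t *\<^sub>R x"] by simp
  qed
  then have "linear p" using add by (intro linearI) auto
  then show thesis using A(2)[OF pA] that by blast
qed

section \<open>Complex-linear functionals and separation of points\<close>

definition functional :: "('a::complex_banach_algebra_1 \<Rightarrow> complex) \<Rightarrow> bool" where
  "functional \<phi> \<longleftrightarrow> bounded_linear \<phi> \<and> (\<forall>c x. \<phi> (c *\<^sub>C x) = c * \<phi> x)"

lemma functional_add: "functional \<phi> \<Longrightarrow> \<phi> (x + y) = \<phi> x + \<phi> y"
  by (simp add: functional_def linear_add bounded_linear.linear)

lemma functional_diff: "functional \<phi> \<Longrightarrow> \<phi> (x - y) = \<phi> x - \<phi> y"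
  by (simp add: functional_def linear_diff bounded_linear.linear)

lemma functional_scaleC: "functional \<phi> \<Longrightarrow> \<phi> (c *\<^sub>C x) = c * \<phi> x"
  by (simp add: functional_def)

lemma functional_zero: "functional \<phi> \<Longrightarrow> \<phi> 0 = 0"
  by (simp add: functional_def linear_0 bounded_linear.linear)

lemma functional_mult_left: "functional \<phi> \<Longrightarrow> functional (\<lambda>x. \<phi> (b * x))"
  unfolding functional_def
  by (auto intro: bounded_linear_compose bounded_linear_mult_right simp: scaleC_mult_right)

lemma functional_mult_right: "functional \<phi> \<Longrightarrow> functional (\<lambda>x. \<phi> (x * b))"
  unfolding functional_def
  by (auto intro: bounded_linear_compose bounded_linear_mult_left simp: scaleC_mult_left)

text \<open>Hahn-Banach over the reals followed by complexification. Tilting the norm in the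
  direction \<open>z = x - y\<close> provides a real linear \<open>p\<close> dominated by the norm
  with \<open>p z > 0\<close>.\<close>

lemma functional_separates:
  fixes x :: "'a::complex_banach_algebra_1"
  assumes "\<And>\<phi>. functional \<phi> \<Longrightarrow> \<phi> x = \<phi> y"
  shows "x = y"
proof (rule ccontr)
  assume "x \<noteq> y"
  define z where "z = x - y"
  have "sublinear (norm :: 'a \<Rightarrow> real)" by (auto simp: sublinear_def norm_triangle_ineq)
  from sublinear_tilt[OF this, of z] obtain r where
    r: "sublinear r" "\<And>w. r w \<le> norm w" "\<And>w. r w \<le> norm (w + z) - norm z" by blast
  obtain p where p: "linear p" "\<And>w. p w \<le> r w" using sublinear_dominates_linear[OF r(1)] by blast
  have p_le: "\<bar>p w\<bar> \<le> norm w" for w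
    using p(2)[of w] r(2)[of w] p(2)[of "- w"] r(2)[of "- w"] by (simp add: linear_neg[OF p(1)])
  have "p z > 0"
  proof -
    \<comment> \<open>At \<open>- z\<close> the tilted bound reads
      \<open>norm 0 - norm z\<close>.\<close>
    have "- p z \<le> - norm z"
      using p(2)[of "- z"] r(3)[of "- z"] by (simp add: linear_neg[OF p(1)])
    moreover have "norm z > 0" using \<open>x \<noteq> y\<close> by (simp add: z_def)
    ultimately show ?thesis by linarith
  qed
  have scaleC_scaleR: "c *\<^sub>C (t *\<^sub>R w) = t *\<^sub>R (c *\<^sub>C w)" for c t and w :: 'a
    by (metis scaleC_of_real scaleC_scaleC mult.commute)
  \<comment> \<open>The imaginary part is forced by compatibility with multiplication by
    \<open>\<i>\<close>.\<close>
  define \<phi> where "\<phi> w = Complex (p w) (- p (\<i> *\<^sub>C w))" for w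
  have "bounded_linear \<phi>"
  proof (rule bounded_linear_intro[of _ 2])
    show "\<phi> (v + w) = \<phi> v + \<phi> w" for v w
      by (simp add: \<phi>_def scaleC_add_right linear_add[OF p(1)] complex_eq_iff)
    show "\<phi> (t *\<^sub>R w) = t *\<^sub>R \<phi> w" for t w
      by (simp add: \<phi>_def scaleC_scaleR linear_scale[OF p(1)] complex_eq_iff)
    show "norm (\<phi> w) \<le> norm w * 2" for w
    proof -
      have "norm (\<phi> w) \<le> \<bar>p w\<bar> + \<bar>p (\<i> *\<^sub>C w)\<bar>"
        using cmod_le[of "\<phi> w"] by (simp add: \<phi>_def)
      then show ?thesis using p_le[of w] p_le[of "\<i> *\<^sub>C w"] by (simp add: norm_scaleC)
    qed
  qed
  moreover have "\<phi> (c *\<^sub>C w) = c * \<phi> w" for c w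
  proof -
    have lin: "p (d *\<^sub>C w) = Re d * p w + Im d * p (\<i> *\<^sub>C w)" for d
    proof -
      have "d *\<^sub>C w = (of_real (Re d) + of_real (Im d) * \<i>) *\<^sub>C w"
        by (rule arg_cong[where f = "\<lambda>d. d *\<^sub>C w"]) (simp add: complex_eq_iff)
      also have "\<dots> = Re d *\<^sub>R w + Im d *\<^sub>R (\<i> *\<^sub>C w)"
        by (simp add: scaleC_add_left scaleC_of_real scaleC_scaleC[symmetric])
      finally show ?thesis by (simp add: linear_add[OF p(1)] linear_scale[OF p(1)])
    qed
    show ?thesis
      using lin[of c] lin[of "\<i> * c"] by (simp add: \<phi>_def scaleC_scaleC complex_eq_iff)
  qed
  ultimately have "functional \<phi>" by (simp add: functional_def)
  then have "\<phi> z = 0" using assms[of \<phi>] by (simp add: z_def functional_diff)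
  then show False using \<open>p z > 0\<close> by (simp add: \<phi>_def complex_eq_iff)
qed

section \<open>Cycles along the edges of a square grid\<close>

text \<open>On the edges whose reverse is also present, swapping is an involution that changes the
  sign of \<open>I\<close>, so their sum equals its own negative. This one cancellation is used for
  winding numbers, for contour integrals and for counting endpoints.\<close>

lemma sum_antisymmetric_boundary:
  fixes I :: "'v \<times> 'v \<Rightarrow> 'b::real_vector"
  assumes "finite E"
    and "\<And>u v. (u, v) \<in> E \<Longrightarrow> (v, u) \<in> E \<Longrightarrow> I (v, u) = - I (u, v)"
  shows "sum I {e \<in> E. prod.swap e \<notin> E} = sum I E"
proof -
  let ?D = "{e \<in> E. prod.swap e \<in> E}"
  have "bij_betw prod.swap ?D ?D"
    by (rule bij_betwI[of _ _ _ prod.swap]) (simp_all add: Pi_iff)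
  then have "sum I ?D = sum (\<lambda>e. I (prod.swap e)) ?D"
    by (rule sum.reindex_bij_betw[symmetric])
  also have "\<dots> = (\<Sum>e\<in>?D. - I e)"
  proof (rule sum.cong)
    fix e assume "e \<in> ?D"
    then show "I (prod.swap e) = - I e"
      using assms(2)[of "fst e" "snd e"] by (simp add: prod.swap_def)
  qed simp
  finally have "sum I ?D = - sum I ?D"
    by (simp add: sum_negf)
  then have D: "sum I ?D = 0"
    using real_vector.scale_eq_0_iff[of 2 "sum I ?D"] by (simp add: scaleR_2 eq_neg_iff_add_eq_0)
  have "sum I E = sum I ({e \<in> E. prod.swap e \<notin> E} \<union> ?D)"
    by (rule arg_cong[where f = "sum I"]) auto
  also have "\<dots> = sum I {e \<in> E. prod.swap e \<notin> E} + sum I ?D"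
    by (rule sum.union_disjoint) (use assms(1) in auto)
  finally show ?thesis using D by simp
qed

section \<open>Cells and oriented edges of a square grid\<close>

definition grid_point :: "real \<Rightarrow> int \<times> int \<Rightarrow> complex" where
  "grid_point \<delta> p = Complex (\<delta> * of_int (fst p)) (\<delta> * of_int (snd p))"

definition grid_path :: "real \<Rightarrow> (int \<times> int) \<times> (int \<times> int) \<Rightarrow> real \<Rightarrow> complex" where
  "grid_path \<delta> e = linepath (grid_point \<delta> (fst e)) (grid_point \<delta> (snd e))"

definition cell :: "real \<Rightarrow> int \<times> int \<Rightarrow> complex set" where
  "cell \<delta> s = cbox (grid_point \<delta> s) (grid_point \<delta> (fst s + 1, snd s + 1))"

text \<open>The counterclockwise boundary of the cell with lower left corner \<open>s\<close>.
  Vertices are kept as integers, so that coincidence and reversal of edges are combinatorial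
  questions.\<close>

definition cell_edges :: "int \<times> int \<Rightarrow> ((int \<times> int) \<times> (int \<times> int)) set" where
  "cell_edges s = (let m = fst s; n = snd s in
     {((m, n), (m+1, n)), ((m+1, n), (m+1, n+1)), ((m+1, n+1), (m, n+1)), ((m, n+1), (m, n))})"

lemma finite_cell_edges [simp]: "finite (cell_edges s)"
  by (simp add: cell_edges_def Let_def)

text \<open>All cells have the same orientation, so two neighbours run through their common edge in
  opposite directions and share no oriented edge.\<close>

lemma cell_edges_disjoint: "s \<noteq> t \<Longrightarrow> cell_edges s \<inter> cell_edges t = {}"
  by (cases s; cases t) (auto simp: cell_edges_def Let_def)

lemma sum_cell_edges:
  "sum I (cell_edges (m, n)) =
     I ((m, n), (m+1, n)) + I ((m+1, n), (m+1, n+1)) + I ((m+1, n+1), (m, n+1)) + I ((m, n+1), (m, n))"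
  for I :: "_ \<Rightarrow> 'b::comm_monoid_add"
  by (simp add: cell_edges_def Let_def algebra_simps)

lemma mem_cell:
  "z \<in> cell \<delta> (m, n) \<longleftrightarrow>
     \<delta> * m \<le> Re z \<and> Re z \<le> \<delta> * (m + 1) \<and> \<delta> * n \<le> Im z \<and> Im z \<le> \<delta> * (n + 1)"
  by (auto simp: cell_def grid_point_def in_cbox_complex_iff)

lemma path_image_grid_path_subset_cell:
  assumes "\<delta> > 0" "e \<in> cell_edges s"
  shows "path_image (grid_path \<delta> e) \<subseteq> cell \<delta> s"
proof -
  have "grid_point \<delta> (fst e) \<in> cell \<delta> s" "grid_point \<delta> (snd e) \<in> cell \<delta> s"
    using assms by (cases s; auto simp: cell_edges_def Let_def mem_cell grid_point_def)+
  then show ?thesis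
    by (simp add: grid_path_def cell_def closed_segment_subset)
qed

text \<open>The witness is the neighbour across the edge. It shows later that a boundary edge of a
  union of cells also lies in a cell outside the union, hence misses the set being covered.\<close>

lemma swap_edge_obtain_cell:
  assumes "e \<in> cell_edges s"
  obtains t where "prod.swap e \<in> cell_edges t"
proof -
  obtain m n where s: "s = (m, n)" by (cases s)
  consider "e = ((m, n), (m+1, n))" | "e = ((m+1, n), (m+1, n+1))"
    | "e = ((m+1, n+1), (m, n+1))" | "e = ((m, n+1), (m, n))"
    using assms by (auto simp: cell_edges_def Let_def s)
  then show thesis
  proof cases
    case 1
    show thesis by (rule that[of "(m, n - 1)"]) (simp add: 1 cell_edges_def Let_def)
  next
    case 2
    show thesis by (rule that[of "(m + 1, n)"]) (simp add: 2 cell_edges_def Let_def)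
  next
    case 3
    show thesis by (rule that[of "(m, n + 1)"]) (simp add: 3 cell_edges_def Let_def)
  next
    case 4
    show thesis by (rule that[of "(m - 1, n)"]) (simp add: 4 cell_edges_def Let_def)
  qed
qed

lemma grid_path_swap: "grid_path \<delta> (v, u) = reversepath (grid_path \<delta> (u, v))"
  by (simp add: grid_path_def reversepath_linepath)

lemma valid_path_grid_path [simp]: "valid_path (grid_path \<delta> e)"
  by (simp add: grid_path_def)

lemma pathstart_grid_path [simp]: "pathstart (grid_path \<delta> e) = grid_point \<delta> (fst e)"
  by (simp add: grid_path_def)

lemma pathfinish_grid_path [simp]: "pathfinish (grid_path \<delta> e) = grid_point \<delta> (snd e)"
  by (simp add: grid_path_def)

lemma path_grid_path [simp]: "path (grid_path \<delta> e)"
  by (simp add: grid_path_def)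

lemma rectpath_cell:
  "rectpath (grid_point \<delta> (m, n)) (grid_point \<delta> (m + 1, n + 1)) =
     grid_path \<delta> ((m, n), (m+1, n)) +++ grid_path \<delta> ((m+1, n), (m+1, n+1)) +++
     grid_path \<delta> ((m+1, n+1), (m, n+1)) +++ grid_path \<delta> ((m, n+1), (m, n))"
  by (simp add: rectpath_def Let_def grid_path_def grid_point_def)

lemma sum_winding_number_cell_edges:
  assumes "\<delta> > 0" "\<And>e. e \<in> cell_edges (m, n) \<Longrightarrow> z \<notin> path_image (grid_path \<delta> e)"
  shows "(\<Sum>e\<in>cell_edges (m, n). winding_number (grid_path \<delta> e) z) =
           (if z \<in> cell \<delta> (m, n) then 1 else 0)"
proof -
  let ?R = "rectpath (grid_point \<delta> (m, n)) (grid_point \<delta> (m + 1, n + 1))"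
  have le: "Re (grid_point \<delta> (m, n)) \<le> Re (grid_point \<delta> (m + 1, n + 1))"
    "Im (grid_point \<delta> (m, n)) \<le> Im (grid_point \<delta> (m + 1, n + 1))"
    using assms(1) by (auto simp: grid_point_def)
  have e: "z \<notin> path_image (grid_path \<delta> ((m, n), (m+1, n)))"
    "z \<notin> path_image (grid_path \<delta> ((m+1, n), (m+1, n+1)))"
    "z \<notin> path_image (grid_path \<delta> ((m+1, n+1), (m, n+1)))"
    "z \<notin> path_image (grid_path \<delta> ((m, n+1), (m, n)))"
    by (intro assms(2); simp add: cell_edges_def)+
  then have nz: "z \<notin> path_image ?R"
    unfolding rectpath_cell by (simp add: path_image_join)
  have "winding_number ?R z = (\<Sum>e\<in>cell_edges (m, n). winding_number (grid_path \<delta> e) z)"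
    using e unfolding rectpath_cell sum_cell_edges
    by (simp add: winding_number_join path_image_join)
  moreover have "winding_number ?R z = (if z \<in> cell \<delta> (m, n) then 1 else 0)"
  proof (cases "z \<in> cell \<delta> (m, n)")
    case True
    then have "z \<in> box (grid_point \<delta> (m, n)) (grid_point \<delta> (m + 1, n + 1))"
      using nz le by (simp add: path_image_rectpath_cbox_minus_box cell_def)
    then show ?thesis using True by (simp add: winding_number_rectpath)
  next
    case False
    then show ?thesis using le by (simp add: winding_number_rectpath_outside cell_def)
  qed
  ultimately show ?thesis by simp
qed

lemma sum_contour_integral_cell_edges:
  assumes "\<delta> > 0" "f holomorphic_on U" "open U" "cell \<delta> (m, n) \<subseteq> U"
  shows "(\<Sum>e\<in>cell_edges (m, n). contour_integral (grid_path \<delta> e) f) = 0"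
proof -
  let ?R = "rectpath (grid_point \<delta> (m, n)) (grid_point \<delta> (m + 1, n + 1))"
  have int: "f contour_integrable_on grid_path \<delta> e" if "e \<in> cell_edges (m, n)" for e
    by (rule contour_integrable_holomorphic_simple[of f U])
       (use assms path_image_grid_path_subset_cell[OF assms(1) that] in auto)
  have e: "f contour_integrable_on grid_path \<delta> ((m, n), (m+1, n))"
    "f contour_integrable_on grid_path \<delta> ((m+1, n), (m+1, n+1))"
    "f contour_integrable_on grid_path \<delta> ((m+1, n+1), (m, n+1))"
    "f contour_integrable_on grid_path \<delta> ((m, n+1), (m, n))"
    by (intro int; simp add: cell_edges_def)+
  have "path_image ?R \<subseteq> cell \<delta> (m, n)"
    unfolding cell_def using assms(1)
    by (simp add: path_image_rectpath_subset_cbox grid_point_def)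
  then have "(f has_contour_integral 0) ?R"
    using assms by (intro Cauchy_theorem_convex_simple[of f "cell \<delta> (m, n)"])
      (auto simp: cell_def intro: holomorphic_on_subset)
  then have "contour_integral ?R f = 0" by (rule contour_integral_unique)
  moreover have "contour_integral ?R f = (\<Sum>e\<in>cell_edges (m, n). contour_integral (grid_path \<delta> e) f)"
    using e unfolding rectpath_cell sum_cell_edges by simp
  ultimately show ?thesis by simp
qed

text \<open>Reversed pairs cancel, so the boundary sum is the sum over all cells, each contributing
  1 or 0. The point must avoid inner edges too, since the cells are counted one by one.\<close>

lemma chain_index_grid_boundary:
  assumes "\<delta> > 0" "finite S" "z \<notin> (\<Union>s\<in>S. \<Union>e\<in>cell_edges s. path_image (grid_path \<delta> e))"
    and "B = {e \<in> \<Union>(cell_edges ` S). prod.swap e \<notin> \<Union>(cell_edges ` S)}"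
  shows "(\<Sum>e\<in>B. winding_number (grid_path \<delta> e) z) = of_nat (card {s \<in> S. z \<in> cell \<delta> s})"
proof -
  have "(\<Sum>e\<in>B. winding_number (grid_path \<delta> e) z) =
      (\<Sum>e\<in>\<Union>(cell_edges ` S). winding_number (grid_path \<delta> e) z)"
    unfolding assms(4)
  proof (rule sum_antisymmetric_boundary)
    fix u v assume "(u, v) \<in> \<Union>(cell_edges ` S)"
    then have "z \<notin> path_image (grid_path \<delta> (u, v))" using assms(3) by blast
    then show "winding_number (grid_path \<delta> (v, u)) z = - winding_number (grid_path \<delta> (u, v)) z"
      unfolding grid_path_swap[of \<delta> v u] by (simp add: winding_number_reversepath)
  qed (use assms in auto)
  also have "\<dots> = (\<Sum>s\<in>S. \<Sum>e\<in>cell_edges s. winding_number (grid_path \<delta> e) z)"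
    by (rule sum.UNION_disjoint) (use assms cell_edges_disjoint in auto)
  also have "\<dots> = (\<Sum>s\<in>S. if z \<in> cell \<delta> s then 1 else 0)"
  proof (rule sum.cong)
    fix s assume "s \<in> S"
    then show "(\<Sum>e\<in>cell_edges s. winding_number (grid_path \<delta> e) z) = (if z \<in> cell \<delta> s then 1 else 0)"
      using assms(3) sum_winding_number_cell_edges[OF assms(1), of "fst s" "snd s" z] by force
  qed simp
  also have "\<dots> = of_nat (card {s \<in> S. z \<in> cell \<delta> s})"
    using assms(2) by (simp add: sum.If_cases Int_def)
  finally show ?thesis .
qed

text \<open>A point of the covered set may lie on an inner edge, where cells cannot be counted. A
  small shift to the upper right moves it into the interior of exactly one cell, found by rounding
  both coordinates down.\<close>

lemma diagonal_shift_avoids_grid: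
  assumes "\<delta> > 0"
  shows "\<forall>\<^sub>F \<epsilon> in at_right 0. \<forall>s. (\<forall>e\<in>cell_edges s. z + of_real \<epsilon> * Complex 1 1 \<notin> path_image (grid_path \<delta> e)) \<and>
           (z + of_real \<epsilon> * Complex 1 1 \<in> cell \<delta> s \<longleftrightarrow> s = (\<lfloor>Re z / \<delta>\<rfloor>, \<lfloor>Im z / \<delta>\<rfloor>))"
proof -
  define m n where "m = \<lfloor>Re z / \<delta>\<rfloor>" and "n = \<lfloor>Im z / \<delta>\<rfloor>"
  have m: "\<delta> * m \<le> Re z" "Re z < \<delta> * (m + 1)" and n: "\<delta> * n \<le> Im z" "Im z < \<delta> * (n + 1)"
    using assms floor_divide_lower[OF assms, of "Re z"] floor_divide_upper[OF assms, of "Re z"]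
      floor_divide_lower[OF assms, of "Im z"] floor_divide_upper[OF assms, of "Im z"]
    unfolding m_def n_def by (simp_all add: mult.commute)
  \<comment> \<open>The room left up to the right and the upper side of that cell.\<close>
  define d where "d = min (\<delta> * (m + 1) - Re z) (\<delta> * (n + 1) - Im z)"
  have "d > 0" using m n by (simp add: d_def)
  have *: "(\<forall>e\<in>cell_edges s. z + of_real \<epsilon> * Complex 1 1 \<notin> path_image (grid_path \<delta> e)) \<and>
           (z + of_real \<epsilon> * Complex 1 1 \<in> cell \<delta> s \<longleftrightarrow> s = (m, n))"
    if \<epsilon>: "0 < \<epsilon>" "\<epsilon> < d" for \<epsilon> s
  proof -
    obtain k l where s: "s = (k, l)" by (cases s)
    let ?w = "z + of_real \<epsilon> * Complex 1 1"
    have w: "\<delta> * m < Re ?w" "Re ?w < \<delta> * (m + 1)" "\<delta> * n < Im ?w" "Im ?w < \<delta> * (n + 1)"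
      using m n \<epsilon> by (auto simp: d_def)
    have far: "x < \<delta> * k \<or> \<delta> * k < x" if "\<delta> * j < x" "x < \<delta> * (j + 1)" for x :: real and k j :: int
    proof (cases "k \<le> j")
      case True
      then have "\<delta> * k \<le> \<delta> * j" using assms by simp
      then show ?thesis using that by linarith
    next
      case False
      then have "\<delta> * (j + 1) \<le> \<delta> * k" using assms by (simp add: int_less_real_le)
      then show ?thesis using that by linarith
    qed
    have nRe: "Re ?w \<noteq> \<delta> * i" for i :: int using far[OF w(1,2), of i] by auto
    have nIm: "Im ?w \<noteq> \<delta> * i" for i :: int using far[OF w(3,4), of i] by auto
    have "?w \<notin> path_image (grid_path \<delta> e)" if "e \<in> cell_edges s" for e
    proof
      assume "?w \<in> path_image (grid_path \<delta> e)"
      then obtain u where u: "?w = (1 - u) *\<^sub>R grid_point \<delta> (fst e) + u *\<^sub>R grid_point \<delta> (snd e)"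
        by (auto simp: grid_path_def closed_segment_def)
      have "fst (fst e) = fst (snd e) \<or> snd (fst e) = snd (snd e)"
        using that by (auto simp: cell_edges_def s Let_def)
      then show False
      proof
        assume "fst (fst e) = fst (snd e)"
        then have "Re ?w = \<delta> * fst (fst e)"
          unfolding u by (simp add: grid_point_def algebra_simps)
        then show False using nRe by blast
      next
        assume "snd (fst e) = snd (snd e)"
        then have "Im ?w = \<delta> * snd (fst e)"
          unfolding u by (simp add: grid_point_def algebra_simps)
        then show False using nIm by blast
      qed
    qed
    moreover have "?w \<in> cell \<delta> s \<longleftrightarrow> s = (m, n)"
    proof
      assume "s = (m, n)"
      then show "?w \<in> cell \<delta> s" using w by (simp add: mem_cell)
    next
      assume *: "?w \<in> cell \<delta> s"
      have eq: "k = j" if "\<delta> * k \<le> x" "x \<le> \<delta> * (k + 1)" "\<delta> * j < x" "x < \<delta> * (j + 1)" for x :: real and k j :: int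
      proof -
        have "\<delta> * k < \<delta> * (j + 1)" "\<delta> * j < \<delta> * (k + 1)" using that by linarith+
        then have "real_of_int k < j + 1" "real_of_int j < k + 1"
          using assms by (simp_all add: mult_less_cancel_left_pos)
        then show "k = j" by linarith
      qed
      show "s = (m, n)"
        using * w unfolding s mem_cell by (auto intro!: eq[of k "Re ?w" m] eq[of l "Im ?w" n])
    qed
    ultimately show ?thesis by blast
  qed
  show ?thesis
    unfolding eventually_at_right_field m_def[symmetric] n_def[symmetric]
    using \<open>d > 0\<close> * by blast
qed

lemma sum_list_map_set: "distinct xs \<Longrightarrow> (\<Sum>x\<leftarrow>map g xs. f x) = (\<Sum>x\<in>set xs. f (g x))"
  for f :: "'c \<Rightarrow> 'b::comm_monoid_add"
  by (simp add: sum_list_distinct_conv_sum_set o_def)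

text \<open>The cycle consists of the boundary edges of the union of all cells that meet
  \<open>K\<close>. The vanishing of integrals is read off from Cauchy's theorem in each cell; it is
  recorded here because the general theorem for cycles is derived from it. Straight paths keep later
  integrals along the cycle elementary.\<close>

lemma grid_cycle_exists:
  assumes "compact K" "open U" "K \<subseteq> U"
  obtains \<Gamma> where "surrounds_in \<Gamma> K U" "\<And>\<gamma>. \<gamma> \<in> set \<Gamma> \<Longrightarrow> \<exists>u v. \<gamma> = linepath u v"
    "\<And>F. F holomorphic_on U \<Longrightarrow> (\<Sum>\<gamma>\<leftarrow>\<Gamma>. contour_integral \<gamma> F) = 0"
proof -
  obtain d where d: "d > 0" "(\<Union>x\<in>K. ball x d) \<subseteq> U"
    using compact_subset_open_imp_ball_epsilon_subset[OF assms] by blast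
  \<comment> \<open>Points of one cell differ by at most \<open>\<delta>\<close> in each coordinate,
    hence by at most \<open>d / 2\<close> in the plane, so every cell meeting \<open>K\<close> stays
    in \<open>U\<close>.\<close>
  define \<delta> where "\<delta> = d / 4"
  have \<delta>: "\<delta> > 0" using d by (simp add: \<delta>_def)
  define S where "S = {s. cell \<delta> s \<inter> K \<noteq> {}}"
  obtain R where R: "\<And>z. z \<in> K \<Longrightarrow> norm z \<le> R"
    using compact_imp_bounded[OF assms(1)] by (auto simp: bounded_iff)
  define M where "M = \<lceil>R / \<delta>\<rceil>"
  have M: "R \<le> \<delta> * M"
  proof -
    have "R / \<delta> \<le> M" unfolding M_def by (rule le_of_int_ceiling)
    then show ?thesis using \<delta> by (simp add: pos_divide_le_eq mult.commute)
  qed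
  have "S \<subseteq> {- M - 1..M} \<times> {- M - 1..M}"
  proof
    fix s assume "s \<in> S"
    then obtain m n z where s: "s = (m, n)" and z: "z \<in> cell \<delta> (m, n)" "z \<in> K"
      by (cases s) (auto simp: S_def)
    have "\<bar>Re z\<bar> \<le> \<delta> * M" "\<bar>Im z\<bar> \<le> \<delta> * M"
      using R[OF z(2)] abs_Re_le_cmod[of z] abs_Im_le_cmod[of z] M by linarith+
    then have "\<delta> * m \<le> \<delta> * M" "\<delta> * n \<le> \<delta> * M" "\<delta> * (- M) \<le> \<delta> * (m + 1)" "\<delta> * (- M) \<le> \<delta> * (n + 1)"
      using z(1) unfolding mem_cell by (simp_all add: abs_le_iff)
    then have "real_of_int m \<le> M" "real_of_int n \<le> M" "real_of_int (- M) \<le> m + 1" "real_of_int (- M) \<le> n + 1"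
      using \<delta> by (simp_all only: mult_le_cancel_left_pos of_int_minus of_int_add of_int_1)
    then show "s \<in> {- M - 1..M} \<times> {- M - 1..M}" unfolding s by simp
  qed
  then have finS: "finite S" by (rule finite_subset) simp
  have cellU: "cell \<delta> s \<subseteq> U" if "s \<in> S" for s
  proof
    obtain m n where s: "s = (m, n)" by (cases s)
    then obtain k where k: "k \<in> cell \<delta> (m, n)" "k \<in> K"
      using \<open>s \<in> S\<close> by (auto simp: S_def)
    fix z assume "z \<in> cell \<delta> s"
    then have "\<bar>Re (k - z)\<bar> \<le> \<delta>" "\<bar>Im (k - z)\<bar> \<le> \<delta>"
      using k(1) unfolding s mem_cell by (auto simp: algebra_simps abs_le_iff)
    then have "norm (k - z) < d"
      using cmod_le[of "k - z"] d(1) by (simp add: \<delta>_def)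
    then have "z \<in> ball k d" by (simp add: dist_norm)
    then show "z \<in> U" using d(2) k(2) by blast
  qed
  define E where "E = \<Union>(cell_edges ` S)"
  define B where "B = {e \<in> E. prod.swap e \<notin> E}"
  have finE: "finite E" using finS by (simp add: E_def)
  then have finB: "finite B" by (simp add: B_def)
  have EU: "path_image (grid_path \<delta> e) \<subseteq> U" if "e \<in> E" for e
    using that path_image_grid_path_subset_cell[OF \<delta>] cellU unfolding E_def by blast
  \<comment> \<open>If the edge met \<open>K\<close>, so would the cell on its other side; that cell
    would belong to \<open>S\<close>, the reversed edge to \<open>E\<close>, and the edge would have
    been cancelled.\<close>
  have BK: "path_image (grid_path \<delta> e) \<inter> K = {}" if "e \<in> B" for e
  proof -
    obtain s where "e \<in> cell_edges s" using \<open>e \<in> B\<close> by (auto simp: B_def E_def)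
    then obtain t where t: "prod.swap e \<in> cell_edges t" by (rule swap_edge_obtain_cell)
    have "path_image (grid_path \<delta> (prod.swap e)) = path_image (grid_path \<delta> e)"
      by (simp add: grid_path_def closed_segment_commute)
    then have "path_image (grid_path \<delta> e) \<subseteq> cell \<delta> t"
      using path_image_grid_path_subset_cell[OF \<delta> t] by simp
    moreover have "t \<notin> S" using that t by (auto simp: B_def E_def)
    ultimately show ?thesis by (auto simp: S_def)
  qed
  obtain xs where xs: "set xs = B" "distinct xs" using finite_distinct_list[OF finB] by blast
  define \<Gamma> where "\<Gamma> = map (grid_path \<delta>) xs"
  have sumB: "(\<Sum>\<gamma>\<leftarrow>\<Gamma>. F \<gamma>) = (\<Sum>e\<in>B. F (grid_path \<delta> e))" for F :: "_ \<Rightarrow> complex"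
    unfolding \<Gamma>_def using sum_list_map_set[OF xs(2)] xs(1) by metis
  have index: "chain_index \<Gamma> z = of_nat (card {s \<in> S. z \<in> cell \<delta> s})"
    if "z \<notin> (\<Union>s\<in>S. \<Union>e\<in>cell_edges s. path_image (grid_path \<delta> e))" for z
    unfolding chain_index_def sumB
    by (rule chain_index_grid_boundary[OF \<delta> finS that]) (simp add: B_def E_def)
  have indexK: "chain_index \<Gamma> z = 1" if "z \<in> K" for z
  proof -
    have zB: "z \<notin> path_image (grid_path \<delta> e)" if "e \<in> B" for e using BK[OF that] \<open>z \<in> K\<close> by blast
    \<comment> \<open>The index is computed at shifted points and carried back to \<open>z\<close>
      by continuity of the winding numbers along the edges in \<open>B\<close>, which avoid
      \<open>z\<close>.\<close>
    define w where "w \<epsilon> = z + of_real \<epsilon> * Complex 1 1" for \<epsilon>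
    have "(w \<longlongrightarrow> z + of_real 0 * Complex 1 1) (at_right 0)"
      unfolding w_def by (intro tendsto_intros)
    then have w: "(w \<longlongrightarrow> z) (at_right 0)" by simp
    have "((\<lambda>\<epsilon>. chain_index \<Gamma> (w \<epsilon>)) \<longlongrightarrow> chain_index \<Gamma> z) (at_right 0)"
      unfolding chain_index_def sumB
    proof (rule tendsto_sum)
      fix e assume "e \<in> B"
      then have "isCont (winding_number (grid_path \<delta> e)) z"
        by (intro continuous_at_winding_number zB) auto
      then show "((\<lambda>\<epsilon>. winding_number (grid_path \<delta> e) (w \<epsilon>)) \<longlongrightarrow> winding_number (grid_path \<delta> e) z) (at_right 0)"
        using w by (rule isCont_tendsto_compose)
    qed
    moreover have "\<forall>\<^sub>F \<epsilon> in at_right 0. chain_index \<Gamma> (w \<epsilon>) = 1"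
      using diagonal_shift_avoids_grid[OF \<delta>, of z]
    proof eventually_elim
      case (elim \<epsilon>)
      let ?s = "(\<lfloor>Re z / \<delta>\<rfloor>, \<lfloor>Im z / \<delta>\<rfloor>)"
      have "z \<in> cell \<delta> ?s"
        using floor_divide_lower[OF \<delta>] floor_divide_upper[OF \<delta>]
        by (auto simp: mem_cell mult.commute less_imp_le)
      then have "?s \<in> S" using that by (auto simp: S_def)
      then have "{s \<in> S. w \<epsilon> \<in> cell \<delta> s} = {?s}"
        using elim unfolding w_def by blast
      moreover have "w \<epsilon> \<notin> (\<Union>s\<in>S. \<Union>e\<in>cell_edges s. path_image (grid_path \<delta> e))"
        using elim unfolding w_def by blast
      ultimately show ?case by (simp add: index)
    qed
    then have "((\<lambda>\<epsilon>. chain_index \<Gamma> (w \<epsilon>)) \<longlongrightarrow> 1) (at_right 0)" by (rule tendsto_eventually)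
    ultimately show ?thesis by (rule tendsto_unique[OF trivial_limit_at_right_real])
  qed
  have indexU: "chain_index \<Gamma> z = 0" if "z \<notin> U" for z
  proof -
    have "chain_index \<Gamma> z = of_nat (card {s \<in> S. z \<in> cell \<delta> s})"
      by (rule index) (use EU that in \<open>unfold E_def, blast\<close>)
    also have "{s \<in> S. z \<in> cell \<delta> s} = {}" using cellU that by blast
    finally show ?thesis by simp
  qed
  have bal: "mset (map pathstart \<Gamma>) = mset (map pathfinish \<Gamma>)"
  proof (rule multiset_eqI)
    fix p
    \<comment> \<open>The cancellation is applied to start indicator minus end indicator at
      \<open>p\<close>; it vanishes on a single cell, each corner being entered once and left
      once.\<close>
    define I :: "(int \<times> int) \<times> (int \<times> int) \<Rightarrow> real" where
      "I e = of_bool (grid_point \<delta> (fst e) = p) - of_bool (grid_point \<delta> (snd e) = p)" for e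
    have "sum I B = sum I E"
      unfolding B_def by (rule sum_antisymmetric_boundary) (use finE in \<open>auto simp: I_def\<close>)
    also have "\<dots> = (\<Sum>s\<in>S. sum I (cell_edges s))"
      unfolding E_def by (rule sum.UNION_disjoint) (use finS cell_edges_disjoint in auto)
    also have "\<dots> = 0"
    proof (rule sum.neutral, rule ballI)
      fix s :: "int \<times> int"
      show "sum I (cell_edges s) = 0" by (cases s) (simp add: sum_cell_edges I_def)
    qed
    finally have "sum I B = 0" .
    then have "(\<Sum>e\<in>B. of_bool (grid_point \<delta> (fst e) = p) :: real) = (\<Sum>e\<in>B. of_bool (grid_point \<delta> (snd e) = p))"
      by (simp add: I_def sum_subtractf)
    then have "card {e \<in> B. grid_point \<delta> (fst e) = p} = card {e \<in> B. grid_point \<delta> (snd e) = p}"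
      using finB by (simp add: of_bool_def sum.If_cases Int_def)
    moreover have "count (mset (map q \<Gamma>)) p = card {e \<in> B. q (grid_path \<delta> e) = p}" for q :: "(real \<Rightarrow> complex) \<Rightarrow> complex"
    proof -
      have "count (mset (map q \<Gamma>)) p = length (filter (\<lambda>e. q (grid_path \<delta> e) = p) xs)"
        unfolding \<Gamma>_def by (induction xs) auto
      also have "\<dots> = card {e \<in> B. q (grid_path \<delta> e) = p}"
        using xs by (simp add: distinct_length_filter Int_def conj_commute)
      finally show ?thesis .
    qed
    ultimately show "count (mset (map pathstart \<Gamma>)) p = count (mset (map pathfinish \<Gamma>)) p"
      by simp
  qed
  have "valid_path \<gamma> \<and> path_image \<gamma> \<subseteq> U - K" if "\<gamma> \<in> set \<Gamma>" for \<gamma>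
  proof -
    obtain e where e: "e \<in> B" "\<gamma> = grid_path \<delta> e" using \<open>\<gamma> \<in> set \<Gamma>\<close> xs(1) by (auto simp: \<Gamma>_def)
    then have "e \<in> E" by (simp add: B_def)
    then show ?thesis using EU[of e] BK[OF e(1)] e(2) by auto
  qed
  then have "cycle_in (U - K) \<Gamma>"
    unfolding cycle_in_def using bal by blast
  then have "surrounds_in \<Gamma> K U"
    unfolding surrounds_in_def using indexK indexU by blast
  moreover have "(\<Sum>\<gamma>\<leftarrow>\<Gamma>. contour_integral \<gamma> F) = 0" if F: "F holomorphic_on U" for F
  proof -
    have "(\<Sum>\<gamma>\<leftarrow>\<Gamma>. contour_integral \<gamma> F) = (\<Sum>e\<in>E. contour_integral (grid_path \<delta> e) F)"
      unfolding sumB B_def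
    proof (rule sum_antisymmetric_boundary[OF finE])
      fix u v
      show "contour_integral (grid_path \<delta> (v, u)) F = - contour_integral (grid_path \<delta> (u, v)) F"
        unfolding grid_path_swap[of \<delta> v u] by (simp add: contour_integral_reversepath)
    qed
    also have "\<dots> = (\<Sum>s\<in>S. \<Sum>e\<in>cell_edges s. contour_integral (grid_path \<delta> e) F)"
      unfolding E_def by (rule sum.UNION_disjoint) (use finS cell_edges_disjoint in auto)
    also have "\<dots> = 0"
    proof (rule sum.neutral, rule ballI)
      fix s assume "s \<in> S"
      then show "(\<Sum>e\<in>cell_edges s. contour_integral (grid_path \<delta> e) F) = 0"
        using sum_contour_integral_cell_edges[OF \<delta> F assms(2), of "fst s" "snd s"] cellU by simp
    qed
    finally show ?thesis .
  qed
  moreover have "\<exists>u v. \<gamma> = linepath u v" if "\<gamma> \<in> set \<Gamma>" for \<gamma>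
    using that by (auto simp: \<Gamma>_def grid_path_def)
  ultimately show thesis using that by blast
qed

section \<open>Cauchy's theorem for cycles\<close>

lemma contour_integral_sum_list:
  assumes "\<And>x. x \<in> set xs \<Longrightarrow> f x contour_integrable_on \<gamma>"
  shows "(\<lambda>z. \<Sum>x\<leftarrow>xs. f x z) contour_integrable_on \<gamma>"
    and "contour_integral \<gamma> (\<lambda>z. \<Sum>x\<leftarrow>xs. f x z) = (\<Sum>x\<leftarrow>xs. contour_integral \<gamma> (f x))"
  using assms
proof (induction xs)
  case (Cons x xs)
  {
    case 1
    then show ?case using Cons.IH(1) by (auto intro!: contour_integrable_add)
  next
    case 2
    then show ?case using Cons.IH by (auto simp: contour_integral_add)
  }
qed (use has_contour_integral_0 in \<open>auto simp: contour_integrable_on_def\<close>)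

lemma sum_list_swap:
  "(\<Sum>x\<leftarrow>xs. \<Sum>y\<leftarrow>ys. f x y) = (\<Sum>y\<leftarrow>ys. \<Sum>x\<leftarrow>xs. f x y)"
  for f :: "'b \<Rightarrow> 'c \<Rightarrow> 'd::comm_monoid_add"
  by (induction xs) (simp_all add: sum_list_addf)

section \<open>Cycles, primitives and the index\<close>

definition chain_trace :: "(real \<Rightarrow> complex) list \<Rightarrow> complex set" where
  "chain_trace \<Gamma> = (\<Union>\<gamma>\<in>set \<Gamma>. path_image \<gamma>)"

lemma cycle_in_iff:
  "cycle_in S \<Gamma> \<longleftrightarrow> (\<forall>\<gamma>\<in>set \<Gamma>. valid_path \<gamma>) \<and> chain_trace \<Gamma> \<subseteq> S \<and>
     mset (map pathstart \<Gamma>) = mset (map pathfinish \<Gamma>)"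
  by (auto simp: cycle_in_def chain_trace_def)

lemma cycle_in_superset: "cycle_in S \<Gamma> \<Longrightarrow> chain_trace \<Gamma> \<subseteq> T \<Longrightarrow> cycle_in T \<Gamma>"
  unfolding cycle_in_iff by (elim conjE) (intro conjI; assumption)

lemma compact_chain_trace: "cycle_in S \<Gamma> \<Longrightarrow> compact (chain_trace \<Gamma>)"
  unfolding cycle_in_def chain_trace_def
  by (intro compact_UN) (auto intro: compact_path_image valid_path_imp_path)

text \<open>The endpoint values of the primitive cancel because initial and final points agree as
  multisets, even if no single path is closed.\<close>

lemma cycle_integral_primitive:
  assumes "cycle_in S \<Gamma>" "\<And>z. z \<in> S \<Longrightarrow> (G has_field_derivative F z) (at z within S)"
  shows "(\<Sum>\<gamma>\<leftarrow>\<Gamma>. contour_integral \<gamma> F) = 0"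
proof -
  have "(\<Sum>\<gamma>\<leftarrow>\<Gamma>. contour_integral \<gamma> F) = (\<Sum>\<gamma>\<leftarrow>\<Gamma>. G (pathfinish \<gamma>) - G (pathstart \<gamma>))"
  proof (rule arg_cong[where f = sum_list], rule map_cong[OF refl])
    fix \<gamma> assume "\<gamma> \<in> set \<Gamma>"
    then show "contour_integral \<gamma> F = G (pathfinish \<gamma>) - G (pathstart \<gamma>)"
      using assms by (intro contour_integral_unique contour_integral_primitive[of S]) (auto simp: cycle_in_def)
  qed
  also have "\<dots> = (\<Sum>\<gamma>\<leftarrow>\<Gamma>. G (pathfinish \<gamma>)) - (\<Sum>\<gamma>\<leftarrow>\<Gamma>. G (pathstart \<gamma>))"
    by (rule sum_list_subtractf)
  also have "\<dots> = 0"
  proof -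
    have *: "(\<Sum>\<gamma>\<leftarrow>\<Gamma>. G (q \<gamma>)) = sum_mset (image_mset G (mset (map q \<Gamma>)))" for q
      by (simp add: sum_mset_sum_list[symmetric] multiset.map_comp o_def)
    have "mset (map pathstart \<Gamma>) = mset (map pathfinish \<Gamma>)"
      using assms(1) by (simp add: cycle_in_def)
    then show ?thesis by (simp only: *[of pathstart] *[of pathfinish] diff_self)
  qed
  finally show ?thesis .
qed

lemma chain_index_integral:
  assumes "cycle_in S \<Gamma>" "z \<notin> chain_trace \<Gamma>"
  shows "chain_index \<Gamma> z = 1 / (2 * of_real pi * \<i>) * (\<Sum>\<gamma>\<leftarrow>\<Gamma>. contour_integral \<gamma> (\<lambda>w. 1 / (w - z)))"
proof -
  have "winding_number \<gamma> z = 1 / (2 * of_real pi * \<i>) * contour_integral \<gamma> (\<lambda>w. 1 / (w - z))"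
    if "\<gamma> \<in> set \<Gamma>" for \<gamma>
  proof -
    have "valid_path \<gamma>" "z \<notin> path_image \<gamma>"
      using that assms by (auto simp: cycle_in_def chain_trace_def)
    then show ?thesis using winding_number_valid_path[of \<gamma> z] by simp
  qed
  then have "chain_index \<Gamma> z = (\<Sum>\<gamma>\<leftarrow>\<Gamma>. 1 / (2 * of_real pi * \<i>) * contour_integral \<gamma> (\<lambda>w. 1 / (w - z)))"
    unfolding chain_index_def by (intro arg_cong[where f = sum_list] map_cong) auto
  then show ?thesis by (simp only: sum_list_const_mult)
qed

text \<open>The Moebius map with zero \<open>z'\<close> and pole \<open>z\<close> takes nonpositive
  real values only on the segment between them, so \<open>Ln\<close> can be composed with it
  elsewhere.\<close>

lemma ratio_nonpos_imp_segment:
  fixes w z z' :: complex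
  assumes "w \<noteq> z" "(w - z') / (w - z) \<in> \<real>\<^sub>\<le>\<^sub>0"
  shows "w \<in> closed_segment z z'"
proof -
  obtain t where t: "t \<le> 0" "(w - z') / (w - z) = of_real t"
    using assms(2) by (auto elim: nonpos_Reals_cases)
  then have eq: "w - z' = of_real t * (w - z)"
    using assms(1) by (simp add: nonzero_divide_eq_eq)
  \<comment> \<open>Solving \<open>w - z' = t (w - z)\<close> for \<open>w\<close> gives a convex
    combination with this weight at \<open>z'\<close>.\<close>
  define s where "s = 1 / (1 - t)"
  have s: "s * (1 - t) = 1" "0 \<le> s" "s \<le> 1" using t(1) by (auto simp: s_def)
  have "w = of_real (s * (1 - t)) * w" using s(1) by simp
  also have "\<dots> = of_real s * (w - of_real t * w)" by (simp add: algebra_simps)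
  also have "\<dots> = of_real s * (z' - of_real t * z)"
    by (rule arg_cong[where f = "(*) (of_real s)"]) (use eq in \<open>simp add: algebra_simps\<close>)
  also have "\<dots> = of_real (- (s * t)) * z + of_real s * z'" by (simp add: algebra_simps)
  also have "- (s * t) = 1 - s" using s(1) by (simp add: algebra_simps)
  finally have "w = (1 - s) *\<^sub>R z + s *\<^sub>R z'" by (simp only: scaleR_conv_of_real)
  then show ?thesis unfolding closed_segment_def using s by blast
qed

lemma inverse_difference: "p \<noteq> 0 \<Longrightarrow> q \<noteq> 0 \<Longrightarrow> inverse (q / p) * ((p - q) / (p * p)) = 1 / q - 1 / p"
  for p q :: "'b::field"
  by (simp add: field_simps)

text \<open>The difference of the two Cauchy kernels has the primitive
  \<open>Ln ((w - z') / (w - z))\<close> off the segment. The winding numbers of open paths may vary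
  with the point; it is their sum over the cycle that is unchanged.\<close>

lemma chain_index_eq_if_segment_avoids:
  assumes "cycle_in S \<Gamma>" "closed_segment z z' \<inter> chain_trace \<Gamma> = {}"
  shows "chain_index \<Gamma> z' = chain_index \<Gamma> z"
proof -
  have z: "z \<notin> chain_trace \<Gamma>" "z' \<notin> chain_trace \<Gamma>" using assms(2) by auto
  have cyc: "cycle_in (- closed_segment z z') \<Gamma>"
    by (rule cycle_in_superset[OF assms(1)]) (use assms(2) in blast)
  have int: "(\<lambda>w. 1 / (w - u)) contour_integrable_on \<gamma>" if "\<gamma> \<in> set \<Gamma>" "u \<notin> chain_trace \<Gamma>" for \<gamma> u
    using that assms(1) by (intro contour_integrable_inversediff) (auto simp: cycle_in_def chain_trace_def)
  have "(\<Sum>\<gamma>\<leftarrow>\<Gamma>. contour_integral \<gamma> (\<lambda>w. 1 / (w - z') - 1 / (w - z))) = 0"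
  proof (rule cycle_integral_primitive[OF cyc, where G = "\<lambda>w. Ln ((w - z') / (w - z))"])
    fix w assume w: "w \<in> - closed_segment z z'"
    then have "w \<noteq> z" "w \<noteq> z'" by auto
    have neg: "(w - z') / (w - z) \<notin> \<real>\<^sub>\<le>\<^sub>0"
      using ratio_nonpos_imp_segment[OF \<open>w \<noteq> z\<close>] w by blast
    have "((\<lambda>w. (w - z') / (w - z)) has_field_derivative ((w - z) - (w - z')) / ((w - z) * (w - z))) (at w)"
      using \<open>w \<noteq> z\<close> by (auto intro!: derivative_eq_intros)
    from DERIV_chain2[OF has_field_derivative_Ln[OF neg] this]
    have "((\<lambda>w. Ln ((w - z') / (w - z))) has_field_derivative 1 / (w - z') - 1 / (w - z)) (at w)"
      using inverse_difference[of "w - z" "w - z'"] \<open>w \<noteq> z\<close> \<open>w \<noteq> z'\<close> by simp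
    then show "((\<lambda>w. Ln ((w - z') / (w - z))) has_field_derivative 1 / (w - z') - 1 / (w - z))
        (at w within - closed_segment z z')"
      by (rule has_field_derivative_at_within)
  qed
  moreover have "(\<Sum>\<gamma>\<leftarrow>\<Gamma>. contour_integral \<gamma> (\<lambda>w. 1 / (w - z') - 1 / (w - z))) =
      (\<Sum>\<gamma>\<leftarrow>\<Gamma>. contour_integral \<gamma> (\<lambda>w. 1 / (w - z')) - contour_integral \<gamma> (\<lambda>w. 1 / (w - z)))"
    using contour_integral_diff[OF int[OF _ z(2)] int[OF _ z(1)]]
    by (intro arg_cong[where f = sum_list] map_cong) auto
  moreover have "\<dots> = (\<Sum>\<gamma>\<leftarrow>\<Gamma>. contour_integral \<gamma> (\<lambda>w. 1 / (w - z'))) - (\<Sum>\<gamma>\<leftarrow>\<Gamma>. contour_integral \<gamma> (\<lambda>w. 1 / (w - z)))"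
    by (rule sum_list_subtractf)
  ultimately have "(\<Sum>\<gamma>\<leftarrow>\<Gamma>. contour_integral \<gamma> (\<lambda>w. 1 / (w - z'))) = (\<Sum>\<gamma>\<leftarrow>\<Gamma>. contour_integral \<gamma> (\<lambda>w. 1 / (w - z)))"
    by (simp only: right_minus_eq)
  then show ?thesis by (simp only: chain_index_integral[OF assms(1) z(1)] chain_index_integral[OF assms(1) z(2)])
qed

text \<open>For such a point the Cauchy kernel is holomorphic on the ball containing the cycle, and
  convexity supplies a primitive.\<close>

lemma chain_index_zero_outside_ball:
  assumes "cycle_in S \<Gamma>" "chain_trace \<Gamma> \<subseteq> ball 0 R" "R \<le> norm z"
  shows "chain_index \<Gamma> z = 0"
proof -
  have cyc: "cycle_in (ball 0 R) \<Gamma>" by (rule cycle_in_superset[OF assms(1,2)])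
  have "(\<lambda>w. 1 / (w - z)) holomorphic_on ball 0 R"
    using assms(3) by (intro holomorphic_intros) auto
  then obtain G where G: "\<And>w. w \<in> ball 0 R \<Longrightarrow> (G has_field_derivative 1 / (w - z)) (at w within ball 0 R)"
    using holomorphic_convex_primitive'[OF convex_ball open_ball] by blast
  then have "(\<Sum>\<gamma>\<leftarrow>\<Gamma>. contour_integral \<gamma> (\<lambda>w. 1 / (w - z))) = 0"
    by (rule cycle_integral_primitive[OF cyc])
  moreover have "z \<notin> chain_trace \<Gamma>" using assms by auto
  ultimately show ?thesis by (simp add: chain_index_integral[OF assms(1)])
qed

text \<open>The filled-in cycle. For an open set \<open>V\<close> containing the trace, the
  hypothesis of Cauchy's theorem that the index vanishes off \<open>V\<close> says precisely that
  \<open>V\<close> contains this set.\<close>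

definition chain_hull :: "(real \<Rightarrow> complex) list \<Rightarrow> complex set" where
  "chain_hull \<Gamma> = chain_trace \<Gamma> \<union> {z. chain_index \<Gamma> z \<noteq> 0}"

text \<open>Bounded because the index vanishes far away, closed because the index is locally
  constant off the trace.\<close>

lemma compact_chain_hull:
  assumes "cycle_in S \<Gamma>"
  shows "compact (chain_hull \<Gamma>)"
proof -
  have "bounded (chain_trace \<Gamma>)" using compact_chain_trace[OF assms] by (rule compact_imp_bounded)
  then obtain R where R: "chain_trace \<Gamma> \<subseteq> ball 0 R" using bounded_subset_ballD by blast
  have "chain_hull \<Gamma> \<subseteq> ball 0 R"
  proof
    fix z assume "z \<in> chain_hull \<Gamma>"
    then consider "z \<in> chain_trace \<Gamma>" | "chain_index \<Gamma> z \<noteq> 0" by (auto simp: chain_hull_def)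
    then show "z \<in> ball 0 R"
    proof cases
      case 2
      then have "\<not> R \<le> norm z" using chain_index_zero_outside_ball[OF assms R] by blast
      then show ?thesis by simp
    qed (use R in blast)
  qed
  then have "bounded (chain_hull \<Gamma>)" by (rule bounded_subset[OF bounded_ball])
  moreover have "open (- chain_hull \<Gamma>)"
    unfolding open_contains_ball
  proof
    fix z assume z: "z \<in> - chain_hull \<Gamma>"
    have "open (- chain_trace \<Gamma>)"
      using compact_imp_closed[OF compact_chain_trace[OF assms]] by blast
    moreover have "z \<in> - chain_trace \<Gamma>" using z by (simp add: chain_hull_def)
    ultimately obtain e where e: "e > 0" "ball z e \<subseteq> - chain_trace \<Gamma>"
      unfolding open_contains_ball by blast
    have "ball z e \<subseteq> - chain_hull \<Gamma>"
    proof
      fix w assume w: "w \<in> ball z e"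
      then have "closed_segment z w \<subseteq> ball z e" using e(1) by (simp add: closed_segment_subset)
      then have "chain_index \<Gamma> w = chain_index \<Gamma> z"
        using e(2) by (intro chain_index_eq_if_segment_avoids[OF assms]) blast
      then show "w \<in> - chain_hull \<Gamma>" using z e(2) w by (auto simp: chain_hull_def)
    qed
    then show "\<exists>e>0. ball z e \<subseteq> - chain_hull \<Gamma>" using e(1) by blast
  qed
  ultimately show ?thesis by (simp add: compact_eq_bounded_closed closed_def)
qed

text \<open>Differentiation under the integral sign for a density that is merely continuous; the
  constant velocity of the segment provides the bound \<open>B\<close>.\<close>

lemma linepath_Cauchy_integral_holomorphic:
  assumes "continuous_on (closed_segment a b) F"
  shows "(\<lambda>z. contour_integral (linepath a b) (\<lambda>w. F w / (w - z))) holomorphic_on - closed_segment a b"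
proof -
  have "(\<lambda>z. contour_integral (linepath a b) (\<lambda>w. F w / (w - z))) field_differentiable at z"
    if "z \<in> - closed_segment a b" for z
  proof -
    have "((\<lambda>z. contour_integral (linepath a b) (\<lambda>w. F w / (w - z))) has_field_derivative
        of_nat 1 * contour_integral (linepath a b) (\<lambda>w. F w / (w - z) ^ Suc 1)) (at z)"
    proof (rule Cauchy_next_derivative(2)[where B = "norm (b - a)" and S = UNIV])
      fix w assume "w \<in> UNIV - path_image (linepath a b)"
      then have "(\<lambda>u. F u / (u - w) ^ 1) contour_integrable_on linepath a b"
        using assms by (intro contour_integrable_continuous_linepath continuous_intros) auto
      then show "((\<lambda>u. F u / (u - w) ^ 1) has_contour_integral contour_integral (linepath a b) (\<lambda>u. F u / (u - w)))
          (linepath a b)"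
        using has_contour_integral_integral by fastforce
    qed (use assms that in auto)
    then show ?thesis by (auto simp: field_differentiable_def)
  qed
  then show ?thesis
    by (auto simp: holomorphic_on_def intro: field_differentiable_at_within)
qed

text \<open>The given path may fail to be rectifiable, so it is replaced by a nearby polynomial path
  before the order of integration is exchanged.\<close>

lemma contour_integral_swap_linepath:
  assumes \<gamma>: "valid_path \<gamma>" and disj: "path_image \<gamma> \<inter> closed_segment a b = {}"
    and F: "continuous_on (closed_segment a b) F"
  shows "contour_integral \<gamma> (\<lambda>z. contour_integral (linepath a b) (\<lambda>w. F w / (w - z))) =
         contour_integral (linepath a b) (\<lambda>w. F w * contour_integral \<gamma> (\<lambda>z. 1 / (w - z)))"
proof -
  let ?S = "- closed_segment a b"
  have S: "open ?S" "path_image \<gamma> \<subseteq> ?S" using disj by auto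
  have "path \<gamma>" using \<gamma> by (rule valid_path_imp_path)
  \<comment> \<open>Valid paths closer to \<open>\<gamma>\<close> than \<open>d\<close> with common
    endpoints have the same integrals of functions holomorphic off the segment.\<close>
  obtain d where d: "d > 0" and near: "\<And>g h. valid_path g \<Longrightarrow> valid_path h \<Longrightarrow>
      (\<forall>t\<in>{0..1}. norm (g t - \<gamma> t) < d \<and> norm (h t - \<gamma> t) < d) \<Longrightarrow>
      pathstart h = pathstart g \<Longrightarrow> pathfinish h = pathfinish g \<Longrightarrow>
      path_image g \<subseteq> ?S \<and> path_image h \<subseteq> ?S \<and>
      (\<forall>f. f holomorphic_on ?S \<longrightarrow> contour_integral h f = contour_integral g f)"
    using contour_integral_nearby_ends[OF S(1) \<open>path \<gamma>\<close> S(2)] by metis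
  obtain p where p: "polynomial_function p" "pathstart p = pathstart \<gamma>" "pathfinish p = pathfinish \<gamma>"
      "\<forall>t\<in>{0..1}. norm (p t - \<gamma> t) < d"
    using path_approx_polynomial_function[OF \<open>path \<gamma>\<close> d] by metis
  have vp: "valid_path p" using p(1) by (rule valid_path_polynomial_function)
  have pS: "path_image p \<subseteq> ?S" and eq: "\<And>f. f holomorphic_on ?S \<Longrightarrow> contour_integral p f = contour_integral \<gamma> f"
    using near[OF \<gamma> vp] p d by auto
  obtain p' where p': "polynomial_function p'" "\<And>x. (p has_vector_derivative p' x) (at x)"
    using has_vector_derivative_polynomial_function[OF p(1)] by blast
  \<comment> \<open>This takes the inner integral back to \<open>\<gamma>\<close> after the
    exchange; before it, the outer integral is moved to \<open>p\<close> because the Cauchy integral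
    over the segment is holomorphic off the segment.\<close>
  have inv: "contour_integral p (\<lambda>z. 1 / (w - z)) = contour_integral \<gamma> (\<lambda>z. 1 / (w - z))"
    if "w \<in> closed_segment a b" for w
    by (rule eq) (use that in \<open>auto intro!: holomorphic_intros\<close>)
  have "contour_integral \<gamma> (\<lambda>z. contour_integral (linepath a b) (\<lambda>w. F w / (w - z))) =
      contour_integral p (\<lambda>z. contour_integral (linepath a b) (\<lambda>w. F w / (w - z)))"
    by (rule eq[symmetric]) (rule linepath_Cauchy_integral_holomorphic[OF F])
  also have "\<dots> = contour_integral (linepath a b) (\<lambda>w. contour_integral p (\<lambda>z. F w / (w - z)))"
  proof (rule contour_integral_swap)
    show "continuous_on (path_image p \<times> path_image (linepath a b)) (\<lambda>(z, w). F w / (w - z))"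
      unfolding case_prod_unfold
      by (intro continuous_intros continuous_on_compose2[OF F]) (use pS in auto)
    have "continuous_on {0..1} p'" using p'(1) by (rule continuous_on_polymonial_function)
    then show "continuous_on {0..1} (\<lambda>t. vector_derivative p (at t))"
      by (simp add: vector_derivative_at[OF p'(2)])
  qed (use vp in auto)
  also have "\<dots> = contour_integral (linepath a b) (\<lambda>w. F w * contour_integral \<gamma> (\<lambda>z. 1 / (w - z)))"
  proof (rule contour_integral_eq)
    fix w assume w: "w \<in> path_image (linepath a b)"
    have "(\<lambda>z. 1 / (w - z)) contour_integrable_on p"
      by (rule contour_integrable_holomorphic_simple[of _ ?S]) (use w pS vp in \<open>auto intro!: holomorphic_intros\<close>)
    then have "contour_integral p (\<lambda>z. F w * (1 / (w - z))) = F w * contour_integral p (\<lambda>z. 1 / (w - z))"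
      by (rule contour_integral_lmul)
    then show "contour_integral p (\<lambda>z. F w / (w - z)) = F w * contour_integral \<gamma> (\<lambda>z. 1 / (w - z))"
      using inv w by simp
  qed
  finally show ?thesis .
qed

text \<open>Split \<open>F w / (w - z)\<close> into \<open>F z / (w - z)\<close> and the difference
  quotient, which extends holomorphically across \<open>z\<close> and so integrates to 0. Stated
  from the vanishing of integrals, it applies to grid cycles before Cauchy's theorem is known in
  general.\<close>

lemma Cauchy_formula_if_integrals_vanish:
  assumes V: "open V" and F: "F holomorphic_on V" and cyc: "cycle_in V \<Delta>"
    and vanish: "\<And>H. H holomorphic_on V \<Longrightarrow> (\<Sum>\<delta>\<leftarrow>\<Delta>. contour_integral \<delta> H) = 0"
    and z: "z \<in> V" "z \<notin> chain_trace \<Delta>"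
  shows "(\<Sum>\<delta>\<leftarrow>\<Delta>. contour_integral \<delta> (\<lambda>w. F w / (w - z))) = 2 * of_real pi * \<i> * chain_index \<Delta> z * F z"
proof -
  have hol: "(\<lambda>w. if w = z then deriv F z else (F w - F z) / (w - z)) holomorphic_on V"
    by (rule pole_lemma_open[OF F V])
  have "contour_integral \<delta> (\<lambda>w. F w / (w - z)) - F z * contour_integral \<delta> (\<lambda>w. 1 / (w - z)) =
      contour_integral \<delta> (\<lambda>w. if w = z then deriv F z else (F w - F z) / (w - z))"
    if \<delta>: "\<delta> \<in> set \<Delta>" for \<delta>
  proof -
    have zn: "z \<notin> path_image \<delta>" and \<Delta>: "path_image \<delta> \<subseteq> V" "valid_path \<delta>"
      using z(2) cyc \<delta> by (auto simp: chain_trace_def cycle_in_def)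
    have F': "F holomorphic_on V - {z}" by (rule holomorphic_on_subset[OF F]) auto
    have i1: "(\<lambda>w. F w / (w - z)) contour_integrable_on \<delta>"
      by (rule contour_integrable_holomorphic_simple[of _ "V - {z}"])
         (use \<Delta> V zn F' in \<open>auto intro!: holomorphic_intros open_delete\<close>)
    have i2: "(\<lambda>w. 1 / (w - z)) contour_integrable_on \<delta>"
      using \<Delta> zn by (intro contour_integrable_inversediff) auto
    have "contour_integral \<delta> (\<lambda>w. F w / (w - z)) - F z * contour_integral \<delta> (\<lambda>w. 1 / (w - z)) =
        contour_integral \<delta> (\<lambda>w. F w / (w - z) - F z * (1 / (w - z)))"
      by (simp only: contour_integral_lmul[OF i2] contour_integral_diff[OF i1 contour_integrable_lmul[OF i2]])
    also have "\<dots> = contour_integral \<delta> (\<lambda>w. if w = z then deriv F z else (F w - F z) / (w - z))"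
      by (rule contour_integral_eq) (use zn in \<open>auto simp: diff_divide_distrib\<close>)
    finally show ?thesis .
  qed
  then have "(\<Sum>\<delta>\<leftarrow>\<Delta>. contour_integral \<delta> (\<lambda>w. F w / (w - z)) - F z * contour_integral \<delta> (\<lambda>w. 1 / (w - z))) =
      (\<Sum>\<delta>\<leftarrow>\<Delta>. contour_integral \<delta> (\<lambda>w. if w = z then deriv F z else (F w - F z) / (w - z)))"
    by (intro arg_cong[where f = sum_list] map_cong) auto
  also have "\<dots> = 0" by (rule vanish[OF hol])
  finally have "(\<Sum>\<delta>\<leftarrow>\<Delta>. contour_integral \<delta> (\<lambda>w. F w / (w - z))) =
      F z * (\<Sum>\<delta>\<leftarrow>\<Delta>. contour_integral \<delta> (\<lambda>w. 1 / (w - z)))"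
    by (simp add: sum_list_subtractf sum_list_const_mult)
  then show ?thesis using chain_index_integral[OF cyc z(2)] by simp
qed

lemma contour_integral_reciprocal_flip:
  "contour_integral \<gamma> (\<lambda>z. 1 / (w - z)) = - contour_integral \<gamma> (\<lambda>z. 1 / (z - w))"
proof -
  have "contour_integral \<gamma> (\<lambda>z. 1 / (w - z)) = contour_integral \<gamma> (\<lambda>z. - (1 / (z - w)))"
    by (rule contour_integral_eq) (metis minus_diff_eq minus_divide_right)
  then show ?thesis by (simp add: contour_integral_neg)
qed

text \<open>On the hull of \<open>\<Gamma>\<close> the function is a Cauchy integral over a
  surrounding grid cycle \<open>\<Delta>\<close>. After the exchange of integrals, each point of
  \<open>\<Delta>\<close> contributes a multiple of the index of \<open>\<Gamma>\<close> there,
  which is 0 because \<open>\<Delta>\<close> avoids the hull.\<close>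

theorem Cauchy_theorem_cycle:
  assumes V: "open V" and F: "F holomorphic_on V" and cyc: "cycle_in V \<Gamma>"
    and index: "\<And>z. z \<notin> V \<Longrightarrow> chain_index \<Gamma> z = 0"
  shows "(\<Sum>\<gamma>\<leftarrow>\<Gamma>. contour_integral \<gamma> F) = 0"
proof -
  let ?c = "2 * of_real pi * \<i> :: complex"
  let ?N = "chain_hull \<Gamma>"
  have "?N \<subseteq> V" using cyc index by (auto simp: chain_hull_def cycle_in_iff)
  from grid_cycle_exists[OF compact_chain_hull[OF cyc] V this] obtain \<Delta> where
    surr: "surrounds_in \<Delta> ?N V" and lin: "\<And>\<delta>. \<delta> \<in> set \<Delta> \<Longrightarrow> \<exists>u v. \<delta> = linepath u v"
    and grid0: "\<And>H. H holomorphic_on V \<Longrightarrow> (\<Sum>\<delta>\<leftarrow>\<Delta>. contour_integral \<delta> H) = 0"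
    by blast
  have cyc\<Delta>: "cycle_in (V - ?N) \<Delta>" and one: "\<And>z. z \<in> ?N \<Longrightarrow> chain_index \<Delta> z = 1"
    using surr by (auto simp: surrounds_in_def)
  have \<Delta>: "path_image \<delta> \<subseteq> V - ?N" "valid_path \<delta>" if "\<delta> \<in> set \<Delta>" for \<delta>
    using cyc\<Delta> that by (auto simp: cycle_in_def)
  have \<Gamma>: "path_image \<gamma> \<subseteq> ?N" "valid_path \<gamma>" if "\<gamma> \<in> set \<Gamma>" for \<gamma>
    using cyc that by (auto simp: cycle_in_def chain_hull_def chain_trace_def)
  have contF: "continuous_on V F" by (rule holomorphic_on_imp_continuous_on[OF F])
  define I where "I \<delta> z = contour_integral \<delta> (\<lambda>w. F w / (w - z))" for \<delta> z
  have rep: "F z = 1 / ?c * (\<Sum>\<delta>\<leftarrow>\<Delta>. I \<delta> z)" if z: "z \<in> ?N" for z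
  proof -
    have "z \<in> V" "z \<notin> chain_trace \<Delta>" "cycle_in V \<Delta>"
      using cyc\<Delta> z \<open>?N \<subseteq> V\<close> by (auto simp: cycle_in_iff)
    from Cauchy_formula_if_integrals_vanish[OF V F this(3) grid0 this(1,2)]
    show ?thesis using one[OF z] by (simp add: I_def)
  qed
  have swap: "contour_integral \<gamma> (I \<delta>) = contour_integral \<delta> (\<lambda>w. F w * contour_integral \<gamma> (\<lambda>z. 1 / (w - z)))"
    and intI: "I \<delta> contour_integrable_on \<gamma>"
    and intJ: "(\<lambda>w. F w * contour_integral \<gamma> (\<lambda>z. 1 / (w - z))) contour_integrable_on \<delta>"
    if \<gamma>: "\<gamma> \<in> set \<Gamma>" and \<delta>: "\<delta> \<in> set \<Delta>" for \<gamma> \<delta>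
  proof -
    obtain u v where uv: "\<delta> = linepath u v" using lin[OF \<delta>] by blast
    have seg: "closed_segment u v \<subseteq> V" "path_image \<gamma> \<inter> closed_segment u v = {}"
      using \<Delta>(1)[OF \<delta>] \<Gamma>(1)[OF \<gamma>] by (auto simp: uv)
    have cont: "continuous_on (closed_segment u v) F" using contF seg(1) by (rule continuous_on_subset)
    show "contour_integral \<gamma> (I \<delta>) = contour_integral \<delta> (\<lambda>w. F w * contour_integral \<gamma> (\<lambda>z. 1 / (w - z)))"
      unfolding I_def uv by (rule contour_integral_swap_linepath[OF \<Gamma>(2)[OF \<gamma>] seg(2) cont])
    have "I \<delta> holomorphic_on - closed_segment u v"
      unfolding I_def uv by (rule linepath_Cauchy_integral_holomorphic[OF cont])
    then show "I \<delta> contour_integrable_on \<gamma>"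
      using \<Gamma>[OF \<gamma>] seg(2) by (intro contour_integrable_holomorphic_simple[of _ "- closed_segment u v"]) auto
    \<comment> \<open>Expressed by the winding number, the inner integral is visibly continuous
      along the segment, which gives integrability.\<close>
    have "contour_integral \<gamma> (\<lambda>z. 1 / (w - z)) = - ?c * winding_number \<gamma> w" if "w \<in> closed_segment u v" for w
    proof -
      have w: "w \<notin> path_image \<gamma>" using seg(2) that by blast
      have "contour_integral \<gamma> (\<lambda>z. 1 / (w - z)) = - contour_integral \<gamma> (\<lambda>z. 1 / (z - w))"
        by (rule contour_integral_reciprocal_flip)
      also have "\<dots> = - ?c * winding_number \<gamma> w"
        using winding_number_valid_path[OF \<Gamma>(2)[OF \<gamma>] w] by simp
      finally show ?thesis .
    qed
    moreover have "continuous_on (closed_segment u v) (\<lambda>w. F w * (- ?c * winding_number \<gamma> w))"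
      using seg(2) \<Gamma>(2)[OF \<gamma>]
      by (intro continuous_intros cont continuous_on_subset[OF continuous_on_winding_number])
         (auto intro: valid_path_imp_path)
    ultimately have "continuous_on (closed_segment u v) (\<lambda>w. F w * contour_integral \<gamma> (\<lambda>z. 1 / (w - z)))"
      by (simp cong: continuous_on_cong)
    then show "(\<lambda>w. F w * contour_integral \<gamma> (\<lambda>z. 1 / (w - z))) contour_integrable_on \<delta>"
      unfolding uv by (rule contour_integrable_continuous_linepath)
  qed
  have zero: "contour_integral \<delta> (\<lambda>w. \<Sum>\<gamma>\<leftarrow>\<Gamma>. F w * contour_integral \<gamma> (\<lambda>z. 1 / (w - z))) = 0"
    if \<delta>: "\<delta> \<in> set \<Delta>" for \<delta>
  proof -
    have "(\<Sum>\<gamma>\<leftarrow>\<Gamma>. F w * contour_integral \<gamma> (\<lambda>z. 1 / (w - z))) = 0" if "w \<in> path_image \<delta>" for w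
    proof -
      have w: "w \<notin> chain_trace \<Gamma>" "chain_index \<Gamma> w = 0"
        using \<Delta>(1)[OF \<delta>] that by (auto simp: chain_hull_def)
      have "(\<Sum>\<gamma>\<leftarrow>\<Gamma>. F w * contour_integral \<gamma> (\<lambda>z. 1 / (w - z))) =
          - F w * (\<Sum>\<gamma>\<leftarrow>\<Gamma>. contour_integral \<gamma> (\<lambda>z. 1 / (z - w)))"
        by (simp add: contour_integral_reciprocal_flip[of _ w] sum_list_const_mult[symmetric])
      then show ?thesis using chain_index_integral[OF cyc w(1)] w(2) by simp
    qed
    then have "contour_integral \<delta> (\<lambda>w. \<Sum>\<gamma>\<leftarrow>\<Gamma>. F w * contour_integral \<gamma> (\<lambda>z. 1 / (w - z))) =
        contour_integral \<delta> (\<lambda>w. 0)"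
      by (rule contour_integral_eq)
    then show ?thesis by simp
  qed
  have "contour_integral \<gamma> F = 1 / ?c * (\<Sum>\<delta>\<leftarrow>\<Delta>. contour_integral \<gamma> (I \<delta>))" if \<gamma>: "\<gamma> \<in> set \<Gamma>" for \<gamma>
  proof -
    have "contour_integral \<gamma> F = contour_integral \<gamma> (\<lambda>z. 1 / ?c * (\<Sum>\<delta>\<leftarrow>\<Delta>. I \<delta> z))"
      by (rule contour_integral_eq) (use rep \<Gamma>(1)[OF \<gamma>] in blast)
    also have "\<dots> = 1 / ?c * (\<Sum>\<delta>\<leftarrow>\<Delta>. contour_integral \<gamma> (I \<delta>))"
      using contour_integral_sum_list[of \<Delta> I \<gamma>] intI[OF \<gamma>] by (simp only: contour_integral_lmul)
    finally show ?thesis .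
  qed
  then have "(\<Sum>\<gamma>\<leftarrow>\<Gamma>. contour_integral \<gamma> F) = (\<Sum>\<gamma>\<leftarrow>\<Gamma>. 1 / ?c * (\<Sum>\<delta>\<leftarrow>\<Delta>. contour_integral \<gamma> (I \<delta>)))"
    by (intro arg_cong[where f = sum_list] map_cong) auto
  also have "\<dots> = 1 / ?c * (\<Sum>\<gamma>\<leftarrow>\<Gamma>. \<Sum>\<delta>\<leftarrow>\<Delta>. contour_integral \<gamma> (I \<delta>))"
    by (rule sum_list_const_mult)
  also have "(\<Sum>\<gamma>\<leftarrow>\<Gamma>. \<Sum>\<delta>\<leftarrow>\<Delta>. contour_integral \<gamma> (I \<delta>)) = (\<Sum>\<delta>\<leftarrow>\<Delta>. \<Sum>\<gamma>\<leftarrow>\<Gamma>. contour_integral \<gamma> (I \<delta>))"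
    by (rule sum_list_swap)
  also have "\<dots> = (\<Sum>\<delta>\<leftarrow>\<Delta>. 0)"
  proof (rule arg_cong[where f = sum_list], rule map_cong[OF refl])
    fix \<delta> assume \<delta>: "\<delta> \<in> set \<Delta>"
    have "(\<Sum>\<gamma>\<leftarrow>\<Gamma>. contour_integral \<gamma> (I \<delta>)) =
        (\<Sum>\<gamma>\<leftarrow>\<Gamma>. contour_integral \<delta> (\<lambda>w. F w * contour_integral \<gamma> (\<lambda>z. 1 / (w - z))))"
      using swap[OF _ \<delta>] by (intro arg_cong[where f = sum_list] map_cong) auto
    also have "\<dots> = contour_integral \<delta> (\<lambda>w. \<Sum>\<gamma>\<leftarrow>\<Gamma>. F w * contour_integral \<gamma> (\<lambda>z. 1 / (w - z)))"
      by (rule contour_integral_sum_list(2)[symmetric]) (rule intJ[OF _ \<delta>])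
    finally show "(\<Sum>\<gamma>\<leftarrow>\<Gamma>. contour_integral \<gamma> (I \<delta>)) = 0" using zero[OF \<delta>] by simp
  qed
  finally show ?thesis by simp
qed

section \<open>Vector-valued integrals over cycles\<close>

lemma bounded_bilinear_scaleC:
  "bounded_bilinear (scaleC :: complex \<Rightarrow> 'a::complex_banach_algebra_1 \<Rightarrow> 'a)"
proof
  show "\<exists>K. \<forall>(a::complex) (b::'a). norm (a *\<^sub>C b) \<le> norm a * norm b * K"
    by (rule exI[of _ 1]) (simp add: norm_scaleC)
  show "(r *\<^sub>R c) *\<^sub>C x = r *\<^sub>R (c *\<^sub>C x)" for r c and x :: 'a
    by (metis scaleC_of_real scaleC_scaleC scaleR_conv_of_real)
  show "c *\<^sub>C (r *\<^sub>R x) = r *\<^sub>R (c *\<^sub>C x)" for r c and x :: 'a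
    by (metis scaleC_of_real scaleC_scaleC mult.commute)
qed (simp_all add: scaleC_add_left scaleC_add_right)

interpretation scaleC: bounded_bilinear "scaleC :: complex \<Rightarrow> 'a::complex_banach_algebra_1 \<Rightarrow> 'a"
  by (rule bounded_bilinear_scaleC)

lemma scaleC_one [simp]: "1 *\<^sub>C x = (x :: 'a::complex_banach_algebra_1)"
  using scaleC_of_real[of 1 x] by simp

lemma functional_bounded_linear: "functional \<phi> \<Longrightarrow> bounded_linear \<phi>"
  by (simp add: functional_def)

text \<open>Scalar holomorphy through every functional makes Cauchy's theorem available; norm
  continuity is added so that integrals with values in the algebra exist.\<close>

definition weakly_holomorphic_on :: "(complex \<Rightarrow> 'a::complex_banach_algebra_1) \<Rightarrow> complex set \<Rightarrow> bool"
    (infixl "weakly'_holomorphic'_on" 50) where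
  "F weakly_holomorphic_on S \<longleftrightarrow>
     continuous_on S F \<and> (\<forall>\<phi>. functional \<phi> \<longrightarrow> (\<lambda>z. \<phi> (F z)) holomorphic_on S)"

lemma weakly_holomorphic_on_subset:
  "F weakly_holomorphic_on S \<Longrightarrow> T \<subseteq> S \<Longrightarrow> F weakly_holomorphic_on T"
  unfolding weakly_holomorphic_on_def by (meson continuous_on_subset holomorphic_on_subset)

definition segment_integral :: "complex \<Rightarrow> complex \<Rightarrow> (complex \<Rightarrow> 'a::complex_banach_algebra_1) \<Rightarrow> 'a" where
  "segment_integral u v F = integral {0..1} (\<lambda>t. (v - u) *\<^sub>C F (linepath u v t))"

lemma segment_integrable:
  assumes "continuous_on (closed_segment u v) F"
  shows "(\<lambda>t. c *\<^sub>C F (linepath u v t)) integrable_on {0..1}"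
proof (rule integrable_continuous_real)
  have "continuous_on {0..1} (\<lambda>t. F (linepath u v t))"
    by (rule continuous_on_compose2[OF assms])
       (auto intro!: continuous_intros simp: linepath_image_01[symmetric])
  then show "continuous_on {0..1} (\<lambda>t. c *\<^sub>C F (linepath u v t))"
    by (rule scaleC.continuous_on[OF continuous_on_const])
qed

lemma functional_segment_integral:
  assumes "functional \<phi>" "continuous_on (closed_segment u v) F"
  shows "\<phi> (segment_integral u v F) = contour_integral (linepath u v) (\<lambda>z. \<phi> (F z))"
proof -
  have "contour_integral (linepath u v) (\<lambda>z. \<phi> (F z)) =
      integral {0..1} (\<phi> \<circ> (\<lambda>t. (v - u) *\<^sub>C F (linepath u v t)))"
    unfolding contour_integral_integral
    by (rule integral_cong) (simp add: functional_scaleC[OF assms(1)] mult.commute)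
  also have "\<dots> = \<phi> (segment_integral u v F)"
    unfolding segment_integral_def
    by (rule integral_linear[OF segment_integrable[OF assms(2)] functional_bounded_linear[OF assms(1)]])
  finally show ?thesis by simp
qed

text \<open>Integrate from a base point. Additivity around a triangle is tested on functionals,
  where it is Cauchy's theorem; the derivative then follows from norm continuity of
  \<open>F\<close>. That the derivative multiplies \<open>F z\<close> by the complex increment is
  complex differentiability for a vector-valued map.\<close>

lemma weakly_holomorphic_primitive:
  fixes F :: "complex \<Rightarrow> 'a::complex_banach_algebra_1"
  assumes S: "open S" "convex S" and F: "F weakly_holomorphic_on S"
  obtains H where "\<And>z. z \<in> S \<Longrightarrow> (H has_derivative (\<lambda>h. h *\<^sub>C F z)) (at z)"
proof (cases "S = {}")
  case False
  then obtain c where c: "c \<in> S" by blast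
  have cont: "continuous_on S F" using F by (simp add: weakly_holomorphic_on_def)
  have seg: "closed_segment u v \<subseteq> S" if "u \<in> S" "v \<in> S" for u v
    using S(2) that by (simp add: closed_segment_subset)
  have contseg: "continuous_on (closed_segment u v) F" if "u \<in> S" "v \<in> S" for u v
    using cont seg[OF that] by (rule continuous_on_subset)
  have add: "segment_integral c v F - segment_integral c u F = segment_integral u v F" if "u \<in> S" "v \<in> S" for u v
  proof (rule functional_separates)
    fix \<phi> :: "'a \<Rightarrow> complex" assume \<phi>: "functional \<phi>"
    have hol: "(\<lambda>z. \<phi> (F z)) holomorphic_on S" using F \<phi> by (simp add: weakly_holomorphic_on_def)
    have "convex hull {c, u, v} \<subseteq> S" using S(2) c that by (simp add: hull_minimal)
    then have "((\<lambda>z. \<phi> (F z)) has_contour_integral 0) (linepath c u +++ linepath u v +++ linepath v c)"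
      by (intro Cauchy_theorem_triangle holomorphic_on_subset[OF hol])
    then have "contour_integral (linepath c u) (\<lambda>z. \<phi> (F z)) + contour_integral (linepath u v) (\<lambda>z. \<phi> (F z)) +
        contour_integral (linepath v c) (\<lambda>z. \<phi> (F z)) = 0"
      by (rule has_chain_integral_chain_integral3)
    moreover have "contour_integral (linepath v c) (\<lambda>z. \<phi> (F z)) = - contour_integral (linepath c v) (\<lambda>z. \<phi> (F z))"
      by (rule contour_integral_reverse_linepath)
         (use hol seg[OF that(2) c] in \<open>auto intro: holomorphic_on_imp_continuous_on holomorphic_on_subset\<close>)
    ultimately show "\<phi> (segment_integral c v F - segment_integral c u F) = \<phi> (segment_integral u v F)"
      using c that
      by (simp add: functional_diff[OF \<phi>] functional_segment_integral[OF \<phi>] contseg algebra_simps add_eq_0_iff)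
  qed
  have "((\<lambda>v. segment_integral c v F) has_derivative (\<lambda>h. h *\<^sub>C F z)) (at z)" if z: "z \<in> S" for z
    unfolding has_derivative_at_alt
  proof (intro conjI allI impI)
    show "bounded_linear (\<lambda>h. h *\<^sub>C F z)" by (rule scaleC.bounded_linear_left)
    fix e :: real assume e: "e > 0"
    obtain r where r: "r > 0" "ball z r \<subseteq> S" using S(1) z open_contains_ball by blast
    obtain d where d: "d > 0" "\<And>w. w \<in> S \<Longrightarrow> dist w z < d \<Longrightarrow> dist (F w) (F z) < e"
      using cont z e unfolding continuous_on_iff by blast
    have "norm (segment_integral c v F - segment_integral c z F - (v - z) *\<^sub>C F z) \<le> e * norm (v - z)"
      if v: "norm (v - z) < min r d" for v
    proof -
      have vS: "v \<in> S" using v r(2) by (auto simp: dist_norm norm_minus_commute subset_iff)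
      have int: "(\<lambda>t. (v - z) *\<^sub>C F (linepath z v t)) integrable_on {0..1}"
        by (rule segment_integrable[OF contseg[OF z vS]])
      have "segment_integral c v F - segment_integral c z F - (v - z) *\<^sub>C F z =
          integral {0..1} (\<lambda>t. (v - z) *\<^sub>C F (linepath z v t)) - integral {0..1} (\<lambda>t::real. (v - z) *\<^sub>C F z)"
        using add[OF z vS] by (simp add: segment_integral_def)
      also have "\<dots> = integral {0..1} (\<lambda>t. (v - z) *\<^sub>C F (linepath z v t) - (v - z) *\<^sub>C F z)"
        by (rule integral_diff[symmetric, OF int]) auto
      also have "norm \<dots> \<le> e * norm (v - z) * (1 - 0)"
      proof (rule integral_bound)
        show "continuous_on {0..1} (\<lambda>t. (v - z) *\<^sub>C F (linepath z v t) - (v - z) *\<^sub>C F z)"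
          by (intro continuous_intros scaleC.continuous_on continuous_on_compose2[OF contseg[OF z vS]])
             (auto simp: linepath_image_01[symmetric])
        fix t :: real assume t: "t \<in> {0..1}"
        have "linepath z v t \<in> closed_segment z v" using t by (auto simp: linepath_image_01[symmetric])
        then have "linepath z v t \<in> S" using seg[OF z vS] by blast
        moreover have "dist (linepath z v t) z \<le> norm (v - z)"
          using t by (simp add: linepath_def dist_norm algebra_simps flip: scaleR_diff_right norm_scaleR)
             (metis mult_left_le_one_le norm_ge_zero norm_scaleR abs_of_nonneg scaleR_diff_right)
        ultimately have "norm (F (linepath z v t) - F z) \<le> e"
          using d(2)[of "linepath z v t"] v by (simp add: dist_norm)
        then have "norm (v - z) * norm (F (linepath z v t) - F z) \<le> norm (v - z) * e"
          by (simp add: mult_left_mono)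
        then show "norm ((v - z) *\<^sub>C F (linepath z v t) - (v - z) *\<^sub>C F z) \<le> e * norm (v - z)"
          by (simp add: scaleC.diff_right[symmetric] norm_scaleC mult.commute[of e])
      qed simp
      finally show ?thesis by simp
    qed
    then show "\<exists>d>0. \<forall>v. norm (v - z) < d \<longrightarrow>
        norm (segment_integral c v F - segment_integral c z F - (v - z) *\<^sub>C F z) \<le> e * norm (v - z)"
      using r(1) d(1) by (intro exI[of _ "min r d"]) simp
  qed
  then show thesis by (rule that)
qed (use that in blast)

text \<open>A valid path need not have bounded velocity, so continuity of the integrand does not suffice
  here.\<close>

lemma weakly_holomorphic_integrable_on_path:
  fixes F :: "complex \<Rightarrow> 'a::complex_banach_algebra_1"
  assumes S: "open S" and F: "F weakly_holomorphic_on S" and \<gamma>: "valid_path \<gamma>" "path_image \<gamma> \<subseteq> S"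
  shows "(\<lambda>t. vector_derivative \<gamma> (at t within {0..1}) *\<^sub>C F (\<gamma> t)) integrable_on {0..1}"
proof -
  let ?f = "\<lambda>t. vector_derivative \<gamma> (at t within {0..1}) *\<^sub>C F (\<gamma> t)"
  obtain T where T: "finite T" "\<gamma> C1_differentiable_on ({0..1} - T)" and cont: "continuous_on {0..1} \<gamma>"
    using \<gamma>(1) by (auto simp: valid_path_def piecewise_C1_differentiable_on_def)
  \<comment> \<open>Locally \<open>F\<close> has a primitive \<open>H\<close>, and the integrand is
    the derivative of \<open>H \<circ> \<gamma>\<close> off a finite set. The fundamental theorem
    gives integrability on short intervals without any bound on the velocity; the short intervals
    are glued at the end.\<close>
  have local: "\<exists>d>0. \<forall>u v. x \<in> cbox u v \<and> cbox u v \<subseteq> ball x d \<and> cbox u v \<subseteq> cbox 0 1 \<longrightarrow> ?f integrable_on cbox u v"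
    if x: "x \<in> cbox 0 1" for x
  proof -
    have "\<gamma> x \<in> S" using \<gamma>(2) x by (auto simp: path_image_def)
    then obtain r where r: "r > 0" "ball (\<gamma> x) r \<subseteq> S" using S open_contains_ball by blast
    obtain H where H: "\<And>z. z \<in> ball (\<gamma> x) r \<Longrightarrow> (H has_derivative (\<lambda>h. h *\<^sub>C F z)) (at z)"
      using weakly_holomorphic_primitive[OF open_ball convex_ball weakly_holomorphic_on_subset[OF F r(2)]] by blast
    obtain d where d: "d > 0" "\<And>t. t \<in> {0..1} \<Longrightarrow> dist t x < d \<Longrightarrow> dist (\<gamma> t) (\<gamma> x) < r"
      using cont x r(1) unfolding continuous_on_iff by (metis box_real(2))
    have "?f integrable_on cbox u v" if uv: "x \<in> cbox u v" "cbox u v \<subseteq> ball x d" "cbox u v \<subseteq> cbox 0 1" for u v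
    proof -
      have uv': "u \<le> v" "{u..v} \<subseteq> {0..1}" using uv by auto
      have mem: "\<gamma> t \<in> ball (\<gamma> x) r" if "t \<in> {u..v}" for t
        using d(2)[of t] that uv uv'(2) by (auto simp: dist_commute subset_iff)
      have "(?f has_integral ((H \<circ> \<gamma>) v - (H \<circ> \<gamma>) u)) {u..v}"
      proof (rule fundamental_theorem_of_calculus_interior_strong[OF T(1) uv'(1)])
        fix t assume t: "t \<in> {u<..<v} - T"
        then have t01: "t \<in> {0..1} - T" and tuv: "t \<in> {u..v}" using uv'(2) by auto
        then have "\<gamma> differentiable at t" using T(2) by (auto simp: C1_differentiable_on_eq)
        then have D: "(\<gamma> has_vector_derivative vector_derivative \<gamma> (at t)) (at t)"
          by (simp add: vector_derivative_works)
        then have eq: "vector_derivative \<gamma> (at t within {0..1}) = vector_derivative \<gamma> (at t)"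
          using t01 by (intro vector_derivative_at_within_ivl) auto
        have "(H \<circ> \<gamma> has_derivative (\<lambda>h. h *\<^sub>C F (\<gamma> t)) \<circ> (\<lambda>s. s *\<^sub>R vector_derivative \<gamma> (at t))) (at t)"
          using D H[OF mem[OF tuv]] unfolding has_vector_derivative_def by (intro diff_chain_at) auto
        then show "(H \<circ> \<gamma> has_vector_derivative ?f t) (at t)"
          unfolding eq has_vector_derivative_def by (simp add: o_def scaleC.scaleR_left)
      next
        show "continuous_on {u..v} (H \<circ> \<gamma>)"
        proof (rule continuous_on_compose)
          show "continuous_on {u..v} \<gamma>" using cont uv'(2) by (rule continuous_on_subset)
          show "continuous_on (\<gamma> ` {u..v}) H"
            using H mem by (intro continuous_at_imp_continuous_on ballI) (blast intro: has_derivative_continuous)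
        qed
      qed
      then show ?thesis by auto
    qed
    then show ?thesis using d(1) by blast
  qed
  show ?thesis
    using integrable_on_little_subintervals[of "0::real" 1 ?f] local by simp
qed

text \<open>The bridge from vector to scalar integrals: since the vector integral exists along each
  path, a bounded linear functional may be moved inside.\<close>

lemma functional_chain_integral:
  fixes F :: "complex \<Rightarrow> 'a::complex_banach_algebra_1"
  assumes \<phi>: "functional \<phi>" and S: "open S" "F weakly_holomorphic_on S" and cyc: "cycle_in S \<Gamma>"
  shows "\<phi> (chain_integral \<Gamma> F) = (\<Sum>\<gamma>\<leftarrow>\<Gamma>. contour_integral \<gamma> (\<lambda>z. \<phi> (F z)))"
proof -
  let ?f = "\<lambda>\<gamma> t. vector_derivative \<gamma> (at t within {0..1}) *\<^sub>C F (\<gamma> t)"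
  have \<phi>_sum: "\<phi> (sum_list xs) = (\<Sum>x\<leftarrow>xs. \<phi> x)" for xs
    by (induction xs) (simp_all add: functional_add[OF \<phi>] functional_zero[OF \<phi>])
  have one: "\<phi> (integral {0..1} (?f \<gamma>)) = contour_integral \<gamma> (\<lambda>z. \<phi> (F z))" if "\<gamma> \<in> set \<Gamma>" for \<gamma>
  proof -
    have "?f \<gamma> integrable_on {0..1}"
      using cyc that by (intro weakly_holomorphic_integrable_on_path[OF S]) (auto simp: cycle_in_def)
    then have "(?f \<gamma> has_integral integral {0..1} (?f \<gamma>)) {0..1}" by (rule integrable_integral)
    from has_integral_linear[OF this functional_bounded_linear[OF \<phi>]]
    have "((\<lambda>z. \<phi> (F z)) has_contour_integral \<phi> (integral {0..1} (?f \<gamma>))) \<gamma>"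
      unfolding has_contour_integral_def by (simp add: o_def functional_scaleC[OF \<phi>] mult.commute)
    then show ?thesis by (simp add: contour_integral_unique)
  qed
  have "\<phi> (chain_integral \<Gamma> F) = (\<Sum>\<gamma>\<leftarrow>\<Gamma>. \<phi> (integral {0..1} (?f \<gamma>)))"
    unfolding chain_integral_def \<phi>_sum by (simp add: o_def)
  also have "\<dots> = (\<Sum>\<gamma>\<leftarrow>\<Gamma>. contour_integral \<gamma> (\<lambda>z. \<phi> (F z)))"
    by (intro arg_cong[where f = sum_list] map_cong one) auto
  finally show ?thesis .
qed

section \<open>The resolvent\<close>

lemma ring_of_type_algebra_ring: "ring (ring_of_type_algebra :: 'a::ring_1 ring)"
proof -
  have "\<exists>y. x + y = 0" for x :: 'a using add.right_inverse by blast
  then show ?thesis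
    unfolding ring_of_type_algebra_def using add.right_inverse
    by unfold_locales (auto simp: algebra_simps Units_def)
qed

lemma Units_ring_of_type_algebra:
  "u \<in> Units ring_of_type_algebra \<longleftrightarrow> (\<exists>v. u * v = 1 \<and> v * u = 1)" for u :: "'a::ring_1"
  by (auto simp: Units_def ring_of_type_algebra_def)

lemma Units_minus_iff: "- u \<in> Units ring_of_type_algebra \<longleftrightarrow> u \<in> Units ring_of_type_algebra" for u :: "'a::ring_1"
  unfolding Units_ring_of_type_algebra by (metis minus_mult_minus minus_mult_commute minus_minus)

lemma Units_times:
  "u \<in> Units ring_of_type_algebra \<Longrightarrow> v \<in> Units ring_of_type_algebra \<Longrightarrow> u * v \<in> Units ring_of_type_algebra"
  for u v :: "'a::ring_1"
proof -
  interpret ring "ring_of_type_algebra :: 'a ring" by (rule ring_of_type_algebra_ring)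
  show "u \<in> Units ring_of_type_algebra \<Longrightarrow> v \<in> Units ring_of_type_algebra \<Longrightarrow> u * v \<in> Units ring_of_type_algebra"
    using Units_m_closed[of u v] by (simp add: ring_of_type_algebra_def)
qed

text \<open>The inverse is the Neumann series, which converges by completeness.\<close>

lemma one_minus_Units:
  fixes x :: "'a::{real_normed_algebra_1, banach}"
  assumes "norm x < 1"
  shows "1 - x \<in> Units ring_of_type_algebra"
proof -
  have s: "summable (\<lambda>n. x ^ n)" by (rule complete_algebra_summable_geometric[OF assms])
  have "(\<Sum>n. x ^ n) = 1 + (\<Sum>n. x ^ Suc n)"
    using suminf_split_head[OF s] by simp
  moreover have "(\<Sum>n. x ^ Suc n) = x * (\<Sum>n. x ^ n)" "(\<Sum>n. x ^ Suc n) = (\<Sum>n. x ^ n) * x"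
    using suminf_mult[OF s, of x] suminf_mult2[OF s, of x] by (simp_all add: power_commutes)
  ultimately have "(1 - x) * (\<Sum>n. x ^ n) = 1" "(\<Sum>n. x ^ n) * (1 - x) = 1"
    by (simp_all add: left_diff_distrib right_diff_distrib)
  then show ?thesis unfolding Units_ring_of_type_algebra by blast
qed

section \<open>Resolvent set and analyticity of the resolvent\<close>

context
  fixes a :: "'a::complex_banach_algebra_1"
begin

lemma notin_spectrum_iff: "z \<notin> spectrum a \<longleftrightarrow> z *\<^sub>C 1 - a \<in> Units ring_of_type_algebra"
  using Units_minus_iff[of "a - z *\<^sub>C 1"] by (simp add: spectrum_def)

lemma resolvent_inverse:
  assumes "z \<notin> spectrum a"
  shows "(z *\<^sub>C 1 - a) * resolvent a z = 1" "resolvent a z * (z *\<^sub>C 1 - a) = 1"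
proof -
  interpret ring "ring_of_type_algebra :: 'a ring" by (rule ring_of_type_algebra_ring)
  show "(z *\<^sub>C 1 - a) * resolvent a z = 1" "resolvent a z * (z *\<^sub>C 1 - a) = 1"
    using Units_r_inv[of "z *\<^sub>C 1 - a"] Units_l_inv[of "z *\<^sub>C 1 - a"] assms
    unfolding notin_spectrum_iff resolvent_def by (simp_all add: ring_of_type_algebra_def)
qed

lemma resolvent_scaleC:
  assumes "z \<notin> spectrum a"
  shows "z *\<^sub>C resolvent a z = 1 + a * resolvent a z" "z *\<^sub>C resolvent a z = 1 + resolvent a z * a"
  using resolvent_inverse[OF assms]
  by (simp_all add: left_diff_distrib right_diff_distrib scaleC_mult_left scaleC_mult_right algebra_simps)

text \<open>Write \<open>R(z)\<close> for the resolvent. Substituting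
  \<open>z R(z) = 1 + R(z) a\<close> and \<open>w R(w) = 1 + a R(w)\<close> on the right-hand side
  makes the mixed terms \<open>R(z) a R(w)\<close> cancel.\<close>

lemma resolvent_identity:
  assumes "z \<notin> spectrum a" "w \<notin> spectrum a"
  shows "resolvent a z - resolvent a w = (w - z) *\<^sub>C (resolvent a z * resolvent a w)"
proof -
  have "(w - z) *\<^sub>C (resolvent a z * resolvent a w) =
      resolvent a z * (w *\<^sub>C resolvent a w) - (z *\<^sub>C resolvent a z) * resolvent a w"
    by (simp add: scaleC.diff_left scaleC_mult_left scaleC_mult_right)
  also have "\<dots> = resolvent a z - resolvent a w"
    using resolvent_scaleC(1)[OF assms(2)] resolvent_scaleC(2)[OF assms(1)]
    by (simp add: distrib_left distrib_right mult.assoc)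
  finally show ?thesis by simp
qed

text \<open>For larger \<open>z\<close> factor \<open>z - a\<close> as \<open>z (1 - a / z)\<close>
  and invert the second factor by the Neumann series.\<close>

lemma norm_in_spectrum: "z \<in> spectrum a \<Longrightarrow> norm z \<le> norm a"
proof (rule ccontr)
  assume z: "z \<in> spectrum a" and "\<not> norm z \<le> norm a"
  then have less: "norm a < norm z" by simp
  then have "z \<noteq> 0" by auto
  have "norm ((1 / z) *\<^sub>C a) < 1" using less by (simp add: norm_scaleC norm_divide divide_less_eq)
  then have "1 - (1 / z) *\<^sub>C a \<in> Units ring_of_type_algebra" by (rule one_minus_Units)
  moreover have "z *\<^sub>C (1 :: 'a) \<in> Units ring_of_type_algebra"
    unfolding Units_ring_of_type_algebra using \<open>z \<noteq> 0\<close>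
    by (intro exI[of _ "(1 / z) *\<^sub>C 1"]) (simp add: scaleC_mult_left scaleC_mult_right scaleC_scaleC)
  ultimately have "z *\<^sub>C 1 * (1 - (1 / z) *\<^sub>C a) \<in> Units ring_of_type_algebra" by (intro Units_times)
  moreover have "z *\<^sub>C 1 * (1 - (1 / z) *\<^sub>C a) = z *\<^sub>C 1 - a"
    using \<open>z \<noteq> 0\<close> by (simp add: right_diff_distrib scaleC_mult_left scaleC_mult_right scaleC_scaleC)
  ultimately show False using z notin_spectrum_iff[of z] by simp
qed

text \<open>Near \<open>z\<close>, the element \<open>w - a\<close> is \<open>z - a\<close> times
  \<open>1 - (z - w) R(z)\<close>, and the Neumann series inverts the second factor. The 1 added to
  the norm keeps the radius free of a division by 0.\<close>

lemma open_resolvent_set: "open (- spectrum a)"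
  unfolding open_contains_ball
proof
  fix z assume z: "z \<in> - spectrum a"
  let ?R = "resolvent a z"
  have "ball z (1 / (norm ?R + 1)) \<subseteq> - spectrum a"
  proof
    fix w assume "w \<in> ball z (1 / (norm ?R + 1))"
    then have "norm (z - w) * (norm ?R + 1) < 1"
      by (simp add: dist_norm pos_less_divide_eq add_nonneg_pos)
    moreover have "norm (z - w) * norm ?R \<le> norm (z - w) * (norm ?R + 1)"
      by (intro mult_left_mono) auto
    ultimately have "norm ((z - w) *\<^sub>C ?R) < 1" by (simp add: norm_scaleC)
    then have "1 - (z - w) *\<^sub>C ?R \<in> Units ring_of_type_algebra" by (rule one_minus_Units)
    then have "(z *\<^sub>C 1 - a) * (1 - (z - w) *\<^sub>C ?R) \<in> Units ring_of_type_algebra"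
      using z notin_spectrum_iff[of z] by (intro Units_times) auto
    moreover have "(z *\<^sub>C 1 - a) * (1 - (z - w) *\<^sub>C ?R) = w *\<^sub>C 1 - a"
      using resolvent_inverse(1)[of z] z
      by (simp add: right_diff_distrib scaleC_mult_right scaleC.diff_left)
    ultimately show "w \<in> - spectrum a" using notin_spectrum_iff[of w] by simp
  qed
  then show "\<exists>e>0. ball z e \<subseteq> - spectrum a"
    by (intro exI[of _ "1 / (norm ?R + 1)"]) (simp add: add_nonneg_pos)
qed

lemma compact_spectrum: "compact (spectrum a)"
  unfolding compact_eq_bounded_closed
  using norm_in_spectrum open_resolvent_set by (auto simp: bounded_iff closed_def)

text \<open>The resolvent identity bounds the increment, but in terms of the norm of the resolvent
  at the moving point, which has to be controlled beforehand.\<close>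

lemma continuous_on_resolvent: "continuous_on (- spectrum a) (resolvent a)"
  unfolding continuous_on_eq_continuous_at[OF open_resolvent_set]
proof
  fix z assume z: "z \<in> - spectrum a"
  let ?R = "resolvent a z"
  \<comment> \<open>Within this radius the increment is at most half of
    \<open>norm (resolvent a w)\<close>, so the latter is at most
    \<open>2 * norm ?R\<close>.\<close>
  define d where "d = 1 / (2 * (norm ?R + 1))"
  have "d > 0" by (simp add: d_def add_nonneg_pos)
  have "\<forall>\<^sub>F w in at z. w \<in> - spectrum a"
    using open_resolvent_set z by (rule eventually_at_in_open'[THEN eventually_mono]) simp
  moreover have "\<forall>\<^sub>F w in at z. dist w z < d"
    using \<open>d > 0\<close> by (auto simp: eventually_at)
  ultimately have "\<forall>\<^sub>F w in at z. norm (resolvent a w - ?R) \<le> norm (w - z) * (2 * norm ?R * norm ?R)"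
  proof eventually_elim
    case (elim w)
    have eq: "resolvent a w - ?R = (z - w) *\<^sub>C (resolvent a w * ?R)"
      using elim z by (intro resolvent_identity) auto
    have le: "norm (resolvent a w - ?R) \<le> norm (w - z) * (norm (resolvent a w) * norm ?R)"
      unfolding eq norm_scaleC by (simp add: norm_minus_commute mult_left_mono norm_mult_ineq)
    have "norm (w - z) * norm ?R \<le> norm (w - z) * (norm ?R + 1)" by (intro mult_left_mono) auto
    also have "\<dots> \<le> d * (norm ?R + 1)" using elim(2) by (intro mult_right_mono) (auto simp: dist_norm)
    also have "\<dots> = 1 / 2" by (simp add: d_def add_nonneg_eq_0_iff)
    finally have "norm (w - z) * norm ?R * norm (resolvent a w) \<le> 1 / 2 * norm (resolvent a w)"
      by (intro mult_right_mono) auto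
    then have "norm (resolvent a w - ?R) \<le> 1 / 2 * norm (resolvent a w)"
      using le by (simp add: mult_ac)
    then have "norm (resolvent a w) \<le> 2 * norm ?R"
      using norm_triangle_ineq[of "resolvent a w - ?R" ?R] by simp
    then have "norm (w - z) * (norm (resolvent a w) * norm ?R) \<le> norm (w - z) * (2 * norm ?R * norm ?R)"
      by (intro mult_left_mono mult_right_mono) auto
    then show ?case using le by linarith
  qed
  then have "((\<lambda>w. resolvent a w - ?R) \<longlongrightarrow> 0) (at z)"
  proof (rule Lim_null_comparison)
    have "((\<lambda>w. norm (w - z) * (2 * norm ?R * norm ?R)) \<longlongrightarrow> norm (z - z) * (2 * norm ?R * norm ?R)) (at z)"
      by (intro tendsto_intros)
    then show "((\<lambda>w. norm (w - z) * (2 * norm ?R * norm ?R)) \<longlongrightarrow> 0) (at z)" by simp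
  qed
  then show "isCont (resolvent a) z" unfolding isCont_def by (rule LIM_zero_cancel)
qed

text \<open>By the resolvent identity the difference quotient is the functional at
  \<open>- R(w) R(z)\<close>, and continuity of the resolvent gives the limit.\<close>

lemma functional_resolvent_holomorphic:
  assumes "functional \<phi>"
  shows "(\<lambda>z. \<phi> (resolvent a z)) holomorphic_on - spectrum a"
proof -
  have "((\<lambda>z. \<phi> (resolvent a z)) has_field_derivative \<phi> (- (resolvent a z * resolvent a z))) (at z)"
    if z: "z \<in> - spectrum a" for z
    unfolding has_field_derivative_iff
  proof (rule Lim_transform_eventually)
    have "isCont (resolvent a) z"
      using continuous_on_resolvent z continuous_on_eq_continuous_at[OF open_resolvent_set] by blast
    then have "((\<lambda>w. - (resolvent a w * resolvent a z)) \<longlongrightarrow> - (resolvent a z * resolvent a z)) (at z)"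
      unfolding isCont_def by (intro tendsto_intros)
    then show "((\<lambda>w. \<phi> (- (resolvent a w * resolvent a z))) \<longlongrightarrow> \<phi> (- (resolvent a z * resolvent a z))) (at z)"
      by (rule bounded_linear.tendsto[OF functional_bounded_linear[OF assms]])
    have "\<forall>\<^sub>F w in at z. w \<in> - spectrum a"
      using open_resolvent_set z by (rule eventually_at_in_open'[THEN eventually_mono]) simp
    moreover have "\<forall>\<^sub>F w in at z. w \<noteq> z" by (simp add: eventually_at_filter)
    ultimately show "\<forall>\<^sub>F w in at z. \<phi> (- (resolvent a w * resolvent a z)) =
        (\<phi> (resolvent a w) - \<phi> (resolvent a z)) / (w - z)"
    proof eventually_elim
      case (elim w)
      have "\<phi> (resolvent a w) - \<phi> (resolvent a z) = \<phi> ((z - w) *\<^sub>C (resolvent a w * resolvent a z))"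
        using resolvent_identity[of w z] elim(1) z by (simp add: functional_diff[OF assms, symmetric])
      also have "\<dots> = (w - z) * \<phi> (- (resolvent a w * resolvent a z))"
        using functional_diff[OF assms, of 0] functional_zero[OF assms]
        by (simp add: functional_scaleC[OF assms] algebra_simps)
      finally show ?case using elim(2) by simp
    qed
  qed
  then show ?thesis
    unfolding holomorphic_on_def field_differentiable_def
    by (blast intro: has_field_derivative_at_within)
qed

lemma scaleC_resolvent_weakly_holomorphic:
  assumes "h holomorphic_on U"
  shows "(\<lambda>z. h z *\<^sub>C resolvent a z) weakly_holomorphic_on U - spectrum a"
  unfolding weakly_holomorphic_on_def
proof (intro conjI allI impI)
  have h: "h holomorphic_on U - spectrum a" by (rule holomorphic_on_subset[OF assms]) auto
  show "continuous_on (U - spectrum a) (\<lambda>z. h z *\<^sub>C resolvent a z)"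
    by (intro scaleC.continuous_on holomorphic_on_imp_continuous_on[OF h]
        continuous_on_subset[OF continuous_on_resolvent]) auto
  fix \<phi> :: "'a \<Rightarrow> complex" assume \<phi>: "functional \<phi>"
  have "(\<lambda>z. h z * \<phi> (resolvent a z)) holomorphic_on U - spectrum a"
    by (intro holomorphic_intros h holomorphic_on_subset[OF functional_resolvent_holomorphic[OF \<phi>]]) auto
  then show "(\<lambda>z. \<phi> (h z *\<^sub>C resolvent a z)) holomorphic_on U - spectrum a"
    by (simp add: functional_scaleC[OF \<phi>])
qed

end

section \<open>The Dunford--Riesz integral\<close>

lemma sum_list_uminus: "(\<Sum>x\<leftarrow>xs. - f x) = - (\<Sum>x\<leftarrow>xs. f x)"
  for f :: "'b \<Rightarrow> 'c::ab_group_add"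
  by (induction xs) simp_all

lemma holomorphic_on_sum_list:
  "(\<And>x. x \<in> set xs \<Longrightarrow> f x holomorphic_on S) \<Longrightarrow> (\<lambda>z. \<Sum>x\<leftarrow>xs. f x z) holomorphic_on S"
  by (induction xs) (auto intro!: holomorphic_intros)

lemma surrounds_in_cycle: "surrounds_in \<Gamma> K U \<Longrightarrow> cycle_in (U - K) \<Gamma>"
  by (simp add: surrounds_in_def)

lemma surrounds_in_cycle': "surrounds_in \<Gamma> K U \<Longrightarrow> cycle_in U \<Gamma>"
proof -
  assume "surrounds_in \<Gamma> K U"
  then have "cycle_in (U - K) \<Gamma>" by (rule surrounds_in_cycle)
  then show ?thesis by (rule cycle_in_superset) (use \<open>cycle_in (U - K) \<Gamma>\<close> in \<open>auto simp: cycle_in_iff\<close>)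
qed

lemma Cauchy_theorem_surrounds:
  assumes "surrounds_in \<Gamma> K U" "open U" "F holomorphic_on U"
  shows "(\<Sum>\<gamma>\<leftarrow>\<Gamma>. contour_integral \<gamma> F) = 0"
  using assms by (intro Cauchy_theorem_cycle[OF assms(2,3) surrounds_in_cycle'[OF assms(1)]])
    (auto simp: surrounds_in_def)

lemma surrounds_in_inner:
  assumes "surrounds_in \<Gamma> N U" "K \<subseteq> N"
  shows "surrounds_in \<Gamma> K U"
  unfolding surrounds_in_def
proof (intro conjI)
  show "cycle_in (U - K) \<Gamma>"
    by (rule cycle_in_superset[OF surrounds_in_cycle[OF assms(1)]])
       (use assms surrounds_in_cycle[OF assms(1)] in \<open>auto simp: cycle_in_iff\<close>)
qed (use assms in \<open>auto simp: surrounds_in_def\<close>)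

lemma cycle_in_append_reverse:
  assumes "cycle_in S \<Gamma>" "cycle_in S \<Delta>"
  shows "cycle_in S (\<Gamma> @ map reversepath \<Delta>)"
proof -
  have "mset (map pathstart (\<Gamma> @ map reversepath \<Delta>)) = mset (map pathstart \<Gamma>) + mset (map pathfinish \<Delta>)"
    "mset (map pathfinish (\<Gamma> @ map reversepath \<Delta>)) = mset (map pathfinish \<Gamma>) + mset (map pathstart \<Delta>)"
    by (simp_all add: o_def)
  then have "mset (map pathstart (\<Gamma> @ map reversepath \<Delta>)) = mset (map pathfinish (\<Gamma> @ map reversepath \<Delta>))"
    using assms by (simp add: cycle_in_def)
  moreover have "\<forall>\<gamma>\<in>set (\<Gamma> @ map reversepath \<Delta>). valid_path \<gamma> \<and> path_image \<gamma> \<subseteq> S"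
    using assms by (simp add: cycle_in_def ball_Un)
  ultimately show ?thesis unfolding cycle_in_def by blast
qed

lemma chain_index_append_reverse:
  assumes "cycle_in S \<Delta>" "z \<notin> S"
  shows "chain_index (\<Gamma> @ map reversepath \<Delta>) z = chain_index \<Gamma> z - chain_index \<Delta> z"
proof -
  have "(\<Sum>\<gamma>\<leftarrow>\<Delta>. winding_number (reversepath \<gamma>) z) = (\<Sum>\<gamma>\<leftarrow>\<Delta>. - winding_number \<gamma> z)"
    by (intro arg_cong[where f = sum_list] map_cong refl winding_number_reversepath)
       (use assms in \<open>auto simp: cycle_in_def intro: valid_path_imp_path\<close>)
  then show ?thesis by (simp add: chain_index_def o_def sum_list_uminus)
qed

text \<open>The difference of the cycles has index 0 off \<open>U - K\<close>: on \<open>K\<close>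
  both indices are 1, and off \<open>U\<close> both are 0 because \<open>U'\<close> lies inside
  \<open>U\<close>. Functionals reduce the claim to Cauchy's theorem.\<close>

lemma chain_integral_surrounds_unique:
  fixes F :: "complex \<Rightarrow> 'a::complex_banach_algebra_1"
  assumes K: "closed K" and U: "open U" "open U'" "U' \<subseteq> U"
    and surr: "surrounds_in \<Gamma> K U" "surrounds_in \<Gamma>' K U'"
    and F: "F weakly_holomorphic_on U - K"
  shows "chain_integral \<Gamma> F = chain_integral \<Gamma>' F"
proof (rule functional_separates)
  fix \<phi> :: "'a \<Rightarrow> complex" assume \<phi>: "functional \<phi>"
  have cyc: "cycle_in (U - K) \<Gamma>" by (rule surrounds_in_cycle[OF surr(1)])
  have cyc': "cycle_in (U - K) \<Gamma>'"
    by (rule cycle_in_superset[OF surrounds_in_cycle[OF surr(2)]])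
       (use U(3) surrounds_in_cycle[OF surr(2)] in \<open>auto simp: cycle_in_iff\<close>)
  have opn: "open (U - K)" using K U(1) by blast
  let ?\<Delta> = "\<Gamma> @ map reversepath \<Gamma>'"
  have "(\<Sum>\<gamma>\<leftarrow>?\<Delta>. contour_integral \<gamma> (\<lambda>z. \<phi> (F z))) = 0"
  proof (rule Cauchy_theorem_cycle[OF opn _ cycle_in_append_reverse[OF cyc cyc']])
    show "(\<lambda>z. \<phi> (F z)) holomorphic_on U - K" using F \<phi> by (simp add: weakly_holomorphic_on_def)
    fix z assume z: "z \<notin> U - K"
    have "chain_index ?\<Delta> z = chain_index \<Gamma> z - chain_index \<Gamma>' z"
      by (rule chain_index_append_reverse[OF cyc' z])
    also have "\<dots> = 0" using surr z U(3) unfolding surrounds_in_def by (cases "z \<in> K") auto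
    finally show "chain_index ?\<Delta> z = 0" .
  qed
  moreover have "(\<Sum>\<gamma>\<leftarrow>\<Gamma>'. contour_integral (reversepath \<gamma>) (\<lambda>z. \<phi> (F z))) =
      (\<Sum>\<gamma>\<leftarrow>\<Gamma>'. - contour_integral \<gamma> (\<lambda>z. \<phi> (F z)))"
    by (intro arg_cong[where f = sum_list] map_cong refl contour_integral_reversepath)
       (use cyc' in \<open>auto simp: cycle_in_def\<close>)
  ultimately have "(\<Sum>\<gamma>\<leftarrow>\<Gamma>. contour_integral \<gamma> (\<lambda>z. \<phi> (F z))) = (\<Sum>\<gamma>\<leftarrow>\<Gamma>'. contour_integral \<gamma> (\<lambda>z. \<phi> (F z)))"
    by (simp add: o_def sum_list_uminus)
  then show "\<phi> (chain_integral \<Gamma> F) = \<phi> (chain_integral \<Gamma>' F)"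
    by (simp add: functional_chain_integral[OF \<phi> opn F] cyc cyc')
qed

text \<open>The integral behind \<open>functional_calculus\<close> with the cycle as a parameter, so
  that the cycle may be shrunk towards the spectrum or expanded to a large circle.\<close>

definition dunford :: "(real \<Rightarrow> complex) list \<Rightarrow> 'a::complex_banach_algebra_1 \<Rightarrow> (complex \<Rightarrow> complex) \<Rightarrow> 'a" where
  "dunford \<Gamma> a h = (1 / (2 * complex_of_real pi * \<i>)) *\<^sub>C chain_integral \<Gamma> (\<lambda>z. h z *\<^sub>C resolvent a z)"

section \<open>Algebraic laws of the Dunford-Riesz integral\<close>

context
  fixes a :: "'a::complex_banach_algebra_1" and U :: "complex set"
  assumes U: "open U"
begin

lemma open_minus_spectrum: "open (U - spectrum a)"
  using U compact_imp_closed[OF compact_spectrum[of a]] by blast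

lemma functional_dunford:
  assumes "functional \<phi>" "surrounds_in \<Gamma> (spectrum a) U" "h holomorphic_on U"
  shows "\<phi> (dunford \<Gamma> a h) =
    1 / (2 * of_real pi * \<i>) * (\<Sum>\<gamma>\<leftarrow>\<Gamma>. contour_integral \<gamma> (\<lambda>z. h z * \<phi> (resolvent a z)))"
  unfolding dunford_def functional_scaleC[OF assms(1)]
    functional_chain_integral[OF assms(1) open_minus_spectrum
      scaleC_resolvent_weakly_holomorphic[OF assms(3)] surrounds_in_cycle[OF assms(2)]] ..

lemma dunford_cycle_unique:
  assumes "surrounds_in \<Gamma> (spectrum a) U" "surrounds_in \<Gamma>' (spectrum a) U'" "open U'" "U' \<subseteq> U"
    and "h holomorphic_on U"
  shows "dunford \<Gamma> a h = dunford \<Gamma>' a h"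
  unfolding dunford_def
  by (rule arg_cong[where f = "scaleC _"],
      rule chain_integral_surrounds_unique[OF compact_imp_closed[OF compact_spectrum] U assms(3,4,1,2)])
     (rule scaleC_resolvent_weakly_holomorphic[OF assms(5)])

lemma integrable_functional_resolvent:
  assumes "functional \<phi>" "surrounds_in \<Gamma> (spectrum a) U" "h holomorphic_on U" "\<gamma> \<in> set \<Gamma>"
  shows "(\<lambda>z. h z * \<phi> (resolvent a z)) contour_integrable_on \<gamma>"
proof (rule contour_integrable_holomorphic_simple[OF _ open_minus_spectrum])
  show "(\<lambda>z. h z * \<phi> (resolvent a z)) holomorphic_on U - spectrum a"
    using scaleC_resolvent_weakly_holomorphic[OF assms(3), of a] assms(1)
    by (simp add: weakly_holomorphic_on_def functional_scaleC)
qed (use surrounds_in_cycle[OF assms(2)] assms(4) in \<open>auto simp: cycle_in_def\<close>)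

lemma dunford_diff:
  assumes "surrounds_in \<Gamma> (spectrum a) U" "g holomorphic_on U" "h holomorphic_on U"
  shows "dunford \<Gamma> a (\<lambda>z. g z - h z) = dunford \<Gamma> a g - dunford \<Gamma> a h"
proof (rule functional_separates)
  fix \<phi> :: "'a \<Rightarrow> complex" assume \<phi>: "functional \<phi>"
  have "(\<lambda>z. g z - h z) holomorphic_on U" using assms by (intro holomorphic_intros)
  note gh = functional_dunford[OF \<phi> assms(1) this]
  have "(\<Sum>\<gamma>\<leftarrow>\<Gamma>. contour_integral \<gamma> (\<lambda>z. (g z - h z) * \<phi> (resolvent a z))) =
      (\<Sum>\<gamma>\<leftarrow>\<Gamma>. contour_integral \<gamma> (\<lambda>z. g z * \<phi> (resolvent a z)) - contour_integral \<gamma> (\<lambda>z. h z * \<phi> (resolvent a z)))"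
  proof (rule arg_cong[where f = sum_list], rule map_cong[OF refl])
    fix \<gamma> assume "\<gamma> \<in> set \<Gamma>"
    then show "contour_integral \<gamma> (\<lambda>z. (g z - h z) * \<phi> (resolvent a z)) =
        contour_integral \<gamma> (\<lambda>z. g z * \<phi> (resolvent a z)) - contour_integral \<gamma> (\<lambda>z. h z * \<phi> (resolvent a z))"
      using contour_integral_diff[OF integrable_functional_resolvent[OF \<phi> assms(1,2)]
          integrable_functional_resolvent[OF \<phi> assms(1,3)]] by (simp add: left_diff_distrib)
  qed
  then show "\<phi> (dunford \<Gamma> a (\<lambda>z. g z - h z)) = \<phi> (dunford \<Gamma> a g - dunford \<Gamma> a h)"
    unfolding gh functional_diff[OF \<phi>] functional_dunford[OF \<phi> assms(1,2)] functional_dunford[OF \<phi> assms(1,3)]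
    by (simp add: sum_list_subtractf right_diff_distrib diff_divide_distrib)
qed

lemma dunford_cmult:
  assumes "surrounds_in \<Gamma> (spectrum a) U" "h holomorphic_on U"
  shows "dunford \<Gamma> a (\<lambda>z. c * h z) = c *\<^sub>C dunford \<Gamma> a h"
proof (rule functional_separates)
  fix \<phi> :: "'a \<Rightarrow> complex" assume \<phi>: "functional \<phi>"
  have "(\<lambda>z. c * h z) holomorphic_on U" using assms by (intro holomorphic_intros)
  note gh = functional_dunford[OF \<phi> assms(1) this]
  have "(\<Sum>\<gamma>\<leftarrow>\<Gamma>. contour_integral \<gamma> (\<lambda>z. c * h z * \<phi> (resolvent a z))) =
      (\<Sum>\<gamma>\<leftarrow>\<Gamma>. c * contour_integral \<gamma> (\<lambda>z. h z * \<phi> (resolvent a z)))"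
  proof (rule arg_cong[where f = sum_list], rule map_cong[OF refl])
    fix \<gamma> assume "\<gamma> \<in> set \<Gamma>"
    then show "contour_integral \<gamma> (\<lambda>z. c * h z * \<phi> (resolvent a z)) =
        c * contour_integral \<gamma> (\<lambda>z. h z * \<phi> (resolvent a z))"
      using contour_integral_lmul[OF integrable_functional_resolvent[OF \<phi> assms]] by (simp add: mult.assoc)
  qed
  then show "\<phi> (dunford \<Gamma> a (\<lambda>z. c * h z)) = \<phi> (c *\<^sub>C dunford \<Gamma> a h)"
    unfolding gh functional_scaleC[OF \<phi>] functional_dunford[OF \<phi> assms]
    by (simp only: sum_list_const_mult mult.left_commute)
qed

text \<open>Since \<open>(a - p) R(z) = (z - p) R(z) - 1\<close>, the two sides differ by a multiple
  of the integral of \<open>h\<close>, which vanishes because \<open>h\<close> is holomorphic on all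
  of \<open>U\<close>, spectrum included. A polynomial factor thus needs no product of two
  integrals.\<close>

lemma dunford_linear_factor:
  assumes "surrounds_in \<Gamma> (spectrum a) U" "h holomorphic_on U"
  shows "dunford \<Gamma> a (\<lambda>z. (z - p) * h z) = (a - p *\<^sub>C 1) * dunford \<Gamma> a h"
proof (rule functional_separates)
  fix \<phi> :: "'a \<Rightarrow> complex" assume \<phi>: "functional \<phi>"
  define \<psi> where "\<psi> x = \<phi> ((a - p *\<^sub>C 1) * x)" for x
  have \<psi>: "functional \<psi>" unfolding \<psi>_def by (rule functional_mult_left[OF \<phi>])
  have h': "(\<lambda>z. (z - p) * h z) holomorphic_on U" using assms by (intro holomorphic_intros)
  have h1: "(\<lambda>z. h z * \<phi> 1) holomorphic_on U" using assms by (intro holomorphic_intros)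
  have "contour_integral \<gamma> (\<lambda>z. (z - p) * h z * \<phi> (resolvent a z)) =
      contour_integral \<gamma> (\<lambda>z. h z * \<psi> (resolvent a z)) + contour_integral \<gamma> (\<lambda>z. h z * \<phi> 1)"
    if \<gamma>: "\<gamma> \<in> set \<Gamma>" for \<gamma>
  proof -
    have im: "path_image \<gamma> \<subseteq> U - spectrum a" "valid_path \<gamma>"
      using surrounds_in_cycle[OF assms(1)] \<gamma> by (auto simp: cycle_in_def)
    have "(\<lambda>z. h z * \<phi> 1) contour_integrable_on \<gamma>"
      by (rule contour_integrable_holomorphic_simple[OF h1 U]) (use im in auto)
    then have "contour_integral \<gamma> (\<lambda>z. h z * \<psi> (resolvent a z)) + contour_integral \<gamma> (\<lambda>z. h z * \<phi> 1) =
        contour_integral \<gamma> (\<lambda>z. h z * \<psi> (resolvent a z) + h z * \<phi> 1)"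
      using contour_integral_add[OF integrable_functional_resolvent[OF \<psi> assms \<gamma>]] by simp
    also have "\<dots> = contour_integral \<gamma> (\<lambda>z. (z - p) * h z * \<phi> (resolvent a z))"
    proof (rule contour_integral_eq)
      fix z assume "z \<in> path_image \<gamma>"
      then have "z \<notin> spectrum a" using im by blast
      then have "(a - p *\<^sub>C 1) * resolvent a z = (z - p) *\<^sub>C resolvent a z - 1"
        using resolvent_scaleC(1)[of z a]
        by (simp add: left_diff_distrib scaleC.diff_left scaleC_mult_left)
      then have eq: "\<psi> (resolvent a z) = (z - p) * \<phi> (resolvent a z) - \<phi> 1"
        by (simp add: \<psi>_def functional_diff[OF \<phi>] functional_scaleC[OF \<phi>])
      show "h z * \<psi> (resolvent a z) + h z * \<phi> 1 = (z - p) * h z * \<phi> (resolvent a z)"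
        unfolding eq by (simp add: algebra_simps)
    qed
    finally show ?thesis by simp
  qed
  then have "(\<Sum>\<gamma>\<leftarrow>\<Gamma>. contour_integral \<gamma> (\<lambda>z. (z - p) * h z * \<phi> (resolvent a z))) =
      (\<Sum>\<gamma>\<leftarrow>\<Gamma>. contour_integral \<gamma> (\<lambda>z. h z * \<psi> (resolvent a z)) + contour_integral \<gamma> (\<lambda>z. h z * \<phi> 1))"
    by (intro arg_cong[where f = sum_list] map_cong) auto
  also have "\<dots> = (\<Sum>\<gamma>\<leftarrow>\<Gamma>. contour_integral \<gamma> (\<lambda>z. h z * \<psi> (resolvent a z)))"
    using Cauchy_theorem_surrounds[OF assms(1) U h1] by (simp only: sum_list_addf add_0_right)
  finally show "\<phi> (dunford \<Gamma> a (\<lambda>z. (z - p) * h z)) = \<phi> ((a - p *\<^sub>C 1) * dunford \<Gamma> a h)"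
    using functional_dunford[OF \<phi> assms(1) h'] functional_dunford[OF \<psi> assms]
    by (simp add: \<psi>_def)
qed

text \<open>Nested cycles: \<open>\<Delta>\<close> surrounds the hull of \<open>\<Gamma>\<close>, so
  every point of \<open>\<Gamma>\<close> has index 1 with respect to \<open>\<Delta>\<close>. The
  resolvent identity separates the product of resolvents, Cauchy's formula over
  \<open>\<Delta>\<close> evaluates \<open>k\<close>, and the remaining term is holomorphic around
  the hull of \<open>\<Gamma>\<close>, so it integrates to 0 along \<open>\<Gamma>\<close> without
  an exchange of integrals.\<close>

lemma dunford_mult:
  assumes surr: "surrounds_in \<Gamma> (spectrum a) U" and g: "g holomorphic_on U" and k: "k holomorphic_on U"
  shows "dunford \<Gamma> a k * dunford \<Gamma> a g = dunford \<Gamma> a (\<lambda>z. k z * g z)"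
proof -
  let ?c = "1 / (2 * of_real pi * \<i>) :: complex" and ?K = "spectrum a" and ?N = "chain_hull \<Gamma>"
  have cyc: "cycle_in U \<Gamma>" by (rule surrounds_in_cycle'[OF surr])
  have "?N \<subseteq> U" using cyc surr by (auto simp: chain_hull_def cycle_in_iff surrounds_in_def)
  from grid_cycle_exists[OF compact_chain_hull[OF cyc] U this] obtain \<Delta> where
    \<Delta>: "surrounds_in \<Delta> ?N U" and lin: "\<And>\<delta>. \<delta> \<in> set \<Delta> \<Longrightarrow> \<exists>u v. \<delta> = linepath u v"
    and grid0: "\<And>H. H holomorphic_on U \<Longrightarrow> (\<Sum>\<delta>\<leftarrow>\<Delta>. contour_integral \<delta> H) = 0"
    by blast
  have "?K \<subseteq> ?N" using surr by (auto simp: chain_hull_def surrounds_in_def)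
  with \<Delta> have \<Delta>K: "surrounds_in \<Delta> ?K U" by (rule surrounds_in_inner)
  have cyc\<Delta>: "cycle_in (U - ?N) \<Delta>" by (rule surrounds_in_cycle[OF \<Delta>])
  have same: "dunford \<Gamma> a k = dunford \<Delta> a k"
    by (rule dunford_cycle_unique[OF surr \<Delta>K U order_refl k])
  have "\<phi> (dunford \<Delta> a k * dunford \<Gamma> a g) = \<phi> (dunford \<Gamma> a (\<lambda>z. k z * g z))" if \<phi>: "functional \<phi>" for \<phi>
  proof -
    define \<rho> where "\<rho> z = \<phi> (resolvent a z)" for z
    \<comment> \<open>The Cauchy transform of \<open>k w * \<rho> w\<close> along
      \<open>\<Delta>\<close>, which is the error term in \<open>step\<close>.\<close>
    define \<psi> where "\<psi> z = ?c * (\<Sum>\<delta>\<leftarrow>\<Delta>. contour_integral \<delta> (\<lambda>w. k w * \<rho> w / (w - z)))" for z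
    have \<rho>: "\<rho> holomorphic_on - ?K" unfolding \<rho>_def by (rule functional_resolvent_holomorphic[OF \<phi>])
    have k\<rho>: "(\<lambda>w. k w * \<rho> w) holomorphic_on U - ?K"
      by (intro holomorphic_intros holomorphic_on_subset[OF k] holomorphic_on_subset[OF \<rho>]) auto
    have seg: "path_image \<delta> \<subseteq> U - ?N" "valid_path \<delta>" if "\<delta> \<in> set \<Delta>" for \<delta>
      using cyc\<Delta> that by (auto simp: cycle_in_def)
    have \<psi>: "\<psi> holomorphic_on - chain_trace \<Delta>"
      unfolding \<psi>_def
    proof (intro holomorphic_intros)
      have "(\<lambda>z. contour_integral \<delta> (\<lambda>w. k w * \<rho> w / (w - z))) holomorphic_on - chain_trace \<Delta>" if \<delta>: "\<delta> \<in> set \<Delta>" for \<delta>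
      proof -
        obtain u v where uv: "\<delta> = linepath u v" using lin[OF \<delta>] by blast
        have "closed_segment u v \<subseteq> U - ?K" using seg(1)[OF \<delta>] \<open>?K \<subseteq> ?N\<close> by (auto simp: uv)
        then have "continuous_on (closed_segment u v) (\<lambda>w. k w * \<rho> w)"
          by (rule continuous_on_subset[OF holomorphic_on_imp_continuous_on[OF k\<rho>]])
        moreover have "closed_segment u v \<subseteq> chain_trace \<Delta>"
          unfolding chain_trace_def using UN_upper[OF \<delta>, of path_image] by (simp add: uv)
        ultimately show ?thesis
          unfolding uv by (intro holomorphic_on_subset[OF linepath_Cauchy_integral_holomorphic]) auto
      qed
      then show "(\<lambda>z. \<Sum>\<delta>\<leftarrow>\<Delta>. contour_integral \<delta> (\<lambda>w. k w * \<rho> w / (w - z))) holomorphic_on - chain_trace \<Delta>"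
        by (rule holomorphic_on_sum_list)
    qed
    have step: "\<phi> (dunford \<Delta> a k * resolvent a z) = k z * \<rho> z - \<psi> z" if z: "z \<in> chain_trace \<Gamma>" for z
    proof -
      have zN: "z \<in> ?N" using z by (simp add: chain_hull_def)
      have zK: "z \<notin> ?K" using z surrounds_in_cycle[OF surr] by (auto simp: cycle_in_iff)
      have zU: "z \<in> U" using zN \<open>?N \<subseteq> U\<close> by blast
      have z\<Delta>: "z \<notin> chain_trace \<Delta>" using cyc\<Delta> zN by (auto simp: cycle_in_iff)
      have \<eta>: "functional (\<lambda>x. \<phi> (x * resolvent a z))" by (rule functional_mult_right[OF \<phi>])
      have "contour_integral \<delta> (\<lambda>w. k w * \<phi> (resolvent a w * resolvent a z)) =
          \<rho> z * contour_integral \<delta> (\<lambda>w. k w / (w - z)) - contour_integral \<delta> (\<lambda>w. k w * \<rho> w / (w - z))"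
        if \<delta>: "\<delta> \<in> set \<Delta>" for \<delta>
      proof -
        have z\<delta>: "z \<notin> path_image \<delta>" using z\<Delta> \<delta> by (auto simp: chain_trace_def)
        have V: "open (U - ?K - {z})" using open_minus_spectrum by (rule open_delete)
        have im: "path_image \<delta> \<subseteq> U - ?K - {z}" using seg(1)[OF \<delta>] z\<delta> \<open>?K \<subseteq> ?N\<close> by blast
        have i1: "(\<lambda>w. k w / (w - z)) contour_integrable_on \<delta>"
          by (rule contour_integrable_holomorphic_simple[OF _ V seg(2)[OF \<delta>] im])
             (auto intro!: holomorphic_intros holomorphic_on_subset[OF k])
        have i2: "(\<lambda>w. k w * \<rho> w / (w - z)) contour_integrable_on \<delta>"
          by (rule contour_integrable_holomorphic_simple[OF _ V seg(2)[OF \<delta>] im])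
             (auto intro!: holomorphic_intros holomorphic_on_subset[OF k] holomorphic_on_subset[OF \<rho>])
        have "contour_integral \<delta> (\<lambda>w. k w * \<phi> (resolvent a w * resolvent a z)) =
            contour_integral \<delta> (\<lambda>w. \<rho> z * (k w / (w - z)) - k w * \<rho> w / (w - z))"
        proof (rule contour_integral_eq)
          fix w assume "w \<in> path_image \<delta>"
          then have w: "w \<notin> ?K" "w \<noteq> z" using im by auto
          have "\<rho> w - \<rho> z = (z - w) * \<phi> (resolvent a w * resolvent a z)"
            using resolvent_identity[OF w(1) zK]
            by (simp add: \<rho>_def functional_diff[OF \<phi>, symmetric] functional_scaleC[OF \<phi>])
          then have eq: "\<phi> (resolvent a w * resolvent a z) = (\<rho> z - \<rho> w) / (w - z)"
            using w(2) by (simp add: nonzero_eq_divide_eq algebra_simps)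
          show "k w * \<phi> (resolvent a w * resolvent a z) = \<rho> z * (k w / (w - z)) - k w * \<rho> w / (w - z)"
            unfolding eq by (simp add: diff_divide_distrib algebra_simps)
        qed
        also have "\<dots> = \<rho> z * contour_integral \<delta> (\<lambda>w. k w / (w - z)) - contour_integral \<delta> (\<lambda>w. k w * \<rho> w / (w - z))"
          by (simp only: contour_integral_lmul[OF i1] contour_integral_diff[OF contour_integrable_lmul[OF i1] i2])
        finally show ?thesis .
      qed
      then have "(\<Sum>\<delta>\<leftarrow>\<Delta>. contour_integral \<delta> (\<lambda>w. k w * \<phi> (resolvent a w * resolvent a z))) =
          (\<Sum>\<delta>\<leftarrow>\<Delta>. \<rho> z * contour_integral \<delta> (\<lambda>w. k w / (w - z)) - contour_integral \<delta> (\<lambda>w. k w * \<rho> w / (w - z)))"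
        by (intro arg_cong[where f = sum_list] map_cong) auto
      also have "\<dots> = \<rho> z * (\<Sum>\<delta>\<leftarrow>\<Delta>. contour_integral \<delta> (\<lambda>w. k w / (w - z))) -
          (\<Sum>\<delta>\<leftarrow>\<Delta>. contour_integral \<delta> (\<lambda>w. k w * \<rho> w / (w - z)))"
        by (simp only: sum_list_subtractf sum_list_const_mult)
      also have "(\<Sum>\<delta>\<leftarrow>\<Delta>. contour_integral \<delta> (\<lambda>w. k w / (w - z))) = 2 * of_real pi * \<i> * k z"
        using Cauchy_formula_if_integrals_vanish[OF U k surrounds_in_cycle'[OF \<Delta>] grid0 zU z\<Delta>]
          \<Delta> zN by (simp add: surrounds_in_def)
      finally have eq: "(\<Sum>\<delta>\<leftarrow>\<Delta>. contour_integral \<delta> (\<lambda>w. k w * \<phi> (resolvent a w * resolvent a z))) =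
          \<rho> z * (2 * of_real pi * \<i> * k z) - (\<Sum>\<delta>\<leftarrow>\<Delta>. contour_integral \<delta> (\<lambda>w. k w * \<rho> w / (w - z)))" .
      have cancel: "1 / C * (r * (C * s)) = s * r" if "C \<noteq> 0" for C r s :: complex using that by simp
      have "?c * (\<rho> z * (2 * of_real pi * \<i> * k z)) = k z * \<rho> z" by (rule cancel) simp
      then show ?thesis
        unfolding functional_dunford[OF \<eta> \<Delta>K k] eq \<psi>_def right_diff_distrib by (simp only:)
    qed
    define \<eta> where "\<eta> x = \<phi> (dunford \<Delta> a k * x)" for x
    have \<eta>: "functional \<eta>" unfolding \<eta>_def by (rule functional_mult_left[OF \<phi>])
    have V: "open (U - chain_trace \<Delta>)"
      using U compact_imp_closed[OF compact_chain_trace[OF cyc\<Delta>]] by blast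
    have g\<psi>: "(\<lambda>z. g z * \<psi> z) holomorphic_on U - chain_trace \<Delta>"
      by (intro holomorphic_intros holomorphic_on_subset[OF g] holomorphic_on_subset[OF \<psi>]) auto
    have NV: "?N \<subseteq> U - chain_trace \<Delta>" using \<open>?N \<subseteq> U\<close> cyc\<Delta> by (auto simp: cycle_in_iff)
    have kg: "(\<lambda>z. k z * g z) holomorphic_on U" by (intro holomorphic_intros g k)
    have cycV: "cycle_in (U - chain_trace \<Delta>) \<Gamma>"
      by (rule cycle_in_superset[OF cyc]) (use NV in \<open>auto simp: chain_hull_def\<close>)
    \<comment> \<open>The hull of \<open>\<Gamma>\<close> lies in the domain of holomorphy, so the
      index of \<open>\<Gamma>\<close> is 0 off that domain.\<close>
    have vanish: "(\<Sum>\<gamma>\<leftarrow>\<Gamma>. contour_integral \<gamma> (\<lambda>z. g z * \<psi> z)) = 0"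
      by (rule Cauchy_theorem_cycle[OF V g\<psi> cycV]) (use NV in \<open>auto simp: chain_hull_def\<close>)
    have "(\<Sum>\<gamma>\<leftarrow>\<Gamma>. contour_integral \<gamma> (\<lambda>z. g z * \<eta> (resolvent a z))) =
        (\<Sum>\<gamma>\<leftarrow>\<Gamma>. contour_integral \<gamma> (\<lambda>z. k z * g z * \<rho> z) - contour_integral \<gamma> (\<lambda>z. g z * \<psi> z))"
    proof (rule arg_cong[where f = sum_list], rule map_cong[OF refl])
      fix \<gamma> assume \<gamma>: "\<gamma> \<in> set \<Gamma>"
      have i1: "(\<lambda>z. k z * g z * \<rho> z) contour_integrable_on \<gamma>"
        unfolding \<rho>_def by (rule integrable_functional_resolvent[OF \<phi> surr kg \<gamma>])
      have i2: "(\<lambda>z. g z * \<psi> z) contour_integrable_on \<gamma>"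
        by (rule contour_integrable_holomorphic_simple[OF g\<psi> V]) (use cycV \<gamma> in \<open>auto simp: cycle_in_def\<close>)
      have "contour_integral \<gamma> (\<lambda>z. g z * \<eta> (resolvent a z)) =
          contour_integral \<gamma> (\<lambda>z. k z * g z * \<rho> z - g z * \<psi> z)"
      proof (rule contour_integral_eq)
        fix z assume "z \<in> path_image \<gamma>"
        then have "z \<in> chain_trace \<Gamma>" using \<gamma> by (auto simp: chain_trace_def)
        note eq = step[OF this]
        show "g z * \<eta> (resolvent a z) = k z * g z * \<rho> z - g z * \<psi> z"
          unfolding \<eta>_def eq by (simp add: algebra_simps)
      qed
      then show "contour_integral \<gamma> (\<lambda>z. g z * \<eta> (resolvent a z)) =
          contour_integral \<gamma> (\<lambda>z. k z * g z * \<rho> z) - contour_integral \<gamma> (\<lambda>z. g z * \<psi> z)"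
        by (simp only: contour_integral_diff[OF i1 i2])
    qed
    also have "\<dots> = (\<Sum>\<gamma>\<leftarrow>\<Gamma>. contour_integral \<gamma> (\<lambda>z. k z * g z * \<rho> z))"
      by (simp only: sum_list_subtractf vanish diff_zero)
    finally show ?thesis
      using functional_dunford[OF \<eta> surr g] functional_dunford[OF \<phi> surr kg] by (simp add: \<eta>_def \<rho>_def)
  qed
  then show ?thesis unfolding same by (rule functional_separates)
qed

text \<open>The constant 1 is entire, so the cycle may be replaced by a circle of any radius
  \<open>r\<close> beyond \<open>norm a\<close>. There \<open>R(z) = 1 / z + a R(z) / z\<close>: the
  first part yields 1 and the second is of order \<open>1 / r\<close>. Letting \<open>r\<close> grow
  takes the place of a Laurent expansion.\<close>

lemma dunford_one:
  assumes surr: "surrounds_in \<Gamma> (spectrum a) U"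
  shows "dunford \<Gamma> a (\<lambda>z. 1) = 1"
proof (rule functional_separates)
  fix \<phi> :: "'a \<Rightarrow> complex" assume \<phi>: "functional \<phi>"
  obtain B where B: "B > 0" "\<And>x. norm (\<phi> x) \<le> norm x * B"
    using bounded_linear.pos_bounded[OF functional_bounded_linear[OF \<phi>]] by blast
  let ?c = "1 / (2 * of_real pi * \<i>) :: complex"
  define A where "A = norm a"
  have "A \<ge> 0" by (simp add: A_def)
  have bound: "norm (\<phi> (dunford \<Gamma> a (\<lambda>z. 1)) - \<phi> 1) \<le> A * B / (r - A)" if r: "r > A" for r
  proof -
    have r0: "r > 0" using r \<open>A \<ge> 0\<close> by simp
    let ?C = "circlepath 0 r"
    have off: "z \<notin> spectrum a" if "norm z = r" for z
      using norm_in_spectrum[of z a] that r by (auto simp: A_def)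
    have in_disc: "norm z < r" if "z \<in> spectrum a" for z
      using norm_in_spectrum[OF that] r by (simp add: A_def)
    have C: "surrounds_in [?C] (spectrum a) UNIV"
      unfolding surrounds_in_def cycle_in_def chain_index_def
      using r0 off in_disc by (auto simp: winding_number_circlepath)
    \<comment> \<open>In the whole plane the condition off \<open>U\<close> becomes empty, and index
      1 on the spectrum is what is kept.\<close>
    have surr': "surrounds_in \<Gamma> (spectrum a) UNIV"
      unfolding surrounds_in_def
      using surr cycle_in_superset[OF surrounds_in_cycle[OF surr], of "UNIV - spectrum a"] surrounds_in_cycle[OF surr]
      by (auto simp: surrounds_in_def cycle_in_iff)
    have integ: "(\<lambda>z. \<phi> (a * resolvent a z) / z) contour_integrable_on ?C"
    proof (rule contour_integrable_holomorphic_simple)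
      show "open (- spectrum a - {0})" using open_resolvent_set by (rule open_delete)
      show "(\<lambda>z. \<phi> (a * resolvent a z) / z) holomorphic_on - spectrum a - {0}"
        by (intro holomorphic_intros holomorphic_on_subset[OF
              functional_resolvent_holomorphic[OF functional_mult_left[OF \<phi>]]]) auto
      show "path_image ?C \<subseteq> - spectrum a - {0}" using off r0 by auto
    qed simp
    have "chain_integral \<Gamma> (\<lambda>z. 1 *\<^sub>C resolvent a z) = chain_integral [?C] (\<lambda>z. 1 *\<^sub>C resolvent a z)"
      by (rule chain_integral_surrounds_unique[OF compact_imp_closed[OF compact_spectrum] open_UNIV open_UNIV order_refl surr' C])
         (intro scaleC_resolvent_weakly_holomorphic holomorphic_intros)
    then have "\<phi> (dunford \<Gamma> a (\<lambda>z. 1)) = ?c * \<phi> (chain_integral [?C] (\<lambda>z. 1 *\<^sub>C resolvent a z))"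
      by (simp add: dunford_def functional_scaleC[OF \<phi>])
    also have "\<phi> (chain_integral [?C] (\<lambda>z. 1 *\<^sub>C resolvent a z)) =
        (\<Sum>\<gamma>\<leftarrow>[?C]. contour_integral \<gamma> (\<lambda>z. \<phi> (1 *\<^sub>C resolvent a z)))"
    proof (rule functional_chain_integral[OF \<phi> _ _ surrounds_in_cycle[OF C]])
      show "open (UNIV - spectrum a)" using open_resolvent_set[of a] by (simp add: Compl_eq_Diff_UNIV)
      show "(\<lambda>z. 1 *\<^sub>C resolvent a z) weakly_holomorphic_on UNIV - spectrum a"
        by (intro scaleC_resolvent_weakly_holomorphic holomorphic_intros)
    qed
    also have "\<dots> = contour_integral ?C (\<lambda>z. \<phi> (resolvent a z))" by simp
    also have "\<dots> = contour_integral ?C (\<lambda>z. \<phi> 1 * (1 / (z - 0)) + \<phi> (a * resolvent a z) / z)"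
    proof (rule contour_integral_eq)
      fix z assume "z \<in> path_image ?C"
      then have z: "norm z = r" using r0 by (auto simp: dist_norm)
      then have "z \<noteq> 0" using r0 by auto
      have "z * \<phi> (resolvent a z) = \<phi> (z *\<^sub>C resolvent a z)" by (simp add: functional_scaleC[OF \<phi>])
      also have "\<dots> = \<phi> 1 + \<phi> (a * resolvent a z)"
        using resolvent_scaleC(1)[OF off[OF z]] by (simp add: functional_add[OF \<phi>])
      finally show "\<phi> (resolvent a z) = \<phi> 1 * (1 / (z - 0)) + \<phi> (a * resolvent a z) / z"
        using \<open>z \<noteq> 0\<close> by (simp add: field_simps)
    qed
    also have "\<dots> = \<phi> 1 * (2 * of_real pi * \<i>) + contour_integral ?C (\<lambda>z. \<phi> (a * resolvent a z) / z)"
    proof -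
      have "0 \<notin> path_image ?C" using r0 by simp
      then have i: "(\<lambda>z. 1 / (z - 0)) contour_integrable_on ?C"
        by (intro contour_integrable_inversediff) auto
      show ?thesis
        by (simp only: contour_integral_add[OF contour_integrable_lmul[OF i] integ] contour_integral_lmul[OF i]
            contour_integral_circlepath[OF r0])
    qed
    finally have "\<phi> (dunford \<Gamma> a (\<lambda>z. 1)) - \<phi> 1 = ?c * contour_integral ?C (\<lambda>z. \<phi> (a * resolvent a z) / z)"
      by (simp add: field_simps)
    then have "norm (\<phi> (dunford \<Gamma> a (\<lambda>z. 1)) - \<phi> 1) =
        norm (contour_integral ?C (\<lambda>z. \<phi> (a * resolvent a z) / z)) / (2 * pi)"
      by (simp add: norm_mult norm_divide)
    moreover have "norm (contour_integral ?C (\<lambda>z. \<phi> (a * resolvent a z) / z)) \<le> A * B / (r - A) / r * (2 * pi * r)"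
    proof (rule has_contour_integral_bound_circlepath[OF has_contour_integral_integral[OF integ]])
      fix z :: complex assume "norm (z - 0) = r"
      then have z: "norm z = r" by simp
      \<comment> \<open>Taking norms in \<open>z R(z) = 1 + a R(z)\<close> bounds
        \<open>(r - A) * norm (resolvent a z)\<close> by 1.\<close>
      have "r * norm (resolvent a z) = norm (z *\<^sub>C resolvent a z)" by (simp add: norm_scaleC z)
      also have "\<dots> \<le> 1 + norm (a * resolvent a z)"
        unfolding resolvent_scaleC(1)[OF off[OF z]] using norm_triangle_ineq[of 1 "a * resolvent a z"] by simp
      also have "\<dots> \<le> 1 + A * norm (resolvent a z)" by (simp add: A_def norm_mult_ineq)
      finally have "norm (resolvent a z) \<le> 1 / (r - A)" using r by (simp add: field_simps)
      then have "A * norm (resolvent a z) * B \<le> A * (1 / (r - A)) * B"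
        using \<open>A \<ge> 0\<close> B(1) by (intro mult_right_mono mult_left_mono) auto
      moreover have "norm (\<phi> (a * resolvent a z)) \<le> A * norm (resolvent a z) * B"
      proof -
        have "norm (a * resolvent a z) * B \<le> norm a * norm (resolvent a z) * B"
          using norm_mult_ineq B(1) by (intro mult_right_mono) auto
        then show ?thesis using B(2)[of "a * resolvent a z"] unfolding A_def by (rule order_trans[rotated])
      qed
      ultimately have "norm (\<phi> (a * resolvent a z)) \<le> A * B / (r - A)" by simp
      then show "norm (\<phi> (a * resolvent a z) / z) \<le> A * B / (r - A) / r"
        unfolding norm_divide z by (rule divide_right_mono) (use r0 in simp)
    qed (use r r0 B(1) \<open>A \<ge> 0\<close> in auto)
    moreover have "A * B / (r - A) / r * (2 * pi * r) = A * B / (r - A) * (2 * pi)" using r0 by simp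
    ultimately show ?thesis by (simp only: pos_divide_le_eq[OF pi_gt_zero[THEN mult_pos_pos[OF zero_less_numeral]]])
  qed
  show "\<phi> (dunford \<Gamma> a (\<lambda>z. 1)) = \<phi> 1"
  proof (rule ccontr)
    assume "\<not> ?thesis"
    then have pos: "norm (\<phi> (dunford \<Gamma> a (\<lambda>z. 1)) - \<phi> 1) > 0" (is "?n > 0") by simp
    \<comment> \<open>With this radius the bound would give
      \<open>A * B + ?n \<le> A * B\<close>.\<close>
    define r where "r = A + A * B / ?n + 1"
    have "A * B / ?n \<ge> 0" using \<open>A \<ge> 0\<close> B(1) by simp
    then have rA: "r > A" by (simp add: r_def)
    have "?n * (r - A) \<le> A * B" using bound[OF rA] rA by (simp add: pos_le_divide_eq)
    moreover have "n * (A + A * B / n + 1 - A) = A * B + n" if "n > 0" for n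
      using that by (simp add: distrib_left)
    from this[OF pos] have "?n * (r - A) = A * B + ?n" unfolding r_def .
    ultimately show False using pos by simp
  qed
qed

end

section \<open>Drazin invertibility in rings\<close>

context ring
begin

lemma pow_commute:
  assumes "x \<in> carrier R" "y \<in> carrier R" "x \<otimes> y = y \<otimes> x"
  shows "x [^] (n::nat) \<otimes> y = y \<otimes> x [^] n"
proof (induction n)
  case (Suc n)
  have "x [^] Suc n \<otimes> y = x [^] n \<otimes> (y \<otimes> x)" using assms by (simp add: m_assoc)
  also have "\<dots> = y \<otimes> x [^] Suc n" using assms Suc by (simp add: m_assoc[symmetric])
  finally show ?case .
qed (use assms in simp)

lemma commute_mult:
  assumes "x \<in> carrier R" "y \<in> carrier R" "z \<in> carrier R" "x \<otimes> z = z \<otimes> x" "y \<otimes> z = z \<otimes> y"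
  shows "(x \<otimes> y) \<otimes> z = z \<otimes> (x \<otimes> y)"
  by (metis assms m_assoc)

text \<open>The power \<open>f = (x c)^k\<close> is an idempotent below which \<open>c\<close>
  inverts \<open>x\<close>, so \<open>y = f c\<close> is a Drazin inverse. It therefore suffices to
  find a commuting \<open>c\<close> with the absorption property; the relation
  \<open>y x y = y\<close> comes for free.\<close>

lemma Drazin_invertible_if_pow_absorbs:
  assumes x: "x \<in> carrier R" and c: "c \<in> carrier R" and xc: "x \<otimes> c = c \<otimes> x"
    and absorb: "x [^] (k::nat) \<otimes> (x \<otimes> c) = x [^] k"
  shows "Drazin_invertible R x"
proof -
  define e where "e = x \<otimes> c"
  define f where "f = e [^] k"
  have car: "e \<in> carrier R" "f \<in> carrier R" "x [^] k \<in> carrier R" "c [^] k \<in> carrier R"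
    using x c by (simp_all add: e_def f_def)
  \<comment> \<open>With \<open>x^k\<close> on the right, \<open>f\<close> absorbs every power of
    \<open>e\<close>, in particular itself.\<close>
  have f: "f = c [^] k \<otimes> x [^] k"
    unfolding f_def e_def xc using pow_mult_distrib[OF xc[symmetric] c x] .
  have xe: "x [^] k \<otimes> e [^] j = x [^] k" for j :: nat
  proof (induction j)
    case (Suc j)
    then show ?case using absorb car by (simp add: m_assoc[symmetric] e_def[symmetric])
  qed (use car in simp)
  have fe: "f \<otimes> e [^] j = f" for j :: nat
    unfolding f using xe[of j] car by (simp add: m_assoc)
  have fe1: "f \<otimes> e = f" using fe[of 1] car by simp
  have ff: "f \<otimes> f = f" using fe[of k] unfolding f_def[symmetric] .
  have ex: "e \<otimes> x = x \<otimes> e" unfolding e_def by (rule commute_mult[OF x c x refl xc[symmetric]])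
  have xf: "x \<otimes> f = f \<otimes> x" unfolding f_def using pow_commute[OF car(1) x ex] by simp
  define y where "y = f \<otimes> c"
  have y: "y \<in> carrier R" using car c by (simp add: y_def)
  have xy: "x \<otimes> y = f"
  proof -
    have "x \<otimes> y = f \<otimes> (x \<otimes> c)" unfolding y_def using x c car xf by (simp add: m_assoc[symmetric])
    then show ?thesis using fe1 by (simp add: e_def)
  qed
  have yx: "y \<otimes> x = f"
  proof -
    have "y \<otimes> x = f \<otimes> (x \<otimes> c)" unfolding y_def xc using x c car by (simp add: m_assoc)
    then show ?thesis using fe1 by (simp add: e_def)
  qed
  have "y \<otimes> x \<otimes> y = y" unfolding yx unfolding y_def using car c ff by (simp add: m_assoc[symmetric])
  moreover have "x [^] k \<otimes> y \<otimes> x = x [^] k" using car x y yx xe[of k] by (simp add: m_assoc f_def)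
  moreover have "x \<otimes> y = y \<otimes> x" by (simp only: xy yx)
  ultimately show ?thesis
    unfolding Drazin_invertible_def using x y by (intro conjI bexI[of _ y] exI[of _ k])
qed

text \<open>Two additions to the definition: absorption at all large exponents, so that two elements
  can share one, and the double commutant property, which is derived from the idempotent
  \<open>e = x y\<close>.\<close>

lemma Drazin_invertible_obtain:
  assumes "Drazin_invertible R x"
  obtains c and k :: nat where "c \<in> carrier R" "x \<otimes> c = c \<otimes> x"
    "\<forall>l\<ge>k. x [^] l \<otimes> (x \<otimes> c) = x [^] l"
    "\<forall>b\<in>carrier R. b \<otimes> x = x \<otimes> b \<longrightarrow> b \<otimes> c = c \<otimes> b"
proof -
  obtain y and k :: nat where x: "x \<in> carrier R" and y: "y \<in> carrier R" and yxy: "y \<otimes> x \<otimes> y = y"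
    and xy: "x \<otimes> y = y \<otimes> x" and k: "x [^] k \<otimes> y \<otimes> x = x [^] k"
    using assms unfolding Drazin_invertible_def by blast
  define e where "e = x \<otimes> y"
  have e: "e \<in> carrier R" using x y by (simp add: e_def)
  have xke: "x [^] k \<otimes> e = x [^] k" unfolding e_def xy using k x y by (simp add: m_assoc)
  have absorb: "x [^] l \<otimes> e = x [^] l" if "l \<ge> k" for l
  proof -
    have "x [^] l = x [^] (l - k) \<otimes> x [^] k" using that x by (simp add: nat_pow_mult)
    then show ?thesis using xke x e by (simp add: m_assoc)
  qed
  have ee: "e \<otimes> e = e"
  proof -
    have "e \<otimes> e = x \<otimes> (y \<otimes> x \<otimes> y)" unfolding e_def using x y by (simp add: m_assoc)
    then show ?thesis by (simp add: yxy e_def)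
  qed
  have ye: "y \<otimes> e = y" unfolding e_def using yxy x y by (simp add: m_assoc)
  have ey: "e \<otimes> y = y" unfolding e_def xy using yxy by simp
  have epow: "e [^] Suc n = e" for n
    by (induction n) (use e ee in auto)
  \<comment> \<open>The exponent is positive so that this power of the idempotent \<open>e\<close>
    is \<open>e\<close> itself, and at least \<open>k\<close> so that absorption applies.\<close>
  let ?K = "Suc k"
  have eK: "e = x [^] ?K \<otimes> y [^] ?K"
    using epow[of k] pow_mult_distrib[OF xy x y, of ?K] by (simp add: e_def)
  have eK': "e = y [^] ?K \<otimes> x [^] ?K"
    using epow[of k] pow_mult_distrib[OF xy[symmetric] y x, of ?K] by (simp only: e_def xy)
  have xK: "x [^] ?K \<in> carrier R" "y [^] ?K \<in> carrier R" using x y by simp_all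
  have xKe: "x [^] ?K \<otimes> e = x [^] ?K" by (rule absorb) simp
  have ex: "e \<otimes> x = x \<otimes> e" unfolding e_def by (rule commute_mult[OF x y x refl xy[symmetric]])
  have exK: "e \<otimes> x [^] ?K = x [^] ?K" using pow_commute[OF x e ex[symmetric], of ?K] xKe by simp
  have "b \<otimes> y = y \<otimes> b" if b: "b \<in> carrier R" "b \<otimes> x = x \<otimes> b" for b
  proof -
    have bK: "b \<otimes> x [^] ?K = x [^] ?K \<otimes> b" using pow_commute[OF x b(1), of ?K] b(2) by simp
    \<comment> \<open>Writing \<open>e\<close> as \<open>x^K y^K\<close> shows that \<open>e\<close>
      fixes \<open>b e\<close> from the left; writing it as \<open>y^K x^K\<close> shows that it
      fixes \<open>e b\<close> from the right. Hence both equal \<open>e b e\<close>.\<close>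
    have "b \<otimes> e = e \<otimes> (b \<otimes> e)"
    proof -
      have "b \<otimes> e = x [^] ?K \<otimes> (b \<otimes> y [^] ?K)"
        unfolding eK using bK xK b(1) by (simp only: m_assoc[symmetric])
      also have "\<dots> = e \<otimes> (x [^] ?K \<otimes> (b \<otimes> y [^] ?K))"
        using exK xK b(1) e by (simp only: m_assoc[symmetric] m_closed)
      also have "x [^] ?K \<otimes> (b \<otimes> y [^] ?K) = b \<otimes> e"
        unfolding eK using bK xK b(1) by (simp only: m_assoc[symmetric])
      finally show ?thesis .
    qed
    moreover have "e \<otimes> b = e \<otimes> (b \<otimes> e)"
    proof -
      have "e \<otimes> b = y [^] ?K \<otimes> (b \<otimes> x [^] ?K)"
        unfolding eK' bK using xK b(1) by (simp only: m_assoc)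
      also have "\<dots> = y [^] ?K \<otimes> (b \<otimes> (x [^] ?K \<otimes> e))" by (simp only: xKe)
      also have "\<dots> = y [^] ?K \<otimes> (b \<otimes> x [^] ?K) \<otimes> e"
        using xK b(1) e by (simp only: m_assoc m_closed)
      also have "y [^] ?K \<otimes> (b \<otimes> x [^] ?K) = e \<otimes> b"
        unfolding eK' bK using xK b(1) by (simp only: m_assoc)
      finally show ?thesis using e b(1) by (simp only: m_assoc)
    qed
    ultimately have be: "b \<otimes> e = e \<otimes> b" by simp
    have "y \<otimes> b = y \<otimes> (e \<otimes> b)" using ye y e b(1) by (simp only: m_assoc[symmetric])
    also have "\<dots> = y \<otimes> (b \<otimes> x \<otimes> y)" unfolding be[symmetric] unfolding e_def using x y b(1) by (simp only: m_assoc)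
    also have "\<dots> = y \<otimes> x \<otimes> b \<otimes> y" unfolding b(2) using x y b(1) by (simp only: m_assoc m_closed)
    also have "\<dots> = e \<otimes> b \<otimes> y" by (simp only: e_def xy)
    also have "\<dots> = b \<otimes> (e \<otimes> y)" unfolding be[symmetric] using e y b(1) by (simp only: m_assoc)
    also have "\<dots> = b \<otimes> y" by (simp only: ey)
    finally show ?thesis by simp
  qed
  then show thesis
    using that[of y k] y xy absorb unfolding e_def by blast
qed

text \<open>By the double commutant property \<open>c\<close> commutes with \<open>y\<close> and
  \<open>d\<close> with \<open>x\<close>, so \<open>c d\<close> serves for \<open>x y\<close> at the
  larger of the two exponents.\<close>

lemma Drazin_invertible_mult:
  assumes "Drazin_invertible R x" "Drazin_invertible R y" and xy: "x \<otimes> y = y \<otimes> x"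
  shows "Drazin_invertible R (x \<otimes> y)"
proof -
  have x: "x \<in> carrier R" and y: "y \<in> carrier R" using assms by (auto simp: Drazin_invertible_def)
  obtain c k where c: "c \<in> carrier R" "x \<otimes> c = c \<otimes> x"
    "\<forall>l\<ge>k. x [^] (l::nat) \<otimes> (x \<otimes> c) = x [^] l"
    "\<forall>b\<in>carrier R. b \<otimes> x = x \<otimes> b \<longrightarrow> b \<otimes> c = c \<otimes> b"
    using assms(1) by (rule Drazin_invertible_obtain)
  obtain d m where d: "d \<in> carrier R" "y \<otimes> d = d \<otimes> y"
    "\<forall>l\<ge>m. y [^] (l::nat) \<otimes> (y \<otimes> d) = y [^] l"
    "\<forall>b\<in>carrier R. b \<otimes> y = y \<otimes> b \<longrightarrow> b \<otimes> d = d \<otimes> b"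
    using assms(2) by (rule Drazin_invertible_obtain)
  have yc: "y \<otimes> c = c \<otimes> y" using c(4)[rule_format, OF y] xy by simp
  have xd: "x \<otimes> d = d \<otimes> x" using d(4)[rule_format, OF x] xy by simp
  define l where "l = max k m"
  have pow: "(x \<otimes> y) [^] l = x [^] l \<otimes> y [^] l" by (rule pow_mult_distrib[OF xy x y])
  have yxc: "y [^] l \<otimes> (x \<otimes> c) = (x \<otimes> c) \<otimes> y [^] l"
    using commute_mult[OF x c(1) y xy yc[symmetric]] x y c(1) by (intro pow_commute) auto
  have "(x \<otimes> y) \<otimes> (c \<otimes> d) = (x \<otimes> c) \<otimes> (y \<otimes> d)"
    using x y c(1) d(1) yc by (metis m_assoc m_closed)
  then have "(x \<otimes> y) [^] l \<otimes> ((x \<otimes> y) \<otimes> (c \<otimes> d)) = x [^] l \<otimes> (y [^] l \<otimes> (x \<otimes> c)) \<otimes> (y \<otimes> d)"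
    using x y c(1) d(1) unfolding pow by (simp add: m_assoc)
  also have "\<dots> = (x [^] l \<otimes> (x \<otimes> c)) \<otimes> (y [^] l \<otimes> (y \<otimes> d))"
    unfolding yxc using x y c(1) d(1) by (simp add: m_assoc)
  also have "\<dots> = (x \<otimes> y) [^] l"
    unfolding pow using c(3)[rule_format, of l] d(3)[rule_format, of l] by (simp add: l_def)
  finally have absorb: "(x \<otimes> y) [^] l \<otimes> ((x \<otimes> y) \<otimes> (c \<otimes> d)) = (x \<otimes> y) [^] l" .
  have "(x \<otimes> y) \<otimes> c = c \<otimes> (x \<otimes> y)" "(x \<otimes> y) \<otimes> d = d \<otimes> (x \<otimes> y)"
    using commute_mult[OF x y c(1) c(2) yc] commute_mult[OF x y d(1) xd d(2)] by simp_all
  then have "(x \<otimes> y) \<otimes> (c \<otimes> d) = (c \<otimes> d) \<otimes> (x \<otimes> y)"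
    using commute_mult[OF c(1) d(1) m_closed[OF x y]] by simp
  then show ?thesis
    using Drazin_invertible_if_pow_absorbs[OF _ _ _ absorb] x y c(1) d(1) by simp
qed

lemma Drazin_invertible_Units:
  assumes "x \<in> Units R" shows "Drazin_invertible R x"
  using assms by (intro Drazin_invertible_if_pow_absorbs[of x "inv x" 0]) auto

text \<open>Divisibility of \<open>z\<close> by \<open>d\<close> after multiplication by a power of
  \<open>d\<close>, with a quotient commuting with \<open>d\<close>. For \<open>z = \<one>\<close>
  it is the hypothesis of \<open>Drazin_invertible_if_pow_absorbs\<close>, so striking factors from
  \<open>z\<close> until \<open>\<one>\<close> remains proves that \<open>d\<close> is Drazin
  invertible.\<close>

definition next_power_divides :: "'a \<Rightarrow> 'a \<Rightarrow> bool" where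
  "next_power_divides d z \<longleftrightarrow>
     (\<exists>m::nat. \<exists>c\<in>carrier R. d \<otimes> c = c \<otimes> d \<and> d [^] m \<otimes> z = d [^] m \<otimes> (d \<otimes> c))"

text \<open>The elements that may be struck from the divisibility relation. Commutation of
  \<open>z\<close> with \<open>d\<close> is all that is asked of the other factor, so that products
  of such elements can be removed one after the other.\<close>

definition cancellable :: "'a \<Rightarrow> 'a \<Rightarrow> bool" where
  "cancellable d b \<longleftrightarrow> b \<in> carrier R \<and> b \<otimes> d = d \<otimes> b \<and>
     (\<forall>z\<in>carrier R. z \<otimes> d = d \<otimes> z \<longrightarrow> next_power_divides d (b \<otimes> z) \<longrightarrow> next_power_divides d z)"

lemma cancellable_mult:
  assumes d: "d \<in> carrier R" and "cancellable d b" "cancellable d b'"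
  shows "cancellable d (b \<otimes> b')"
proof -
  have b: "b \<in> carrier R" "b' \<in> carrier R" "b \<otimes> d = d \<otimes> b" "b' \<otimes> d = d \<otimes> b'"
    using assms by (auto simp: cancellable_def)
  have "next_power_divides d z"
    if z: "z \<in> carrier R" "z \<otimes> d = d \<otimes> z" and "next_power_divides d (b \<otimes> b' \<otimes> z)" for z
  proof -
    have "next_power_divides d (b \<otimes> (b' \<otimes> z))" using that b by (simp add: m_assoc)
    moreover have "(b' \<otimes> z) \<otimes> d = d \<otimes> (b' \<otimes> z)" by (rule commute_mult[OF b(2) z(1) d b(4) z(2)])
    ultimately have "next_power_divides d (b' \<otimes> z)"
      using assms(2) b z by (simp add: cancellable_def)
    then show ?thesis using assms(3) z by (simp add: cancellable_def)
  qed
  then show ?thesis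
    unfolding cancellable_def using b commute_mult[OF b(1,2) d b(3,4)] by simp
qed

text \<open>With \<open>p = d^m\<close>, the relation \<open>p (d + s) z = p d c\<close> gives
  \<open>p s z = p d (c - z)\<close>, and multiplying by \<open>t\<close> yields the new quotient
  \<open>t (c - z)\<close>.\<close>

lemma cancellable_shift:
  assumes d: "d \<in> carrier R" and s: "s \<in> carrier R" "t \<in> carrier R" "t \<otimes> s = \<one>"
    and comm: "s \<otimes> d = d \<otimes> s" "t \<otimes> d = d \<otimes> t"
  shows "cancellable d (d \<oplus> s)"
proof -
  have "next_power_divides d z"
    if z: "z \<in> carrier R" "z \<otimes> d = d \<otimes> z" and div: "next_power_divides d ((d \<oplus> s) \<otimes> z)" for z
  proof -
    obtain m :: nat and c where c: "c \<in> carrier R" "d \<otimes> c = c \<otimes> d"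
      and eq: "d [^] m \<otimes> ((d \<oplus> s) \<otimes> z) = d [^] m \<otimes> (d \<otimes> c)"
      using div by (auto simp: next_power_divides_def)
    let ?p = "d [^] m"
    have p: "?p \<in> carrier R" using d by simp
    have sp: "s \<otimes> ?p = ?p \<otimes> s" "t \<otimes> ?p = ?p \<otimes> t"
      using pow_commute[OF d s(1) comm(1)[symmetric], of m] pow_commute[OF d s(2) comm(2)[symmetric], of m] by simp_all
    have "?p \<otimes> (d \<otimes> z) \<oplus> ?p \<otimes> (s \<otimes> z) = ?p \<otimes> (d \<otimes> c)"
      using eq d s z p by (simp add: l_distr r_distr)
    then have "?p \<otimes> (s \<otimes> z) = ?p \<otimes> (d \<otimes> c) \<ominus> ?p \<otimes> (d \<otimes> z)"
      using d s z p c by (metis add.inv_solve_right' add.m_comm m_closed minus_eq)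
    also have "\<dots> = ?p \<otimes> (d \<otimes> (c \<ominus> z))"
      using d z p c by (simp add: minus_eq r_distr r_minus)
    finally have "t \<otimes> (?p \<otimes> (s \<otimes> z)) = t \<otimes> (?p \<otimes> (d \<otimes> (c \<ominus> z)))" by simp
    moreover have "t \<otimes> (?p \<otimes> (s \<otimes> z)) = ?p \<otimes> z"
    proof -
      have "t \<otimes> (?p \<otimes> (s \<otimes> z)) = (t \<otimes> ?p) \<otimes> (s \<otimes> z)" using p s z by (simp add: m_assoc)
      also have "\<dots> = ?p \<otimes> ((t \<otimes> s) \<otimes> z)" unfolding sp using p s(1,2) z(1) by (simp only: m_assoc m_closed)
      finally show ?thesis by (simp only: s(3) l_one z(1))
    qed
    moreover have "t \<otimes> (?p \<otimes> (d \<otimes> (c \<ominus> z))) = ?p \<otimes> (d \<otimes> (t \<otimes> (c \<ominus> z)))"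
    proof -
      have "t \<otimes> (?p \<otimes> (d \<otimes> (c \<ominus> z))) = (t \<otimes> ?p) \<otimes> (d \<otimes> (c \<ominus> z))" using p s z c d by (simp add: m_assoc)
      also have "\<dots> = ?p \<otimes> ((t \<otimes> d) \<otimes> (c \<ominus> z))" unfolding sp using p s z c d by (simp add: m_assoc)
      finally show ?thesis unfolding comm using p s z c d by (simp add: m_assoc)
    qed
    ultimately have "?p \<otimes> z = ?p \<otimes> (d \<otimes> (t \<otimes> (c \<ominus> z)))" by simp
    moreover have "d \<otimes> (t \<otimes> (c \<ominus> z)) = (t \<otimes> (c \<ominus> z)) \<otimes> d"
    proof -
      have "(c \<ominus> z) \<otimes> d = d \<otimes> (c \<ominus> z)"
        using c z d by (simp add: minus_eq l_distr r_distr l_minus r_minus)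
      then show ?thesis using commute_mult[OF s(2) _ d comm(2)] c z by simp
    qed
    ultimately show ?thesis
      unfolding next_power_divides_def using c z s by (intro exI[of _ m] bexI[of _ "t \<otimes> (c \<ominus> z)"]) auto
  qed
  moreover have "(d \<oplus> s) \<otimes> d = d \<otimes> (d \<oplus> s)" using d s comm by (simp add: l_distr r_distr)
  ultimately show ?thesis unfolding cancellable_def using d s by simp
qed

text \<open>Multiplying by \<open>h\<close> removes \<open>g\<close> and turns the quotient
  \<open>c\<close> into \<open>h c\<close>.\<close>

lemma cancellable_unit:
  assumes d: "d \<in> carrier R" and g: "g \<in> carrier R" "h \<in> carrier R" "h \<otimes> g = \<one>"
    and comm: "g \<otimes> d = d \<otimes> g" "h \<otimes> d = d \<otimes> h"
  shows "cancellable d g"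
proof -
  have "next_power_divides d z"
    if z: "z \<in> carrier R" "z \<otimes> d = d \<otimes> z" and div: "next_power_divides d (g \<otimes> z)" for z
  proof -
    obtain m :: nat and c where c: "c \<in> carrier R" "d \<otimes> c = c \<otimes> d"
      and eq: "d [^] m \<otimes> (g \<otimes> z) = d [^] m \<otimes> (d \<otimes> c)"
      using div by (auto simp: next_power_divides_def)
    let ?p = "d [^] m"
    have p: "?p \<in> carrier R" using d by simp
    have hp: "h \<otimes> ?p = ?p \<otimes> h" using pow_commute[OF d g(2) comm(2)[symmetric], of m] by simp
    have "?p \<otimes> z = ?p \<otimes> (h \<otimes> g \<otimes> z)" by (simp only: g(3) l_one z(1))
    also have "\<dots> = (?p \<otimes> h) \<otimes> (g \<otimes> z)" using g(1,2) z(1) p by (simp add: m_assoc)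
    also have "\<dots> = h \<otimes> (?p \<otimes> (g \<otimes> z))" unfolding hp[symmetric] using g(1,2) z(1) p by (simp add: m_assoc)
    also have "\<dots> = (h \<otimes> ?p) \<otimes> (d \<otimes> c)" unfolding eq using g(1,2) c d p by (simp add: m_assoc)
    also have "\<dots> = ?p \<otimes> ((h \<otimes> d) \<otimes> c)" unfolding hp using g(1,2) c d p by (simp add: m_assoc)
    also have "\<dots> = ?p \<otimes> (d \<otimes> (h \<otimes> c))" unfolding comm using g(1,2) c d p by (simp add: m_assoc)
    finally have "?p \<otimes> z = ?p \<otimes> (d \<otimes> (h \<otimes> c))" .
    moreover have "d \<otimes> (h \<otimes> c) = (h \<otimes> c) \<otimes> d"
      using commute_mult[OF g(2) c(1) d comm(2)] c(2) by simp
    ultimately show ?thesis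
      unfolding next_power_divides_def using c g by (intro exI[of _ m] bexI[of _ "h \<otimes> c"]) auto
  qed
  then show ?thesis unfolding cancellable_def using g comm by simp
qed

lemma cancellable_one: "d \<in> carrier R \<Longrightarrow> cancellable d \<one>"
  by (rule cancellable_unit[of _ _ \<one>]) auto

lemma cancellable_pow: "d \<in> carrier R \<Longrightarrow> cancellable d b \<Longrightarrow> cancellable d (b [^] (n::nat))"
  by (induction n) (auto intro: cancellable_mult cancellable_one)

text \<open>Absorption for the product \<open>w\<close> at exponent \<open>k\<close> reads
  \<open>d^m b^k = d^m d r\<close> with \<open>r\<close> commuting with \<open>d\<close>: the next
  power of \<open>d\<close> divides \<open>b^k\<close>. Cancelling \<open>b^k\<close> leaves this
  relation for \<open>\<one>\<close>. At least one factor \<open>d\<close> must be present, whence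
  \<open>Suc n\<close>.\<close>

lemma Drazin_invertible_factor:
  assumes d: "d \<in> carrier R" and b: "cancellable d b" and w: "Drazin_invertible R (d [^] Suc n \<otimes> b)"
  shows "Drazin_invertible R d"
proof -
  let ?w = "d [^] Suc n \<otimes> b"
  have bc: "b \<in> carrier R" "b \<otimes> d = d \<otimes> b" using b by (auto simp: cancellable_def)
  obtain c k where c: "c \<in> carrier R" "?w \<otimes> c = c \<otimes> ?w"
    "\<forall>l\<ge>k. ?w [^] (l::nat) \<otimes> (?w \<otimes> c) = ?w [^] l"
    "\<forall>x\<in>carrier R. x \<otimes> ?w = ?w \<otimes> x \<longrightarrow> x \<otimes> c = c \<otimes> x"
    using w by (rule Drazin_invertible_obtain)
  have dn: "d [^] i \<otimes> d = d \<otimes> d [^] i" for i :: nat by (rule pow_commute[OF d d refl])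
  have db: "d [^] i \<otimes> b = b \<otimes> d [^] i" for i :: nat by (rule pow_commute[OF d bc(1) bc(2)[symmetric]])
  have "d \<otimes> ?w = ?w \<otimes> d"
    using commute_mult[OF nat_pow_closed[OF d] bc(1) d dn bc(2), of "Suc n"] by (rule sym)
  \<comment> \<open>The double commutant property is what lets the inverse of the whole product
    commute with one of its factors.\<close>
  then have dc: "d \<otimes> c = c \<otimes> d" by (rule c(4)[rule_format, OF d])
  \<comment> \<open>\<open>m\<close> counts the factors \<open>d\<close> in \<open>w^k\<close>, and
    \<open>r\<close> is what remains of \<open>w^k w c\<close> once these and one further
    \<open>d\<close> are split off.\<close>
  define m where "m = Suc n * k"
  define r where "r = d [^] n \<otimes> (b \<otimes> (b [^] k \<otimes> c))"
  have bk: "b [^] k \<in> carrier R" "d [^] n \<in> carrier R" "d [^] m \<in> carrier R" "d [^] Suc n \<in> carrier R"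
    using bc d by simp_all
  have bkd: "b [^] k \<otimes> d = d \<otimes> b [^] k" by (rule pow_commute[OF bc(1) d bc(2)])
  have bkdi: "b [^] k \<otimes> d [^] i = d [^] i \<otimes> b [^] k" for i :: nat
    using pow_commute[OF d bk(1) bkd[symmetric], of i] by simp
  have wk: "?w [^] k = d [^] m \<otimes> b [^] k"
    using pow_mult_distrib[OF db bk(4) bc(1), of k] nat_pow_pow[OF d, of "Suc n" k]
    by (simp only: m_def)
  have "d [^] m \<otimes> b [^] k = (d [^] m \<otimes> b [^] k) \<otimes> ((d [^] Suc n \<otimes> b) \<otimes> c)"
    using c(3)[rule_format, of k] unfolding wk by simp
  also have "\<dots> = d [^] m \<otimes> ((b [^] k \<otimes> d [^] Suc n) \<otimes> (b \<otimes> c))"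
    using bk bc c(1) by (simp only: m_assoc m_closed)
  also have "\<dots> = d [^] m \<otimes> (d [^] Suc n \<otimes> ((b [^] k \<otimes> b) \<otimes> c))"
    unfolding bkdi using bk bc c(1) by (simp only: m_assoc m_closed)
  also have "b [^] k \<otimes> b = b \<otimes> b [^] k" by (rule pow_commute[OF bc(1) bc(1) refl])
  also have "d [^] Suc n = d \<otimes> d [^] n" using dn[of n] by simp
  also have "d [^] m \<otimes> (d \<otimes> d [^] n \<otimes> (b \<otimes> b [^] k \<otimes> c)) = d [^] m \<otimes> (d \<otimes> r)"
    unfolding r_def using bk bc c(1) d by (simp only: m_assoc m_closed)
  finally have eq: "d [^] m \<otimes> b [^] k = d [^] m \<otimes> (d \<otimes> r)" .
  have r: "r \<in> carrier R" using bk bc c(1) by (simp add: r_def)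
  have bkc: "(b [^] k \<otimes> c) \<otimes> d = d \<otimes> (b [^] k \<otimes> c)"
    by (rule commute_mult[OF bk(1) c(1) d bkd dc[symmetric]])
  have bbkc: "(b \<otimes> (b [^] k \<otimes> c)) \<otimes> d = d \<otimes> (b \<otimes> (b [^] k \<otimes> c))"
    by (rule commute_mult[OF bc(1) m_closed[OF bk(1) c(1)] d bc(2) bkc])
  have "r \<otimes> d = d \<otimes> r"
    unfolding r_def
    by (rule commute_mult[OF bk(2) m_closed[OF bc(1) m_closed[OF bk(1) c(1)]] d dn bbkc])
  then have "next_power_divides d (b [^] k \<otimes> \<one>)"
    unfolding next_power_divides_def using r eq bk by (intro exI[of _ m] bexI[of _ r]) auto
  then have "next_power_divides d \<one>"
    using cancellable_pow[OF d b, of k] d unfolding cancellable_def by simp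
  then obtain j :: nat and q where q: "q \<in> carrier R" "d \<otimes> q = q \<otimes> d" "d [^] j \<otimes> \<one> = d [^] j \<otimes> (d \<otimes> q)"
    by (auto simp: next_power_divides_def)
  then have "d [^] j \<otimes> (d \<otimes> q) = d [^] j" using d by simp
  then show ?thesis by (rule Drazin_invertible_if_pow_absorbs[OF d q(1,2)])
qed

end

section \<open>The B-Fredholm spectrum\<close>

lemma ring_of_type_algebra_simps:
  "carrier ring_of_type_algebra = UNIV" "x \<otimes>\<^bsub>ring_of_type_algebra\<^esub> y = x * y"
  "x \<oplus>\<^bsub>ring_of_type_algebra\<^esub> y = x + y" "\<one>\<^bsub>ring_of_type_algebra\<^esub> = 1"
  for x y :: "'a::ring_1"
  by (simp_all add: ring_of_type_algebra_def)

lemma prod_list_commute: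
  "(\<And>y. y \<in> set ys \<Longrightarrow> x * y = y * x) \<Longrightarrow> x * prod_list ys = prod_list ys * x" for x :: "'a::monoid_mult"
proof (induction ys)
  case (Cons y ys)
  have "x * prod_list (y # ys) = (x * y) * prod_list ys" by (simp add: mult.assoc)
  also have "\<dots> = y * (x * prod_list ys)" using Cons.prems[of y] by (simp add: mult.assoc)
  also have "\<dots> = prod_list (y # ys) * x" using Cons by (simp add: mult.assoc)
  finally show ?case .
qed simp

text \<open>Repeated roots have to be gathered: the factor under study cannot in general be
  cancelled against itself, whereas the filtered rest contains only different roots.\<close>

lemma prod_list_collect:
  fixes f :: "'b \<Rightarrow> 'a::monoid_mult"
  assumes "\<And>x y. f x * f y = f y * f x"
  shows "prod_list (map f xs) = f x ^ count_list xs x * prod_list (map f (filter (\<lambda>y. y \<noteq> x) xs))"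
proof (induction xs)
  case (Cons y ys)
  have "f y * f x ^ n = f x ^ n * f y" for n
    by (rule power_commuting_commutes[symmetric]) (rule assms)
  then have "f y * (f x ^ n * r) = f x ^ n * (f y * r)" for n r by (simp add: mult.assoc[symmetric])
  then show ?case using Cons by (auto simp: mult.assoc)
qed simp

section \<open>B-Fredholm elements under products\<close>

context
  fixes J :: "'a::complex_banach_algebra_1 set"
  assumes J: "ideal J ring_of_type_algebra"
begin

interpretation Q: ring "ring_of_type_algebra Quot J"
  by (rule ideal.quotient_is_ring[OF J])

abbreviation (input) proj :: "'a \<Rightarrow> 'a set" where
  "proj x \<equiv> J +>\<^bsub>ring_of_type_algebra\<^esub> x"

lemma proj_hom:
  "proj x \<in> carrier (ring_of_type_algebra Quot J)"
  "proj (x * y) = proj x \<otimes>\<^bsub>ring_of_type_algebra Quot J\<^esub> proj y"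
  "proj (x + y) = proj x \<oplus>\<^bsub>ring_of_type_algebra Quot J\<^esub> proj y"
  "proj 1 = \<one>\<^bsub>ring_of_type_algebra Quot J\<^esub>"
  using ring_hom_memE[OF ideal.rcos_ring_hom[OF J]] by (simp_all add: ring_of_type_algebra_simps)

lemma proj_power: "proj (x ^ n) = proj x [^]\<^bsub>ring_of_type_algebra Quot J\<^esub> n"
  by (induction n) (simp_all add: proj_hom power_Suc2 del: power_Suc)

lemma proj_commute:
  "x * y = y * x \<Longrightarrow> proj x \<otimes>\<^bsub>ring_of_type_algebra Quot J\<^esub> proj y = proj y \<otimes>\<^bsub>ring_of_type_algebra Quot J\<^esub> proj x"
  by (simp only: proj_hom(2)[symmetric])

lemma B_Fredholm_unit:
  assumes "u * v = 1" "v * u = 1"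
  shows "B_Fredholm J u"
proof -
  have "proj u \<in> Units (ring_of_type_algebra Quot J)"
    unfolding Units_def using assms proj_hom by (auto simp: proj_hom(2)[symmetric] intro!: bexI[of _ "proj v"])
  then show ?thesis unfolding B_Fredholm_def by (rule Q.Drazin_invertible_Units)
qed

lemma B_Fredholm_mult:
  "B_Fredholm J x \<Longrightarrow> B_Fredholm J y \<Longrightarrow> x * y = y * x \<Longrightarrow> B_Fredholm J (x * y)"
  unfolding B_Fredholm_def proj_hom by (intro Q.Drazin_invertible_mult proj_commute)

lemma B_Fredholm_prod_list:
  "(\<And>x. x \<in> set xs \<Longrightarrow> B_Fredholm J x) \<Longrightarrow> (\<And>x y. x \<in> set xs \<Longrightarrow> y \<in> set xs \<Longrightarrow> x * y = y * x) \<Longrightarrow>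
   B_Fredholm J (prod_list xs)"
proof (induction xs)
  case Nil
  show ?case by (rule B_Fredholm_unit[of _ 1]) auto
next
  case (Cons x xs)
  have "x * prod_list xs = prod_list xs * x" by (rule prod_list_commute) (use Cons.prems in auto)
  then have "B_Fredholm J (x * prod_list xs)" using Cons by (intro B_Fredholm_mult) auto
  then show ?case by simp
qed

lemma cancellable_prod_list:
  assumes "\<And>b. b \<in> set bs \<Longrightarrow> Q.cancellable (proj d) (proj b)"
  shows "Q.cancellable (proj d) (proj (prod_list bs))"
  using assms by (induction bs) (auto simp: proj_hom intro: Q.cancellable_one Q.cancellable_mult)

text \<open>Commutation and invertibility are established in \<open>A\<close> and merely projected
  to the quotient. The list may be empty, in which case both sides hold because \<open>G\<close> is
  a unit.\<close>

lemma B_Fredholm_prod_linear_iff: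
  assumes G: "G * G' = 1" "G' * G = 1" "G * a = a * G"
  shows "B_Fredholm J (prod_list (map (\<lambda>p. a - p *\<^sub>C 1) ps) * G) \<longleftrightarrow> (\<forall>p\<in>set ps. B_Fredholm J (a - p *\<^sub>C 1))"
    (is "B_Fredholm J (?P * G) \<longleftrightarrow> _")
proof
  have G'a: "G' * a = a * G'"
  proof -
    have "G' * a = G' * (a * G) * G'" using G(1) by (simp add: mult.assoc)
    also have "\<dots> = a * G'" using G(2) by (simp add: G(3)[symmetric] mult.assoc[symmetric])
    finally show ?thesis .
  qed
  have lin: "x * (a - p *\<^sub>C 1) = (a - p *\<^sub>C 1) * x" if "x * a = a * x" for x p
    using that by (simp add: left_diff_distrib right_diff_distrib scaleC_mult_left scaleC_mult_right)
  have comm: "(a - p *\<^sub>C 1) * (a - q *\<^sub>C 1) = (a - q *\<^sub>C 1) * (a - p *\<^sub>C 1)" for p q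
    by (rule lin) (rule lin[OF refl, symmetric])
  {
    assume *: "\<forall>p\<in>set ps. B_Fredholm J (a - p *\<^sub>C 1)"
    have "B_Fredholm J ?P" by (rule B_Fredholm_prod_list) (use * comm in auto)
    moreover have "G * ?P = ?P * G" by (rule prod_list_commute) (use lin[OF G(3)] in auto)
    ultimately show "B_Fredholm J (?P * G)" using B_Fredholm_unit[OF G(1,2)] by (intro B_Fredholm_mult) auto
  }
  assume *: "B_Fredholm J (?P * G)"
  show "\<forall>p\<in>set ps. B_Fredholm J (a - p *\<^sub>C 1)"
  proof
    fix p assume p: "p \<in> set ps"
    let ?d = "a - p *\<^sub>C 1"
    let ?B = "prod_list (map (\<lambda>p. a - p *\<^sub>C 1) (filter (\<lambda>q. q \<noteq> p) ps)) * G"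
    \<comment> \<open>Since \<open>p\<close> occurs in \<open>ps\<close>, its multiplicity has the
      form required by \<open>Drazin_invertible_factor\<close>.\<close>
    obtain n where n: "count_list ps p = Suc n"
      using p by (metis count_list_0_iff not0_implies_Suc)
    have eq: "?P * G = ?d ^ Suc n * ?B"
      using prod_list_collect[of "\<lambda>p. a - p *\<^sub>C 1" ps p] comm unfolding n by (simp only: mult.assoc)
    have cG: "Q.cancellable (proj ?d) (proj G)"
      by (rule Q.cancellable_unit[where h = "proj G'"])
         (use proj_commute[OF lin[OF G(3)]] proj_commute[OF lin[OF G'a]] G(2)
          in \<open>simp_all add: proj_hom(1,4) proj_hom(2)[symmetric]\<close>)
    have cq: "Q.cancellable (proj ?d) (proj (a - q *\<^sub>C 1))" if "q \<noteq> p" for q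
    proof -
      \<comment> \<open>Shifting \<open>a - p\<close> by \<open>p - q\<close> gives
        \<open>a - q\<close>, and the shift is invertible because
        \<open>q \<noteq> p\<close>.\<close>
      let ?s = "(p - q) *\<^sub>C (1::'a)" and ?t = "(1 / (p - q)) *\<^sub>C (1::'a)"
      have "?d + ?s = a - q *\<^sub>C 1" by (simp add: scaleC.diff_left)
      moreover have "?t * ?s = 1" using that by (simp add: scaleC_mult_left scaleC_mult_right scaleC_scaleC)
      moreover have "?s * ?d = ?d * ?s" "?t * ?d = ?d * ?t"
        by (simp_all add: scaleC_mult_left scaleC_mult_right)
      ultimately show ?thesis
        using Q.cancellable_shift[of "proj ?d" "proj ?s" "proj ?t"] proj_hom proj_commute[of ?s ?d] proj_commute[of ?t ?d]
        by (metis (no_types, lifting))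
    qed
    have "Q.cancellable (proj ?d) (proj (prod_list (map (\<lambda>p. a - p *\<^sub>C 1) (filter (\<lambda>q. q \<noteq> p) ps))))"
      by (rule cancellable_prod_list) (use cq in auto)
    then have "Q.cancellable (proj ?d) (proj ?B)"
      using cG proj_hom(1) unfolding proj_hom(2) by (intro Q.cancellable_mult)
    moreover have "Drazin_invertible (ring_of_type_algebra Quot J) (proj ?d [^]\<^bsub>ring_of_type_algebra Quot J\<^esub> Suc n \<otimes>\<^bsub>ring_of_type_algebra Quot J\<^esub> proj ?B)"
      using * unfolding B_Fredholm_def eq proj_hom(2)[of "?d ^ Suc n"] proj_power .
    ultimately show "B_Fredholm J ?d"
      unfolding B_Fredholm_def by (intro Q.Drazin_invertible_factor[of "proj ?d" "proj ?B" n] proj_hom(1))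
  qed
qed

end

text \<open>Induction on the zero set, removing one zero with its full multiplicity each time;
  multiplicities are stored as repetitions in \<open>ps\<close>. The last hypothesis excludes local
  vanishing in a form that passes to the quotient \<open>H\<close>, because
  \<open>F w \<noteq> 0\<close> implies \<open>H w \<noteq> 0\<close>.\<close>

lemma holomorphic_factor_out_zeros:
  assumes "open U" "K \<subseteq> U" "finite Z" "F holomorphic_on U" "{z \<in> K. F z = 0} = Z"
    and "\<And>z r. z \<in> Z \<Longrightarrow> r > 0 \<Longrightarrow> \<exists>w\<in>ball z r. w \<in> U \<and> F w \<noteq> 0"
  shows "\<exists>ps G. set ps = Z \<and> G holomorphic_on U \<and> (\<forall>z\<in>K. G z \<noteq> 0) \<and>
    (\<forall>z\<in>U. F z = prod_list (map (\<lambda>p. z - p) ps) * G z)"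
  using assms(3-6)
proof (induction Z arbitrary: F rule: finite_induct)
  case empty
  then show ?case by (intro exI[of _ "[]"] exI[of _ F]) auto
next
  case (insert p Z)
  have p: "p \<in> K" "F p = 0" "p \<in> U" using insert.prems(2) assms(2) by blast+
  obtain r where r: "r > 0" "ball p r \<subseteq> U" using assms(1) p(3) open_contains_ball by blast
  have F: "F holomorphic_on ball p r" using insert.prems(1) r(2) by (rule holomorphic_on_subset)
  have "\<not> F constant_on ball p r"
  proof
    assume "F constant_on ball p r"
    then have "\<forall>w\<in>ball p r. F w = F p" using r(1) by (auto simp: constant_on_def)
    then show False using insert.prems(3)[of p r] r(1) p(2) by auto
  qed
  then obtain g s n where n: "0 < n" and s: "0 < s" "ball p s \<subseteq> ball p r" and g: "g holomorphic_on ball p s"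
    and eq: "\<And>w. w \<in> ball p s \<Longrightarrow> F w = (w - p) ^ n * g w" and g0: "\<And>w. w \<in> ball p s \<Longrightarrow> g w \<noteq> 0"
    using holomorphic_factor_zero_nonconstant[OF F open_ball connected_ball, of p] r(1) p(2)
    by (metis centre_in_ball)
  \<comment> \<open>The singularity at \<open>p\<close> is filled in with the value of the local
    factor \<open>g\<close>; holomorphy is checked on two open pieces covering
    \<open>U\<close>.\<close>
  define H where "H w = (if w = p then g p else F w / (w - p) ^ n)" for w
  have Hg: "H w = g w" if "w \<in> ball p s" for w using eq[OF that] by (simp add: H_def)
  have "H holomorphic_on ball p s \<union> (U - {p})"
  proof (rule holomorphic_on_Un)
    show "H holomorphic_on ball p s" using g by (rule holomorphic_transform) (simp add: Hg)
    have "(\<lambda>w. F w / (w - p) ^ n) holomorphic_on U - {p}"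
      by (intro holomorphic_intros holomorphic_on_subset[OF insert.prems(1)]) auto
    then show "H holomorphic_on U - {p}" by (rule holomorphic_transform) (simp add: H_def)
  qed (use assms(1) in auto)
  then have H: "H holomorphic_on U" by (rule holomorphic_on_subset) (use s in auto)
  have FH: "F z = (z - p) ^ n * H z" if "z \<in> U" for z
    using n p(2) by (simp add: H_def)
  have Hp: "H p \<noteq> 0" using g0[of p] s(1) by (simp add: H_def)
  have zeros: "{z \<in> K. H z = 0} = Z"
  proof -
    have "{z \<in> K. H z = 0} = {z \<in> K. F z = 0} - {p}"
      using FH assms(2) Hp n by auto
    then show ?thesis using insert.prems(2) insert.hyps(2) by auto
  qed
  have "\<exists>w\<in>ball z t. w \<in> U \<and> H w \<noteq> 0" if "z \<in> Z" "t > 0" for z t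
    using insert.prems(3)[of z t] that FH by fastforce
  from insert.IH[OF H zeros this] obtain ps G where ih: "set ps = Z" "G holomorphic_on U" "\<forall>z\<in>K. G z \<noteq> 0"
    "\<forall>z\<in>U. H z = prod_list (map (\<lambda>p. z - p) ps) * G z"
    by blast
  have "prod_list (map (\<lambda>q. z - q) (replicate n p @ ps)) = (z - p) ^ n * prod_list (map (\<lambda>q. z - q) ps)" for z
    by (simp add: prod_list_replicate)
  then have "\<forall>z\<in>U. F z = prod_list (map (\<lambda>q. z - q) (replicate n p @ ps)) * G z"
    using FH ih(4) by (simp add: mult.assoc)
  moreover have "set (replicate n p @ ps) = insert p Z" using ih(1) n by simp
  ultimately show ?case using ih(2,3) by blast
qed

text \<open>An accumulation point in \<open>K\<close> would, by the identity theorem, make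
  \<open>f\<close> constant on the component of \<open>U\<close> through it. That component contains
  the component of \<open>K\<close> through the same point, contrary to hypothesis. On components of
  \<open>U\<close> that miss \<open>K\<close>, \<open>f\<close> may well be constant.\<close>

lemma finite_level_set:
  assumes K: "compact K" and U: "open U" "K \<subseteq> U" and f: "f holomorphic_on U"
    and nonconst: "\<And>C. C \<in> components K \<Longrightarrow> \<not> f constant_on C"
  shows "finite {z \<in> K. f z = c}" and "\<And>z r. z \<in> K \<Longrightarrow> r > 0 \<Longrightarrow> \<exists>w\<in>ball z r. w \<in> U \<and> f w \<noteq> c"
proof -
  have no_limit: "\<not> z islimpt {w \<in> U. f w = c}" if z: "z \<in> K" for z
  proof
    assume lim: "z islimpt {w \<in> U. f w = c}"
    let ?W = "connected_component_set U z"
    have W: "open ?W" "connected ?W" "z \<in> ?W" "?W \<subseteq> U"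
      using U z by (auto simp: open_connected_component connected_component_subset)
    have lim': "z islimpt {w \<in> ?W. f w = c}"
    proof -
      have "z islimpt {w \<in> U. f w = c} \<inter> ?W"
        using lim W(1,3) by (rule islimpt_Int_eventually[OF _ eventually_at_in_open'])
      then show ?thesis by (rule islimpt_subset) auto
    qed
    have const: "f w - c = 0" if "w \<in> ?W" for w
      by (rule analytic_continuation[of "\<lambda>w. f w - c" ?W "{w \<in> ?W. f w = c}" z])
         (use W lim' that f in \<open>auto intro!: holomorphic_intros intro: holomorphic_on_subset\<close>)
    let ?C = "connected_component_set K z"
    have "?C \<subseteq> ?W" using U(2) by (rule connected_component_mono)
    then have "f constant_on ?C" unfolding constant_on_def using const by (intro exI[of _ c]) auto
    moreover have "?C \<in> components K" using z by (simp add: componentsI)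
    ultimately show False using nonconst by blast
  qed
  show "finite {z \<in> K. f z = c}"
  proof (rule ccontr)
    assume "infinite {z \<in> K. f z = c}"
    then obtain z where "z \<in> K" "z islimpt {z \<in> K. f z = c}"
      using K unfolding compact_eq_Bolzano_Weierstrass by (metis (no_types, lifting) mem_Collect_eq subsetI)
    then show False using no_limit[of z] U(2) islimpt_subset[of z "{z \<in> K. f z = c}" "{w \<in> U. f w = c}"] by blast
  qed
  show "\<exists>w\<in>ball z r. w \<in> U \<and> f w \<noteq> c" if z: "z \<in> K" and r: "r > 0" for z r
  proof (rule ccontr)
    assume "\<not> ?thesis"
    then have eq: "ball z r \<inter> U \<subseteq> {w \<in> U. f w = c}" by blast
    have "open (ball z r \<inter> U)" "z \<in> ball z r \<inter> U" using U z r by auto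
    then have "z \<in> interior (ball z r \<inter> U)" by (simp only: interior_open)
    then have "z islimpt (ball z r \<inter> U)" by (rule interior_limit_point)
    then show False using no_limit[OF z] islimpt_subset[OF _ eq] by blast
  qed
qed

section \<open>Factorization of \<open>f(a) - c\<close>\<close>

lemma dunford_prod_linear:
  assumes "open U" "surrounds_in \<Gamma> (spectrum a) U" "g holomorphic_on U"
  shows "dunford \<Gamma> a (\<lambda>z. prod_list (map (\<lambda>p. z - p) ps) * g z) =
    prod_list (map (\<lambda>p. a - p *\<^sub>C 1) ps) * dunford \<Gamma> a g"
proof (induction ps)
  case (Cons p ps)
  have h: "(\<lambda>z. prod_list (map (\<lambda>p. z - p) ps) * g z) holomorphic_on U"
  proof -
    have "(\<lambda>z. prod_list (map (\<lambda>p. z - p) ps)) holomorphic_on U"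
      by (induction ps) (auto intro!: holomorphic_intros)
    then show ?thesis using assms(3) by (rule holomorphic_on_mult)
  qed
  show ?case
    using dunford_linear_factor[OF assms(1,2) h, of p] Cons by (simp add: mult.assoc)
qed simp

lemma chain_integral_cong:
  assumes "\<And>z. z \<in> chain_trace \<Gamma> \<Longrightarrow> F z = G z"
  shows "chain_integral \<Gamma> F = chain_integral \<Gamma> G"
  unfolding chain_integral_def
proof (rule arg_cong[where f = sum_list], rule map_cong[OF refl])
  fix \<gamma> assume \<gamma>: "\<gamma> \<in> set \<Gamma>"
  show "integral {0..1} (\<lambda>t. vector_derivative \<gamma> (at t within {0..1}) *\<^sub>C F (\<gamma> t)) =
      integral {0..1} (\<lambda>t. vector_derivative \<gamma> (at t within {0..1}) *\<^sub>C G (\<gamma> t))"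
  proof (rule integral_cong)
    fix t :: real assume "t \<in> {0..1}"
    then have "\<gamma> t \<in> path_image \<gamma>" by (simp add: path_image_def)
    then have "\<gamma> t \<in> chain_trace \<Gamma>" using \<gamma> unfolding chain_trace_def by (rule UN_I[rotated])
    then show "vector_derivative \<gamma> (at t within {0..1}) *\<^sub>C F (\<gamma> t) = vector_derivative \<gamma> (at t within {0..1}) *\<^sub>C G (\<gamma> t)"
      by (simp add: assms)
  qed
qed

lemma dunford_cong:
  assumes "surrounds_in \<Gamma> (spectrum a) U" "\<And>z. z \<in> U \<Longrightarrow> g z = h z"
  shows "dunford \<Gamma> a g = dunford \<Gamma> a h"
proof -
  have "chain_trace \<Gamma> \<subseteq> U" using surrounds_in_cycle'[OF assms(1)] by (simp add: cycle_in_iff)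
  then show ?thesis
    unfolding dunford_def using assms(2) by (intro arg_cong[where f = "scaleC _"] chain_integral_cong) auto
qed

text \<open>A grid cycle shows that the choice in the definition is not void. The chosen cycle comes
  with its own neighbourhood \<open>U\<close>, and only its defining property is available.\<close>

lemma functional_calculus_eq_dunford:
  assumes "f analytic_on spectrum a"
  obtains \<Gamma> U where "open U" "spectrum a \<subseteq> U" "f holomorphic_on U" "surrounds_in \<Gamma> (spectrum a) U"
    "functional_calculus f a = dunford \<Gamma> a f"
proof -
  define \<Gamma> where "\<Gamma> = (SOME \<Gamma>. \<exists>U. open U \<and> spectrum a \<subseteq> U \<and> f holomorphic_on U \<and> surrounds_in \<Gamma> (spectrum a) U)"
  obtain U where U: "open U" "spectrum a \<subseteq> U" "f holomorphic_on U"
    using assms unfolding analytic_on_holomorphic by blast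
  obtain \<Gamma>0 where "surrounds_in \<Gamma>0 (spectrum a) U"
    by (rule grid_cycle_exists[OF compact_spectrum U(1,2)])
  then have "\<exists>\<Gamma> U. open U \<and> spectrum a \<subseteq> U \<and> f holomorphic_on U \<and> surrounds_in \<Gamma> (spectrum a) U"
    using U by blast
  then have "\<exists>U. open U \<and> spectrum a \<subseteq> U \<and> f holomorphic_on U \<and> surrounds_in \<Gamma> (spectrum a) U"
    unfolding \<Gamma>_def by (rule someI_ex)
  moreover have "functional_calculus f a = dunford \<Gamma> a f"
    unfolding functional_calculus_def dunford_def Let_def \<Gamma>_def ..
  ultimately show thesis using that by blast
qed

text \<open>The function \<open>g\<close> is zero-free on the spectrum but possibly not on
  \<open>U\<close>, so the cycle is moved into the set \<open>V\<close> where \<open>1 / g\<close>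
  is holomorphic as well; multiplicativity makes the value at \<open>1 / g\<close> an inverse of the
  value at \<open>g\<close>.\<close>

lemma functional_calculus_factor:
  assumes f: "f analytic_on spectrum a"
    and nonconst: "\<And>C. C \<in> components (spectrum a) \<Longrightarrow> \<not> f constant_on C"
  obtains ps G G' where "set ps = {z \<in> spectrum a. f z = c}"
    "functional_calculus f a - c *\<^sub>C 1 = prod_list (map (\<lambda>p. a - p *\<^sub>C 1) ps) * G"
    "G * G' = 1" "G' * G = 1" "G * a = a * G"
proof -
  let ?K = "spectrum a"
  obtain \<Gamma> U where U: "open U" "?K \<subseteq> U" and fU: "f holomorphic_on U" and \<Gamma>: "surrounds_in \<Gamma> ?K U"
    and fc: "functional_calculus f a = dunford \<Gamma> a f"
    by (rule functional_calculus_eq_dunford[OF f])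
  have fin: "finite {z \<in> ?K. f z = c}"
    by (rule finite_level_set[OF compact_spectrum U fU nonconst])
  have "(\<lambda>z. f z - c) holomorphic_on U" using fU by (intro holomorphic_intros)
  from holomorphic_factor_out_zeros[OF U fin this] obtain ps g where ps: "set ps = {z \<in> ?K. f z = c}"
    and g: "g holomorphic_on U" "\<forall>z\<in>?K. g z \<noteq> 0" and eq: "\<forall>z\<in>U. f z - c = prod_list (map (\<lambda>p. z - p) ps) * g z"
    using finite_level_set(2)[OF compact_spectrum U fU nonconst, of _ _ c] by auto
  define V where "V = U - {z \<in> U. g z = 0}"
  have VU: "V \<subseteq> U" "?K \<subseteq> V" using U(2) g(2) by (auto simp: V_def)
  have V: "open V"
  proof -
    have "V = U \<inter> g -` (- {0})" by (auto simp: V_def)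
    then show ?thesis
      using continuous_open_preimage[OF holomorphic_on_imp_continuous_on[OF g(1)] U(1), of "- {0}"] by auto
  qed
  have gV: "g holomorphic_on V" "f holomorphic_on V" using g(1) fU VU(1) by (auto intro: holomorphic_on_subset)
  have kV: "(\<lambda>z. 1 / g z) holomorphic_on V" using gV by (intro holomorphic_intros) (auto simp: V_def)
  obtain \<Delta> where \<Delta>: "surrounds_in \<Delta> ?K V"
    by (rule grid_cycle_exists[OF compact_spectrum V VU(2)])
  let ?D = "dunford \<Delta> a"
  have one: "?D (\<lambda>z. 1) = 1" by (rule dunford_one[OF V \<Delta>])
  have const: "?D (\<lambda>z. c) = c *\<^sub>C 1"
    using dunford_cmult[OF V \<Delta>, of "\<lambda>z. 1" c] one by simp
  have "functional_calculus f a - c *\<^sub>C 1 = ?D f - ?D (\<lambda>z. c)"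
    unfolding fc const by (simp only: dunford_cycle_unique[OF U(1) \<Gamma> \<Delta> V VU(1) fU])
  also have "\<dots> = ?D (\<lambda>z. f z - c)"
    using dunford_diff[OF V \<Delta> gV(2), of "\<lambda>z. c"] by simp
  also have "\<dots> = ?D (\<lambda>z. prod_list (map (\<lambda>p. z - p) ps) * g z)"
    by (rule dunford_cong[OF \<Delta>]) (use eq VU(1) in auto)
  also have "\<dots> = prod_list (map (\<lambda>p. a - p *\<^sub>C 1) ps) * ?D g"
    by (rule dunford_prod_linear[OF V \<Delta> gV(1)])
  finally have fac: "functional_calculus f a - c *\<^sub>C 1 = prod_list (map (\<lambda>p. a - p *\<^sub>C 1) ps) * ?D g" .
  have inv: "?D g * ?D (\<lambda>z. 1 / g z) = 1" "?D (\<lambda>z. 1 / g z) * ?D g = 1"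
  proof -
    have "?D (\<lambda>z. g z * (1 / g z)) = ?D (\<lambda>z. 1)" "?D (\<lambda>z. 1 / g z * g z) = ?D (\<lambda>z. 1)"
      by (rule dunford_cong[OF \<Delta>]; simp add: V_def)+
    then show "?D g * ?D (\<lambda>z. 1 / g z) = 1" "?D (\<lambda>z. 1 / g z) * ?D g = 1"
      using dunford_mult[OF V \<Delta> kV gV(1)] dunford_mult[OF V \<Delta> gV(1) kV] one by simp_all
  qed
  \<comment> \<open>The linear factor rule with root 0. Commutation of \<open>?D g\<close> with
    \<open>a\<close> is thereby inherited from commutativity of functions.\<close>
  have "?D (\<lambda>z. z) = a"
    using dunford_linear_factor[OF V \<Delta>, of "\<lambda>z. 1" 0] one by (simp add: scaleC.zero_left)
  then have comm: "?D g * a = a * ?D g"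
    using dunford_mult[OF V \<Delta> gV(1) holomorphic_on_ident] dunford_mult[OF V \<Delta> holomorphic_on_ident gV(1)]
    by (simp add: mult.commute)
  show thesis by (rule that[OF ps fac inv comm])
qed

theorem theorem2p10:
  fixes a :: "'a::complex_banach_algebra_1" and J :: "'a set" and f :: "complex \<Rightarrow> complex"
  assumes "ideal J ring_of_type_algebra"
    and "f analytic_on spectrum a"
    and "\<And>C. C \<in> components (spectrum a) \<Longrightarrow> \<not> f constant_on C"
  shows "f ` BF_spectrum J a = BF_spectrum J (functional_calculus f a)"
proof -
  \<comment> \<open>The roots in the factorization are taken from the spectrum alone; this inclusion
    ensures that no point of the B-Fredholm spectrum escapes them.\<close>
  have sub: "BF_spectrum J a \<subseteq> spectrum a"
  proof
    fix z assume "z \<in> BF_spectrum J a"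
    then have "\<not> B_Fredholm J (a - z *\<^sub>C 1)" by (simp add: BF_spectrum_def)
    then have "a - z *\<^sub>C 1 \<notin> Units ring_of_type_algebra"
      using B_Fredholm_unit[OF assms(1)] Units_ring_of_type_algebra by blast
    then show "z \<in> spectrum a" by (simp add: spectrum_def)
  qed
  \<comment> \<open>If \<open>c\<close> is not a value of \<open>f\<close> on the spectrum, the list
    of roots is empty and both sides are false.\<close>
  have key: "c \<in> BF_spectrum J (functional_calculus f a) \<longleftrightarrow> (\<exists>p\<in>spectrum a. f p = c \<and> p \<in> BF_spectrum J a)" for c
  proof -
    obtain ps G G' where ps: "set ps = {z \<in> spectrum a. f z = c}"
      and fac: "functional_calculus f a - c *\<^sub>C 1 = prod_list (map (\<lambda>p. a - p *\<^sub>C 1) ps) * G"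
      and G: "G * G' = 1" "G' * G = 1" "G * a = a * G"
      by (rule functional_calculus_factor[OF assms(2,3)])
    show ?thesis
      unfolding BF_spectrum_def mem_Collect_eq fac B_Fredholm_prod_linear_iff[OF assms(1) G] ps by blast
  qed
  show ?thesis
  proof (rule Set.set_eqI)
    fix c
    show "c \<in> f ` BF_spectrum J a \<longleftrightarrow> c \<in> BF_spectrum J (functional_calculus f a)"
      unfolding key using sub by (auto simp: image_iff)
  qed
qed

end
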